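(* Let $\delta\ge 1$ be an integer, $0<\lambda\le 1$, $\mathfrak p,\mathfrak q,\mathfrak r\ge 1$, and let $\boldsymbol\gamma=(\gamma_v)_{v\subset\mathbb N}$ be an indexed set of non-negative real numbers. Then there exists a constant $C_{\delta,q,s,\boldsymbol\gamma}>0$ such that for every function $f:[0,1)^s\to\mathbb R$ whose partial mixed derivatives up to order $\delta$ in each variable exist and are continuous, we have $$\|f\|_{\mathcal E_{s,q,\delta+\lambda,\boldsymbol\gamma}}\le C_{\delta,q,s,\boldsymbol\gamma}\,N_{\delta,\lambda,\boldsymbol\gamma}(f)$$ (the inequality being vacuous if $N_{\delta,\lambda,\boldsymbol\gamma}(f)=\infty$).
   Context: $\mathbb N=\{1,2,\dots\}$, $\mathbb N_0=\mathbb N\cup\{0\}$, $\mathcal S=\{1,\dots,s\}$. Walsh functions. Let $p$ be prime, $q=p^r$ with $r\ge 1$, $\mathbb F_q$ the field with $q$ elements, and $\varphi:\{0,\dots,q-1\}\to\mathbb F_q$ a fixed bijection with $\varphi(0)=0$. Write $\mathbb F_q=\mathbb Z_p[\theta]$ with $\mathbb Z_p$-basis $1,\theta,\dots,\theta^{r-1}$, let $\psi:\mathbb F_q\to\mathbb Z_p^r$ be the coordinate map with respect to this basis, and put $\eta=\psi\circ\varphi=(\eta_1,\dots,\eta_r)$. For $k\in\mathbb N_0$ with base $q$ expansion $k=\kappa_0+\kappa_1q+\cdots+\kappa_{m-1}q^{m-1}$ and $x\in[0,1)$ with base $q$ expansion $x=x_1q^{-1}+x_2q^{-2}+\cdots$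 (infinitely many $x_l\ne q-1$), let $\mathrm{wal}_k(x)=\exp\left(\frac{2\pi \mathrm i}{p}\sum_{l=0}^{m-1}\sum_{i=1}^r\eta_i(\kappa_l)\eta_i(x_{l+1})\right)$; for $\boldsymbol k\in\mathbb N_0^s$, $\boldsymbol x\in[0,1)^s$ let $\mathrm{wal}_{\boldsymbol k}(\boldsymbol x)=\prod_{j=1}^s\mathrm{wal}_{k_j}(x_j)$. The Walsh coefficients of $f$ are $\hat f(\boldsymbol k)=\int_{[0,1)^s}f(\boldsymbol x)\overline{\mathrm{wal}_{\boldsymbol k}(\boldsymbol x)}\,d\boldsymbol x$. The function $\mu$. For $k\in\mathbb N$ write $k=\kappa_1q^{a_1-1}+\cdots+\kappa_vq^{a_v-1}$ with $v\ge1$, $\kappa_i\in\{1,\dots,q-1\}$, $1\le a_v<\cdots<a_1$. Then $\mu_{q,\delta+\lambda}(0)=0$, $\mu_{q,\delta+\lambda}(k)=a_1+\cdots+a_v$ if $v\le\delta$, $\mu_{q,\delta+\lambda}(k)=a_1+\cdots+a_\delta+\lambda a_{\delta+1}$ if $v>\delta$; and $\mu_{q,\delta+\lambda}$ of a vector of non-negative integers is the sum of the values of its components. The Walsh space. Put $r_{q,\delta+\lambda}(\boldsymbol k)=q^{-\mu_{q,\delta+\lambda}(\boldsymbol k)}$. The space $\mathcal E_{s,q,\delta+\lambda,\boldsymbol\gamma}\subseteq L_2([0,1)^s)$ has norm $$\|f\|_{\mathcal E_{s,q,\delta+\lambda,\boldsymbol\gamma}}=\max_{u\subseteq\mathcal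 S,\ \gamma_u\ne 0}\gamma_u^{-1}\sup_{\boldsymbol k_u\in\mathbb N^{|u|}}\frac{|\hat f(\boldsymbol k_u,\boldsymbol 0_{\mathcal S\setminus u})|}{r_{q,\delta+\lambda}(\boldsymbol k_u)},$$ where $(\boldsymbol k_u,\boldsymbol 0_{\mathcal S\setminus u})$ has components $k_j$ for $j\in u$ and $0$ otherwise (for $u=\emptyset$ the supremum is $|\hat f(\boldsymbol 0)|$); for $\gamma_u=0$ the elements of the space are assumed to satisfy $\hat f(\boldsymbol k_u,\boldsymbol 0_{\mathcal S\setminus u})=0$ for all $\boldsymbol k_u\in\mathbb N^{|u|}$. In the claim, $\|f\|$ denotes the displayed expression. Variation. For a function $g:[0,1)^d\to\mathbb R$ and a box $J=\prod_{j=1}^d[x_j,y_j)$, $x_j<y_j$, with all vertices in $[0,1)^d$, let $\Delta(g,J)=\sum_{v\subseteq\{1,\dots,d\}}(-1)^{|v|}g(\boldsymbol z_v)$, where $\boldsymbol z_v$ has $j$-th coordinate $y_j$ if $j\in v$ and $x_j$ otherwise. The generalized Vitali variation is $$V^{(d)}_{\lambda,\mathfrak p}(g)=\sup_{\mathcal P}\left(\sum_{J\in\mathcal P}\mathrm{Vol}(J)\left|\frac{\Delta(g,J)}{\mathrm{Vol}(J)^\lambda}\right|^{\mathfrak p}\right)^{1/\mathfrak p},$$ the supremum being over all finite partitions $\mathcal P$ of $[0,1)^d$ into subintervals (boxes), where boxes having a vertex outside $[0,1)^d$ are omitted from the sum. For a function $g$ of variables indexed by a finite set $u$ and $w\subseteq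 u$, let $g_w$ be the function of $\boldsymbol x_w=(x_j)_{j\in w}$ obtained by integrating $g$ over $[0,1)$ in all variables $x_j$, $j\in u\setminus w$ (existence of these integrals is part of the requirement that the variation be finite); let $V^{(|w|)}_{\lambda,\mathfrak p}(g_w;w)$ be its generalized Vitali variation if $w\ne\emptyset$, and $|g_\emptyset|$ if $w=\emptyset$. The generalized Hardy and Krause variation (all weights $1$) is $V^{(|u|)}_{\lambda,\mathfrak p,\mathfrak q,\boldsymbol 1}(g)=\left(\sum_{w\subseteq u}V^{(|w|)}_{\lambda,\mathfrak p}(g_w;w)^{\mathfrak q}\right)^{1/\mathfrak q}$. The functional $N$. For $\boldsymbol\tau\in\{0,\dots,\delta\}^s$ let $f^{(\boldsymbol\tau)}=\frac{\partial^{\tau_1+\cdots+\tau_s}f}{\partial x_1^{\tau_1}\cdots\partial x_s^{\tau_s}}$ (one-sided at $0$), $u(\boldsymbol\tau)=\{j:\tau_j=\delta\}$, $v(\boldsymbol\tau)=\{j:\tau_j>0\}$. Then $$N_{\delta,\lambda,\boldsymbol\gamma}(f)=\left(\sum_{\boldsymbol\tau\in\{0,\dots,\delta\}^s}\gamma_{v(\boldsymbol\tau)}^{-1}\left[V^{(|u(\boldsymbol\tau)|)}_{\lambda,\mathfrak p,\mathfrak q,\boldsymbol 1}\bigl(f^{(\boldsymbol\tau)}(\cdot,\boldsymbol 0_{\mathcal S\setminus u(\boldsymbol\tau)})\bigr)\right]^{\mathfrak r}\right)^{1/\mathfrak r},$$ where $f^{(\boldsymbol\tau)}(\cdot,\boldsymbol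 0_{\mathcal S\setminus u(\boldsymbol\tau)})$ is the function of the variables $x_j$, $j\in u(\boldsymbol\tau)$, with all other variables set to $0$, and for $u(\boldsymbol\tau)=\emptyset$ the bracket is $|f^{(\boldsymbol\tau)}(\boldsymbol 0)|$. If $\gamma_{v(\boldsymbol\tau)}=0$ the bracket is assumed to be $0$ and $0/0:=0$ (so $N=\infty$ otherwise). *)

theory Defs
  imports "HOL-Analysis.Analysis" "HOL-Computational_Algebra.Primes"
begin

text \<open>
  A point of \<open>[0,1)\<^sup>u\<close> for a finite index set \<open>u\<close> is an extensional function on \<open>u\<close>, so that
  functions of the variables \<open>x\<^sub>j\<close>, \<open>j \<in> u\<close>, can be treated for all subsets \<open>u\<close> of
  \<open>{1..s}\<close> at the same time. A function on \<open>[0,1)\<^sup>u\<close> is represented by a total function of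
  which only the values on \<open>cube u\<close> matter.
\<close>

definition cube :: "nat set \<Rightarrow> (nat \<Rightarrow> real) set" where
  "cube u = (\<Pi>\<^sub>E j\<in>u. {0..<1})"

definition cube_measure :: "nat set \<Rightarrow> (nat \<Rightarrow> real) measure" where
  "cube_measure u = (\<Pi>\<^sub>M j\<in>u. restrict_space lborel {0..<1})"

text \<open>
  In a field with \<open>p ^ r\<close> elements the prime field consists of the elements \<open>of_nat n\<close>, \<open>n < p\<close>;
  coordinates in \<open>\<int>\<^sub>p\<close> are given by their representatives in \<open>{0..<p}\<close>.
\<close>

definition is_coords :: "nat \<Rightarrow> nat \<Rightarrow> 'a::field \<Rightarrow> 'a \<Rightarrow> (nat \<Rightarrow> nat) \<Rightarrow> bool" where
  "is_coords p r \<theta> x c \<longleftrightarrow>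
     c \<in> (\<Pi>\<^sub>E i\<in>{1..r}. {..<p}) \<and> x = (\<Sum>i = 1..r. of_nat (c i) * \<theta> ^ (i - 1))"

definition power_basis :: "nat \<Rightarrow> nat \<Rightarrow> 'a::field \<Rightarrow> bool" where
  "power_basis p r \<theta> \<longleftrightarrow> (\<forall>x. \<exists>!c. is_coords p r \<theta> x c)"

definition coords :: "nat \<Rightarrow> nat \<Rightarrow> 'a::field \<Rightarrow> 'a \<Rightarrow> nat \<Rightarrow> nat" where
  "coords p r \<theta> x = (THE c. is_coords p r \<theta> x c)"

definition eta :: "nat \<Rightarrow> nat \<Rightarrow> 'a::field \<Rightarrow> (nat \<Rightarrow> 'a) \<Rightarrow> nat \<Rightarrow> nat \<Rightarrow> nat" where
  "eta p r \<theta> \<phi> a i = coords p r \<theta> (\<phi> a) i"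

text \<open>The coefficient \<open>\<kappa>\<^sub>l\<close> of \<open>q ^ l\<close> in the base \<open>q\<close> expansion of \<open>k\<close>.\<close>

definition nat_digit :: "nat \<Rightarrow> nat \<Rightarrow> nat \<Rightarrow> nat" where
  "nat_digit q k l = (k div q ^ l) mod q"

text \<open>
  The coefficient \<open>x\<^sub>l\<close> of \<open>q\<close> to the power \<open>- l\<close>, for \<open>l \<ge> 1\<close>. Taking floors selects the
  expansion in which infinitely many digits differ from \<open>q - 1\<close>.
\<close>

definition real_digit :: "nat \<Rightarrow> real \<Rightarrow> nat \<Rightarrow> nat" where
  "real_digit q x l = nat \<lfloor>x * real q ^ l\<rfloor> mod q"

text \<open>
  The argument \<open>\<eta>\<close> is \<open>eta p r \<theta> \<phi>\<close>. The indices \<open>l\<close> with \<open>q ^ l \<le> k\<close> are those of the base \<open>q\<close>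
  digits of \<open>k\<close> up to the leading one.
\<close>

definition wal1 :: "nat \<Rightarrow> nat \<Rightarrow> (nat \<Rightarrow> nat \<Rightarrow> nat) \<Rightarrow> nat \<Rightarrow> real \<Rightarrow> complex" where
  "wal1 p r \<eta> k x =
     exp (2 * of_real pi * \<i> / of_nat p *
       of_nat (\<Sum>l | (p ^ r) ^ l \<le> k. \<Sum>i = 1..r.
         \<eta> (nat_digit (p ^ r) k l) i * \<eta> (real_digit (p ^ r) x (l + 1)) i))"

definition wal :: "nat \<Rightarrow> nat \<Rightarrow> (nat \<Rightarrow> nat \<Rightarrow> nat) \<Rightarrow> nat \<Rightarrow> (nat \<Rightarrow> nat) \<Rightarrow> (nat \<Rightarrow> real) \<Rightarrow> complex"
  where "wal p r \<eta> s k x = (\<Prod>j = 1..s. wal1 p r \<eta> (k j) (x j))"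

definition walsh_coeff ::
    "nat \<Rightarrow> nat \<Rightarrow> (nat \<Rightarrow> nat \<Rightarrow> nat) \<Rightarrow> nat \<Rightarrow> ((nat \<Rightarrow> real) \<Rightarrow> real) \<Rightarrow> (nat \<Rightarrow> nat) \<Rightarrow> complex"
  where "walsh_coeff p r \<eta> s f k =
    (LINT x|cube_measure {1..s}. complex_of_real (f x) * cnj (wal p r \<eta> s k x))"

text \<open>The list \<open>[a\<^sub>1, \<dots>, a\<^sub>v]\<close> with \<open>a\<^sub>1 > \<dots> > a\<^sub>v \<ge> 1\<close>; empty for \<open>k = 0\<close>.\<close>

definition digit_positions :: "nat \<Rightarrow> nat \<Rightarrow> nat list" where
  "digit_positions q k = rev (sorted_list_of_set {a. 1 \<le> a \<and> nat_digit q k (a - 1) \<noteq> 0})"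

text \<open>Lists are indexed from \<open>0\<close>, so \<open>ps ! \<delta>\<close> is the position \<open>a\<close> with index \<open>\<delta> + 1\<close>.\<close>

definition mu1 :: "nat \<Rightarrow> nat \<Rightarrow> real \<Rightarrow> nat \<Rightarrow> real" where
  "mu1 q \<delta> lam k =
     (let ps = digit_positions q k in
      if length ps \<le> \<delta> then real (sum_list ps)
      else real (sum_list (take \<delta> ps)) + lam * real (ps ! \<delta>))"

definition mu :: "nat \<Rightarrow> nat \<Rightarrow> real \<Rightarrow> nat set \<Rightarrow> (nat \<Rightarrow> nat) \<Rightarrow> real" where
  "mu q \<delta> lam u k = (\<Sum>j\<in>u. mu1 q \<delta> lam (k j))"

definition walsh_decay :: "nat \<Rightarrow> nat \<Rightarrow> real \<Rightarrow> nat set \<Rightarrow> (nat \<Rightarrow> nat) \<Rightarrow> real" where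
  "walsh_decay q \<delta> lam u k = real q powr (- mu q \<delta> lam u k)"

text \<open>
  The maximum over a finite set of sets \<open>u\<close> is written as a supremum in \<open>[0,\<infinity>]\<close>; it is \<open>0\<close> if all
  weights vanish.
\<close>

definition walsh_norm ::
    "nat \<Rightarrow> nat \<Rightarrow> (nat \<Rightarrow> nat \<Rightarrow> nat) \<Rightarrow> nat \<Rightarrow> nat \<Rightarrow> real \<Rightarrow> (nat set \<Rightarrow> real) \<Rightarrow>
      ((nat \<Rightarrow> real) \<Rightarrow> real) \<Rightarrow> ennreal"
  where "walsh_norm p r \<eta> s \<delta> lam \<gamma> f =
    (SUP u \<in> {u. u \<subseteq> {1..s} \<and> \<gamma> u \<noteq> 0}.
       ennreal (inverse (\<gamma> u)) *
       (SUP k \<in> (\<Pi>\<^sub>E j\<in>u. {1..}).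
          ennreal (norm (walsh_coeff p r \<eta> s f (\<lambda>j. if j \<in> u then k j else 0)) /
                   walsh_decay (p ^ r) \<delta> lam u k)))"

definition epowr :: "ennreal \<Rightarrow> real \<Rightarrow> ennreal" where
  "epowr x a = (if x = \<infinity> then \<infinity> else ennreal (enn2real x powr a))"

text \<open>A pair \<open>(x, y)\<close> stands for the box with sides \<open>[x\<^sub>j, y\<^sub>j)\<close>.\<close>

type_synonym pbox = "(nat \<Rightarrow> real) \<times> (nat \<Rightarrow> real)"

definition box_set :: "nat set \<Rightarrow> pbox \<Rightarrow> (nat \<Rightarrow> real) set" where
  "box_set u J = (\<Pi>\<^sub>E j\<in>u. {fst J j..<snd J j})"

definition box_vol :: "nat set \<Rightarrow> pbox \<Rightarrow> real" where
  "box_vol u J = (\<Prod>j\<in>u. snd J j - fst J j)"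

definition box_vertex :: "nat set \<Rightarrow> pbox \<Rightarrow> nat set \<Rightarrow> nat \<Rightarrow> real" where
  "box_vertex u J v = (\<lambda>j\<in>u. if j \<in> v then snd J j else fst J j)"

definition box_diff :: "nat set \<Rightarrow> ((nat \<Rightarrow> real) \<Rightarrow> real) \<Rightarrow> pbox \<Rightarrow> real" where
  "box_diff u g J = (\<Sum>v\<in>Pow u. (- 1) ^ card v * g (box_vertex u J v))"

definition box_partition :: "nat set \<Rightarrow> pbox set \<Rightarrow> bool" where
  "box_partition u P \<longleftrightarrow>
     finite P \<and>
     (\<forall>J\<in>P. fst J \<in> extensional u \<and> snd J \<in> extensional u \<and> (\<forall>j\<in>u. fst J j < snd J j)) \<and>
     disjoint_family_on (box_set u) P \<and>
     (\<Union>J\<in>P. box_set u J) = cube u"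

definition vitali_variation ::
    "real \<Rightarrow> real \<Rightarrow> nat set \<Rightarrow> ((nat \<Rightarrow> real) \<Rightarrow> real) \<Rightarrow> ennreal"
  where "vitali_variation lam \<pp> u g =
    (SUP P \<in> {P. box_partition u P}.
       ennreal ((\<Sum>J | J \<in> P \<and> (\<forall>v\<subseteq>u. box_vertex u J v \<in> cube u).
         box_vol u J * \<bar>box_diff u g J / box_vol u J powr lam\<bar> powr \<pp>) powr (1 / \<pp>)))"

definition marginal ::
    "nat set \<Rightarrow> nat set \<Rightarrow> ((nat \<Rightarrow> real) \<Rightarrow> real) \<Rightarrow> (nat \<Rightarrow> real) \<Rightarrow> real"
  where "marginal u w g x = (LINT y|cube_measure (u - w). g (merge w (u - w) (x, y)))"

definition marginals_exist :: "nat set \<Rightarrow> ((nat \<Rightarrow> real) \<Rightarrow> real) \<Rightarrow> bool" where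
  "marginals_exist u g \<longleftrightarrow>
     (\<forall>w\<subseteq>u. \<forall>x\<in>cube w. integrable (cube_measure (u - w)) (\<lambda>y. g (merge w (u - w) (x, y))))"

text \<open>For \<open>w = {}\<close> the argument of the marginal is the only point of \<open>cube {}\<close>.\<close>

definition hk_variation ::
    "real \<Rightarrow> real \<Rightarrow> real \<Rightarrow> nat set \<Rightarrow> ((nat \<Rightarrow> real) \<Rightarrow> real) \<Rightarrow> ennreal"
  where "hk_variation lam \<pp> \<qq> u g =
    (if marginals_exist u g then
       epowr (\<Sum>w\<in>Pow u.
         epowr (if w = {} then ennreal \<bar>marginal u {} g (\<lambda>_. undefined)\<bar>
                else vitali_variation lam \<pp> w (marginal u w g)) \<qq>) (1 / \<qq>)
     else \<infinity>)"

text \<open>Derivatives are taken within \<open>[0,1)\<close>, hence one-sided at \<open>0\<close>.\<close>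

definition partial_deriv :: "nat \<Rightarrow> ((nat \<Rightarrow> real) \<Rightarrow> real) \<Rightarrow> (nat \<Rightarrow> real) \<Rightarrow> real" where
  "partial_deriv j f x = vector_derivative (\<lambda>t. f (x(j := t))) (at (x j) within {0..<1})"

text \<open>The variables are listed in the order of the denominator; the last one is applied first.\<close>

definition iterated_deriv :: "nat list \<Rightarrow> ((nat \<Rightarrow> real) \<Rightarrow> real) \<Rightarrow> (nat \<Rightarrow> real) \<Rightarrow> real" where
  "iterated_deriv js f = foldr partial_deriv js f"

definition mixed_deriv ::
    "nat \<Rightarrow> (nat \<Rightarrow> nat) \<Rightarrow> ((nat \<Rightarrow> real) \<Rightarrow> real) \<Rightarrow> (nat \<Rightarrow> real) \<Rightarrow> real"
  where "mixed_deriv s \<tau> f = iterated_deriv (concat (map (\<lambda>j. replicate (\<tau> j) j) [1..<s + 1])) f"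

text \<open>
  Existence and continuity of the mixed partial derivatives up to order \<open>\<delta>\<close> in each variable,
  taken in any order.
\<close>

definition mixed_differentiable :: "nat \<Rightarrow> nat \<Rightarrow> ((nat \<Rightarrow> real) \<Rightarrow> real) \<Rightarrow> bool" where
  "mixed_differentiable s \<delta> f \<longleftrightarrow>
     (\<forall>js. set js \<subseteq> {1..s} \<and> (\<forall>j. count_list js j \<le> \<delta>) \<longrightarrow>
        continuous_on (cube {1..s}) (iterated_deriv js f) \<and>
        (\<forall>j\<in>{1..s}. count_list js j < \<delta> \<longrightarrow>
           (\<forall>x\<in>cube {1..s}.
              (\<lambda>t. iterated_deriv js f (x(j := t))) differentiable (at (x j) within {0..<1}))))"

definition zero_extend :: "nat \<Rightarrow> nat set \<Rightarrow> (nat \<Rightarrow> real) \<Rightarrow> nat \<Rightarrow> real" where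
  "zero_extend s u x = (\<lambda>j\<in>{1..s}. if j \<in> u then x j else 0)"

definition top_vars :: "nat \<Rightarrow> nat \<Rightarrow> (nat \<Rightarrow> nat) \<Rightarrow> nat set" where
  "top_vars s \<delta> \<tau> = {j\<in>{1..s}. \<tau> j = \<delta>}"

definition active_vars :: "nat \<Rightarrow> (nat \<Rightarrow> nat) \<Rightarrow> nat set" where
  "active_vars s \<tau> = {j\<in>{1..s}. \<tau> j > 0}"

definition N_bracket ::
    "nat \<Rightarrow> nat \<Rightarrow> real \<Rightarrow> real \<Rightarrow> real \<Rightarrow> ((nat \<Rightarrow> real) \<Rightarrow> real) \<Rightarrow> (nat \<Rightarrow> nat) \<Rightarrow> ennreal"
  where "N_bracket s \<delta> lam \<pp> \<qq> f \<tau> =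
    (let u = top_vars s \<delta> \<tau> in
     if u = {} then ennreal \<bar>mixed_deriv s \<tau> f (\<lambda>j\<in>{1..s}. 0)\<bar>
     else hk_variation lam \<pp> \<qq> u (\<lambda>x. mixed_deriv s \<tau> f (zero_extend s u x)))"

text \<open>
  In the type \<open>ennreal\<close> one has \<open>0 / 0 = 0\<close> and \<open>b / 0 = \<infinity>\<close> for \<open>b \<noteq> 0\<close>, which is the convention
  for vanishing weights.
\<close>

definition N_functional ::
    "nat \<Rightarrow> nat \<Rightarrow> real \<Rightarrow> real \<Rightarrow> real \<Rightarrow> real \<Rightarrow> (nat set \<Rightarrow> real) \<Rightarrow>
      ((nat \<Rightarrow> real) \<Rightarrow> real) \<Rightarrow> ennreal"
  where "N_functional s \<delta> lam \<pp> \<qq> \<rr> \<gamma> f =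
    epowr (\<Sum>\<tau> \<in> (\<Pi>\<^sub>E j\<in>{1..s}. {0..\<delta>}).
      epowr (N_bracket s \<delta> lam \<pp> \<qq> f \<tau>) \<rr> / ennreal (\<gamma> (active_vars s \<tau>))) (1 / \<rr>)"

end

theory Submission
  imports Defs "HOL-Probability.Infinite_Product_Measure"
begin

text \<open>
  Taylor's formula in each variable writes \<open>f\<close> as a sum over \<open>\<tau>\<close> of integrals of
  \<open>f\<^sup>(\<^sup>\<tau>\<^sup>)(t, 0)\<close>, with \<open>t\<close> indexed by the \<open>j\<close> with \<open>\<tau>\<^sub>j = \<delta>\<close>, against products of truncated
  powers and monomials.
  By Fubini, the Walsh coefficients of \<open>f\<close> are integrals of the same derivatives against products of
  the iterated tail integrals \<open>K\<^sup>n(t) = \<integral>\<^sub>t\<^sup>1 K\<^sup>n\<^sup>-\<^sup>1\<close> of conjugated Walsh functions.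

  If \<open>a\<^sub>1 > a\<^sub>2 > \<dots>\<close> are the positions of the non-zero digits of \<open>k\<close>, a shift in the digit \<open>a\<^sub>i\<close> of the
  argument multiplies the Walsh function by a factor, and these factors sum to \<open>0\<close>. Hence it has mean
  zero on the \<open>q\<close>-adic cells of length \<open>q\<close> to the power \<open>1 - a\<^sub>1\<close>, and its tail integral is smaller by
  this length and still equivariant for the positions \<open>a\<^sub>2, a\<^sub>3, \<dots>\<close>. Iterating this gives the decay
  in \<open>a\<^sub>1 + \<dots> + a\<^sub>\<delta>\<close>, and mean zero on the cells of position \<open>a\<close> with index \<open>\<delta> + 1\<close>.

  A product of bounded kernels with mean zero on cells only sees the increments of \<open>g\<close> over boxes with
  one corner at the left end of a cell. For a fixed relative position of the other corner the boxes in
  different cells are disjoint, so the power mean inequality bounds the sum of the increments by the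
  variation, and the factor \<open>Vol\<close> to the power \<open>\<lambda>\<close> gives the gain \<open>\<lambda> a\<close> in the exponent.
\<close>

section \<open>Digit shifts and tail integrals\<close>

text \<open>A Taylor term with \<open>\<tau>\<^sub>j < \<delta>\<close> brings in a tail integral at
  0. It vanishes as long as \<open>k\<^sub>j\<close> has more than \<open>\<tau>\<^sub>j\<close>
  non-zero digits; if it survives, all the digits have been spent and the full sum of their
  positions is available. So both cases of \<open>\<mu>\<close> are met. The top derivatives are
  continuous only on the half-open cube and may be unbounded. Their integrability, also on slices
  through left ends of cells, which form null sets, comes from the marginals that a finite variation
  requires. Constants: \<open>q\<close> to the power \<open>1 - a\<close> in place of
  \<open>- a\<close> costs \<open>q\<close> for each of at most \<open>\<delta> + 1\<close>
  positions. In each remainder variable 8 comes from the boxes, 2 from subtracting the mean of the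
  kernel and 2 from the choice between mean and oscillation, hence 32. Inequalities with constants
  uniform in the exponents make \<open>C\<close> independent of \<open>lam\<close>,
  \<open>\<pp>\<close>, \<open>\<qq>\<close>, \<open>\<rr>\<close>. As \<open>C\<close> may depend
  on \<open>\<gamma>\<close>, the weights of \<open>N_functional\<close> and of the Walsh norm need
  not be matched: every \<open>\<tau>\<close> may contribute to every \<open>u\<close>.\<close>

abbreviation unit_lborel :: "real measure" where
  "unit_lborel \<equiv> restrict_space lborel {0..<1}"

text \<open>Testing only arguments whose digit \<open>a\<close> is 0 avoids carries:
  \<open>x + d / q ^ a\<close> then differs from \<open>x\<close> in that one digit. In the
  applications \<open>\<omega> d\<close> is a conjugated character value.\<close>

definition digit_equivariant :: "nat \<Rightarrow> nat \<Rightarrow> (nat \<Rightarrow> complex) \<Rightarrow> (real \<Rightarrow> complex) \<Rightarrow> bool" where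
  "digit_equivariant q a \<omega> H \<longleftrightarrow>
     (\<forall>x\<in>{0..<1}. \<forall>d<q. real_digit q x a = 0 \<longrightarrow> H (x + real d / real q ^ a) = \<omega> d * H x)"

section \<open>Arithmetic of the base \<open>q\<close> digits of a real number\<close>

lemma nat_floor_div_power:
  assumes "q \<ge> 2" "x \<ge> 0" "l \<le> a"
  shows "nat \<lfloor>x * real q ^ l\<rfloor> = nat \<lfloor>x * real q ^ a\<rfloor> div q ^ (a - l)"
proof -
  have "x * real q ^ l = x * real q ^ a / real_of_int (int q ^ (a - l))"
  proof -
    have "real q ^ a = real q ^ l * real q ^ (a - l)" using assms by (simp flip: power_add)
    then show ?thesis using assms by simp
  qed
  also have "\<lfloor>\<dots>\<rfloor> = \<lfloor>x * real q ^ a\<rfloor> div (int q ^ (a - l))"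
    by (rule floor_divide_real_eq_div) auto
  finally show ?thesis
    using assms by (simp add: nat_div_distrib nat_power_eq)
qed

text \<open>A zero digit \<open>a\<close> means that the floor of \<open>x * q ^ a\<close> is a
  multiple of \<open>q\<close>. Adding \<open>d < q\<close> to it produces no carry into earlier
  digits, and the floors for later digits change by multiples of \<open>q\<close>.\<close>

lemma real_digit_shift:
  assumes "q \<ge> 2" "x \<ge> 0" "d < q" "real_digit q x a = 0"
  shows "real_digit q (x + real d / real q ^ a) l = (if l = a then d else real_digit q x l)"
proof -
  let ?y = "x + real d / real q ^ a"
  have y0: "?y \<ge> 0" using assms by simp
  have up: "nat \<lfloor>?y * real q ^ l\<rfloor> = nat \<lfloor>x * real q ^ l\<rfloor> + d * q ^ (l - a)" if "a \<le> l" for l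
  proof -
    have "real q ^ l = real q ^ a * real q ^ (l - a)" using that by (simp flip: power_add)
    then have "?y * real q ^ l = x * real q ^ l + of_int (int (d * q ^ (l - a)))"
      using assms by (simp add: distrib_right)
    then have "\<lfloor>?y * real q ^ l\<rfloor> = \<lfloor>x * real q ^ l\<rfloor> + int (d * q ^ (l - a))"
      by (metis floor_add_int)
    then show ?thesis using assms
      by (metis nat_add_distrib nat_int of_nat_0_le_iff zero_le_floor zero_le_mult_iff zero_le_power)
  qed
  consider "l = a" | "a < l" | "l < a" by linarith
  then show ?thesis
  proof cases
    case 1
    then have "real_digit q (x + real d / real q ^ a) l = (nat \<lfloor>x * real q ^ a\<rfloor> mod q + d) mod q"
      using up[of a] by (simp add: real_digit_def mod_add_left_eq)
    then show ?thesis using 1 assms by (simp add: real_digit_def)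
  next
    case 2
    then have "q dvd d * q ^ (l - a)" by simp
    then obtain c where "d * q ^ (l - a) = q * c" by blast
    then show ?thesis using up[of l] 2 unfolding real_digit_def by simp
  next
    case 3
    let ?X = "nat \<lfloor>x * real q ^ a\<rfloor>"
    obtain m where m: "?X = q * m"
      using assms(4) unfolding real_digit_def by auto
    have e: "q ^ (a - l) = q * q ^ (a - l - 1)"
      using 3 by (metis Suc_diff_Suc diff_Suc_1 power_Suc)
    have "(q * m + d) div q ^ (a - l) = (q * m) div q ^ (a - l)"
      using assms(3) unfolding e div_mult2_eq by simp
    then have "nat \<lfloor>?y * real q ^ l\<rfloor> = nat \<lfloor>x * real q ^ l\<rfloor>"
      using nat_floor_div_power[OF assms(1) y0, of l a] nat_floor_div_power[OF assms(1,2), of l a]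
        up[of a] 3 m by simp
    then show ?thesis using 3 by (simp add: real_digit_def)
  qed
qed

text \<open>The floor of \<open>x * q ^ a\<close> is a multiple of \<open>q\<close> below
  \<open>q ^ a\<close>, which is itself a multiple of \<open>q\<close>. Hence there is room for
  \<open>q\<close> more, and a shift by \<open>d < q\<close> stays inside the unit interval.\<close>

lemma real_digit_less_1: "q \<ge> 2 \<Longrightarrow> x \<ge> 0 \<Longrightarrow> x < 1 \<Longrightarrow> d < q \<Longrightarrow> a \<ge> 1 \<Longrightarrow> real_digit q x a = 0
  \<Longrightarrow> x + real d / real q ^ a < 1"
proof -
  assume *: "q \<ge> 2" "x \<ge> 0" "x < 1" "d < q" "a \<ge> 1" "real_digit q x a = 0"
  define X where "X = nat \<lfloor>x * real q ^ a\<rfloor>"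
  obtain m where m: "X = q * m"
    using *(6) unfolding real_digit_def X_def by auto
  have "real X \<le> x * real q ^ a" "x * real q ^ a < real X + 1" using * by (auto simp: X_def)
  moreover have "x * real q ^ a < real q ^ a" using * by simp
  ultimately have "real X < real (q ^ a)" by (metis le_less_trans less_trans of_nat_power)
  then have "q * m < q * q ^ (a - 1)" using m * by (metis of_nat_less_iff power_eq_if not_one_le_zero)
  then have "m < q ^ (a-1)" using * by simp
  then have "q * (m + 1) \<le> q * q ^ (a - 1)" using * by (metis Suc_eq_plus1 Suc_leI mult_le_mono2)
  also have "\<dots> = q ^ a" using * by (metis power_eq_if not_one_le_zero)
  finally have "X + q \<le> q ^ a" using m by simp
  then have "X + (d + 1) \<le> q ^ a" using * by linarith
  then have "real X + real d + 1 \<le> real q ^ a"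
    by (metis (mono_tags) of_nat_le_iff of_nat_add of_nat_1 of_nat_power add.assoc)
  then have "x * real q ^ a + real d < real q ^ a"
    using \<open>x * real q ^ a < real X + 1\<close> by simp
  then show ?thesis using * by (simp add: field_simps)
qed

lemma real_digit_eq_on_cell:
  assumes "q \<ge> 2" "0 \<le> x" "0 \<le> y" "l \<le> m" "\<lfloor>x * real q ^ m\<rfloor> = \<lfloor>y * real q ^ m\<rfloor>"
  shows "real_digit q x l = real_digit q y l"
  using nat_floor_div_power[OF assms(1,2,4)] nat_floor_div_power[OF assms(1,3,4)] assms(5)
  by (simp add: real_digit_def)

section \<open>Integrals over half-open intervals, and functions with mean zero on cells\<close>

lemma set_integral_lborel_shift:
  fixes H :: "real \<Rightarrow> complex"
  shows "(LINT x:{a + c..<b + c}|lborel. H x) = (LINT x:{a..<b}|lborel. H (x + c))"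
proof -
  have "(LINT x:{a + c..<b + c}|lborel. H x) =
        (\<integral>x. indicator {a + c..<b + c} (c + 1 * x) *\<^sub>R H (c + 1 * x) \<partial>lborel)"
    unfolding set_lebesgue_integral_def by (subst lborel_integral_real_affine[where c = 1 and t = c]) auto
  also have "\<dots> = (LINT x:{a..<b}|lborel. H (x + c))"
    unfolding set_lebesgue_integral_def
    by (intro Bochner_Integration.integral_cong) (auto simp: indicator_def add.commute)
  finally show ?thesis .
qed

lemma set_integral_split:
  fixes H :: "real \<Rightarrow> complex"
  assumes "set_integrable lborel {a..<c} H" "a \<le> b" "b \<le> c"
  shows "(LINT x:{a..<c}|lborel. H x) = (LINT x:{a..<b}|lborel. H x) + (LINT x:{b..<c}|lborel. H x)"
proof -
  have "{a..<c} = {a..<b} \<union> {b..<c}" "{a..<b} \<inter> {b..<c} = {}" using assms by auto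
  moreover have "set_integrable lborel {a..<b} H" "set_integrable lborel {b..<c} H"
    using assms by (auto intro!: set_integrable_subset[OF assms(1)])
  ultimately show ?thesis by (metis set_integral_Un)
qed

lemma set_integral_cells:
  fixes H :: "real \<Rightarrow> complex"
  assumes "set_integrable lborel {a..<a + real n * h} H" "h \<ge> 0"
  shows "(LINT x:{a..<a + real n * h}|lborel. H x) =
    (\<Sum>d<n. LINT x:{a + real d * h..<a + real d * h + h}|lborel. H x)"
  using assms(1)
proof (induction n)
  case 0
  then show ?case by (simp add: set_lebesgue_integral_def)
next
  case (Suc n)
  have le: "a + real n * h \<le> a + real (Suc n) * h" "a \<le> a + real n * h"
    using assms(2) by (auto simp: algebra_simps)
  have "set_integrable lborel {a..<a + real n * h} H"
    using le by (intro set_integrable_subset[OF Suc.prems]) auto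
  then show ?case using Suc.IH set_integral_split[OF Suc.prems le(2,1)]
    by (simp add: algebra_simps)
qed

abbreviation cell :: "nat \<Rightarrow> nat \<Rightarrow> real set" where
  "cell n i \<equiv> {real i / real n..<(real i + 1) / real n}"

text \<open>Since \<open>H\<close> has mean zero on the cells, its tail integral from \<open>t\<close> can be cut off at the right end of
  the cell of \<open>t\<close>. Changing a digit before position \<open>a\<close> translates cells to cells.\<close>

locale equivariant_function =
  fixes q a :: nat and \<omega> :: "nat \<Rightarrow> complex" and H :: "real \<Rightarrow> complex" and B :: real
  assumes q: "q \<ge> 2" and a: "a \<ge> 1"
    and equivariant: "digit_equivariant q a \<omega> H"
    and sum0: "(\<Sum>d<q. \<omega> d) = 0"
    and meas: "H \<in> borel_measurable unit_lborel"
    and bound: "\<And>x. x \<in> {0..<1} \<Longrightarrow> norm (H x) \<le> B"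
begin

abbreviation N :: nat where "N \<equiv> q ^ (a - 1)"

lemma Npos: "real N > 0" using q by simp

lemma N_le: "i < N \<Longrightarrow> (real i + 1) / real N \<le> 1"
proof -
  assume "i < N"
  then have "real (i + 1) \<le> real N" by (metis Suc_eq_plus1 Suc_leI of_nat_le_iff)
  then show ?thesis using Npos by (simp add: field_simps)
qed

lemma set_integrable_H:
  assumes "A \<in> sets lborel" "A \<subseteq> {0..<1}"
  shows "set_integrable lborel A H"
proof -
  have "integrable unit_lborel H"
    by (intro finite_measure.integrable_const_bound[where B = B] finite_measureI AE_I2)
       (auto simp: meas bound space_restrict_space emeasure_restrict_space)
  then have "set_integrable lborel {0..<1} H"
    by (simp add: integrable_restrict_space set_integrable_def)
  then show ?thesis using assms by (rule set_integrable_subset)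
qed

lemma cell_mean_zero:
  assumes "i < N"
  shows "(LINT x:cell N i|lborel. H x) = 0"
proof -
  define h where "h = 1 / real q ^ a"
  have qa: "real q ^ a = real N * real q"
    using a by (metis of_nat_power power_minus_mult zero_less_one_class.zero_less_one less_le_trans zero_less_iff_neq_zero not_one_le_zero)
  have h: "h > 0" "real q * h = 1 / real N" using q qa by (auto simp: h_def field_simps)
  define x0 where "x0 = real i / real N"
  have e: "(real i + 1) / real N = x0 + real q * h"
    using h unfolding x0_def by (simp add: add_divide_distrib)
  have x1: "x0 + real q * h \<le> 1" using N_le[OF assms] e by simp
  have x00: "x0 \<ge> 0" by (simp add: x0_def)
  \<comment> \<open>The cell has length \<open>q * h\<close> and consists of \<open>q\<close> pieces
    of length \<open>h\<close>. Digit \<open>a\<close> equals \<open>d\<close> on the piece number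
    \<open>d\<close>, whose integral is therefore \<open>\<omega> d\<close> times that of the first
    piece.\<close>
  have "(LINT x:{x0..<x0 + real q * h}|lborel. H x) =
      (\<Sum>d<q. LINT x:{x0 + real d * h..<x0 + real d * h + h}|lborel. H x)"
    using x1 x00 h by (intro set_integral_cells set_integrable_H) auto
  also have "\<dots> = (\<Sum>d<q. \<omega> d * (LINT x:{x0..<x0 + h}|lborel. H x))"
  proof (intro sum.cong refl)
    fix d assume d: "d \<in> {..<q}"
    have "(LINT x:{x0 + real d * h..<x0 + real d * h + h}|lborel. H x) =
          (LINT x:{x0..<x0 + h}|lborel. H (x + real d * h))"
      using set_integral_lborel_shift[of x0 "real d * h" "x0 + h" H] by (simp add: algebra_simps)
    also have "\<dots> = (LINT x:{x0..<x0 + h}|lborel. \<omega> d * H x)"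
    proof (intro set_lebesgue_integral_cong allI impI)
      fix x assume x: "x \<in> {x0..<x0 + h}"
      have "h * 1 \<le> h * real q" using q h by (intro mult_left_mono) auto
      then have "x0 + h \<le> 1" using x1 by (simp add: mult.commute)
      then have x01: "0 \<le> x" "x < 1" using x x00 by auto
      have "x * real q ^ a \<ge> real (i * q)" "x * real q ^ a < real (i * q) + 1"
      proof -
        have "x0 * real q ^ a = real (i * q)" unfolding x0_def qa using Npos by simp
        moreover have "h * real q ^ a = 1" using q by (simp add: h_def)
        moreover have "x0 * real q ^ a \<le> x * real q ^ a" "x * real q ^ a < (x0 + h) * real q ^ a"
          using x q by (auto intro!: mult_right_mono mult_strict_right_mono)
        ultimately show "x * real q ^ a \<ge> real (i * q)" "x * real q ^ a < real (i * q) + 1"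
          by (auto simp: algebra_simps)
      qed
      then have "\<lfloor>x * real q ^ a\<rfloor> = int (i * q)"
        by (metis floor_unique of_int_of_nat_eq)
      then have "real_digit q x a = 0" by (simp add: real_digit_def nat_mult_distrib)
      then show "H (x + real d * h) = \<omega> d * H x"
        using equivariant x01 d unfolding digit_equivariant_def by (auto simp: h_def)
    qed auto
    finally show "(LINT x:{x0 + real d * h..<x0 + real d * h + h}|lborel. H x) =
      \<omega> d * (LINT x:{x0..<x0 + h}|lborel. H x)" by simp
  qed
  also have "\<dots> = 0" using sum0 by (simp flip: sum_distrib_right)
  finally show ?thesis using e x0_def by simp
qed

definition tail :: "real \<Rightarrow> complex" where
  "tail t = (LINT x:{t..<1}|lborel. H x)"

lemma tail_at_cell: "i \<le> N \<Longrightarrow> (LINT x:{real i / real N..<1}|lborel. H x) = 0"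
proof (induction "N - i" arbitrary: i)
  case 0
  then have "i = N" by simp
  then have "{real i / real N..<1} = {}" using Npos by auto
  then show ?case by (simp add: set_lebesgue_integral_def)
next
  case (Suc m)
  then have i: "i < N" by simp
  have "(LINT x:{real i / real N..<1}|lborel. H x) = 
    (LINT x:cell N i|lborel. H x) +
    (LINT x:{real (Suc i) / real N..<1}|lborel. H x)"
    using set_integral_split[of "real i / real N" 1 H "(real i + 1) / real N"] N_le[OF i] Npos
    by (simp add: set_integrable_H divide_right_mono add.commute)
  also have "(LINT x:{real (Suc i) / real N..<1}|lborel. H x) = 0"
    using Suc by (intro Suc.hyps(1)) auto
  finally show ?case using cell_mean_zero[OF i] by simp
qed

lemma cell_of:
  assumes "0 \<le> t" "t < 1"
  obtains i where "i < N" "\<lfloor>t * real N\<rfloor> = int i" "real i / real N \<le> t" "t < (real i + 1) / real N"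
proof -
  define i where "i = nat \<lfloor>t * real N\<rfloor>"
  have f: "\<lfloor>t * real N\<rfloor> = int i" using assms Npos by (simp add: i_def)
  have le: "real i \<le> t * real N" "t * real N < real i + 1" using f by linarith+
  have "t * real N < real N" using assms Npos by simp
  then have "i < N" using le by linarith
  then show ?thesis using that f le Npos by (simp add: field_simps)
qed

lemma tail_eq_cell:
  assumes "0 \<le> t" "i < N" "real i / real N \<le> t" "t < (real i + 1) / real N"
  shows "tail t = (LINT x:{t..<(real i + 1) / real N}|lborel. H x)"
proof -
  have "tail t = (LINT x:{t..<(real i + 1) / real N}|lborel. H x) +
     (LINT x:{(real i + 1) / real N..<1}|lborel. H x)"
    unfolding tail_def using assms N_le[OF assms(2)]
    by (intro set_integral_split set_integrable_H) auto
  then show ?thesis using tail_at_cell[of "Suc i"] assms by (simp add: add.commute)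
qed

lemma tail_0: "tail 0 = 0"
  using tail_at_cell[of 0] by (simp add: tail_def)

lemma norm_tail:
  assumes "t \<in> {0..<1}"
  shows "norm (tail t) \<le> B / real N"
proof -
  obtain i where i: "i < N" "real i / real N \<le> t" "t < (real i + 1) / real N"
    using cell_of assms by (metis atLeastLessThan_iff)
  let ?A = "{t..<(real i + 1) / real N}"
  have sub: "?A \<subseteq> {0..<1}" using assms N_le[OF i(1)] by auto
  have B0: "B \<ge> 0" using bound[of 0] norm_ge_zero[of "H 0"] by (simp del: norm_ge_zero)
  have "norm (tail t) \<le> (LINT x:?A|lborel. norm (H x))"
    using assms i set_integrable_H[OF _ sub]
    by (subst tail_eq_cell[of _ i]) (auto intro: set_integral_norm_bound)
  also have "\<dots> \<le> (LINT x:?A|lborel. B)"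
  proof (intro set_integral_mono set_integrable_norm set_integrable_H sub)
    show "set_integrable lborel ?A (\<lambda>x. B)"
      unfolding set_integrable_def using i
      by (intro integrable_scaleR_left integrable_real_indicator) simp_all
  qed (use bound sub in auto)
  also have "\<dots> = ((real i + 1) / real N - t) * B"
  proof -
    have "measure lborel ?A = (real i + 1) / real N - t"
      by (rule measure_lborel_Ico) (use i in simp)
    moreover have "(LINT x:?A|lborel. B) = measure lborel ?A *\<^sub>R B"
      by (rule set_integral_const) (use i in simp_all)
    ultimately show ?thesis by simp
  qed
  also have "\<dots> \<le> (1 / real N) * B"
    using i B0 by (intro mult_right_mono) (auto simp: add_divide_distrib)
  finally show ?thesis by simp
qed

lemma tail_equivariant:
  assumes "1 \<le> a'" "a' < a" "digit_equivariant q a' \<omega>' H"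
  shows "digit_equivariant q a' \<omega>' tail"
  unfolding digit_equivariant_def
proof (intro ballI allI impI)
  fix t :: real and d :: nat
  assume t: "t \<in> {0..<1}" and d: "d < q" and dig: "real_digit q t a' = 0"
  obtain i where i: "i < N" "\<lfloor>t * real N\<rfloor> = int i" "real i / real N \<le> t" "t < (real i + 1) / real N"
    using cell_of t by (metis atLeastLessThan_iff)
  define c where "c = real d / real q ^ a'"
  define m where "m = d * q ^ (a - 1 - a')"
  have c: "c = real m / real N" 
  proof -
    have "N = q ^ a' * q ^ (a - 1 - a')" using assms by (simp flip: power_add)
    then show ?thesis using q unfolding c_def m_def by simp
  qed
  have c0: "c \<ge> 0" by (simp add: c_def)
  have t1: "t + c < 1" unfolding c_def using real_digit_less_1[OF q _ _ d assms(1) dig] t by auto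
  have imN: "i + m < N"
  proof -
    have "(real i + real m) / real N \<le> t + c" using i c by (simp add: add_divide_distrib)
    then have "(real i + real m) / real N < 1" using t1 by simp
    then show ?thesis using Npos by (simp add: field_simps flip: of_nat_add of_nat_power)
  qed
  have "tail (t + c) = (LINT x:{t + c..<(real (i + m) + 1) / real N}|lborel. H x)"
    using i t c0 imN by (intro tail_eq_cell) (auto simp: c add_divide_distrib)
  also have "(real (i + m) + 1) / real N = (real i + 1) / real N + c"
    by (simp add: c add_divide_distrib)
  also have "(LINT x:{t + c..<(real i + 1) / real N + c}|lborel. H x) =
      (LINT x:{t..<(real i + 1) / real N}|lborel. H (x + c))"
    by (rule set_integral_lborel_shift)
  also have "\<dots> = (LINT x:{t..<(real i + 1) / real N}|lborel. \<omega>' d * H x)"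
  proof (intro set_lebesgue_integral_cong allI impI)
    fix x assume x: "x \<in> {t..<(real i + 1) / real N}"
    have x01: "x \<in> {0..<1}" using x t N_le[OF i(1)] by auto
    have "real i / real N \<le> x" "x < (real i + 1) / real N" using x i by auto
    then have "real i \<le> x * real N" "x * real N < real i + 1" 
      using Npos by (simp_all add: field_simps)
    then have "\<lfloor>x * real q ^ (a - 1)\<rfloor> = int i" by (simp add: floor_eq_iff)
    \<comment> \<open>The cell is determined by the first \<open>a - 1\<close> digits and
      \<open>a' \<le> a - 1\<close>, so digit \<open>a'\<close> is 0 on the whole interval of
      integration, as it is at \<open>t\<close>.\<close>
    then have "real_digit q x a' = real_digit q t a'"
      using assms t x01 i(2) by (intro real_digit_eq_on_cell[OF q, where m = "a - 1"]) auto
    then show "H (x + c) = \<omega>' d * H x"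
      using assms(3) x01 d dig unfolding digit_equivariant_def c_def by auto
  qed auto
  finally show "tail (t + real d / real q ^ a') = \<omega>' d * tail t"
    using i t by (simp add: c_def tail_eq_cell[of t i])
qed

end

section \<open>Walsh functions\<close>

lemma prob_space_unit_lborel: "prob_space unit_lborel"
  by (rule prob_spaceI) (simp add: space_restrict_space emeasure_restrict_space)

lemma integrable_unit_lborel:
  fixes H :: "real \<Rightarrow> 'b::{banach, second_countable_topology}"
  assumes "H \<in> borel_measurable unit_lborel" "\<And>x. x \<in> {0..<1} \<Longrightarrow> norm (H x) \<le> B"
  shows "integrable unit_lborel H"
proof -
  interpret prob_space unit_lborel by (rule prob_space_unit_lborel)
  show ?thesis
    using assms by (intro integrable_const_bound[where B = B] AE_I2) (auto simp: space_restrict_space)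
qed

lemma tail_integral_unit:
  fixes H :: "real \<Rightarrow> 'b::{banach, second_countable_topology}"
  assumes "0 \<le> t"
  shows "(LINT x:{t..<1}|lborel. H x) = (LINT x|unit_lborel. (if t \<le> x then H x else 0))"
proof -
  have "(LINT x|unit_lborel. (if t \<le> x then H x else 0)) =
      (LINT x|lborel. indicator {0..<1} x *\<^sub>R (if t \<le> x then H x else 0))"
    by (rule integral_restrict_space) simp
  also have "\<dots> = (LINT x:{t..<1}|lborel. H x)"
    unfolding set_lebesgue_integral_def
    by (rule Bochner_Integration.integral_cong) (use assms in \<open>auto split: split_indicator\<close>)
  finally show ?thesis ..
qed

lemma tail_integral_measurable:
  fixes H :: "real \<Rightarrow> complex"
  assumes [measurable]: "H \<in> borel_measurable unit_lborel"
  shows "(\<lambda>t. LINT x:{t..<1}|lborel. H x) \<in> borel_measurable unit_lborel"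
proof -
  interpret prob_space unit_lborel by (rule prob_space_unit_lborel)
  have [measurable]: "(\<lambda>x. x) \<in> borel_measurable unit_lborel"
    by (rule measurable_restrict_space1) simp
  have "(\<lambda>t. LINT x|unit_lborel. (if t \<le> x then H x else 0)) \<in> borel_measurable unit_lborel"
    by (rule borel_measurable_lebesgue_integral) measurable
  then show ?thesis
    by (subst measurable_cong[OF tail_integral_unit]) (auto simp: space_restrict_space)
qed

lemma tail_integral_bound:
  fixes H :: "real \<Rightarrow> complex"
  assumes "H \<in> borel_measurable unit_lborel" "\<And>x. x \<in> {0..<1} \<Longrightarrow> norm (H x) \<le> B" "t \<in> {0..<1}"
  shows "norm (LINT x:{t..<1}|lborel. H x) \<le> B"
proof -
  interpret prob_space unit_lborel by (rule prob_space_unit_lborel)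
  have B0: "B \<ge> 0" using assms(2)[of 0] norm_ge_zero[of "H 0"] by (simp del: norm_ge_zero)
  have "norm (LINT x:{t..<1}|lborel. H x) \<le> (LINT x|unit_lborel. norm (if t \<le> x then H x else 0))"
    using assms by (simp add: tail_integral_unit)
  also have "\<dots> \<le> B"
  proof (cases "integrable unit_lborel (\<lambda>x. norm (if t \<le> x then H x else 0))")
    case True
    then show ?thesis
      using B0 assms by (intro integral_le_const) (auto simp: space_restrict_space)
  next
    case False
    then show ?thesis using B0 by (simp add: not_integrable_integral_eq)
  qed
  finally show ?thesis .
qed

primrec tail_integral :: "(real \<Rightarrow> complex) \<Rightarrow> nat \<Rightarrow> real \<Rightarrow> complex" where
  "tail_integral w 0 = w"
| "tail_integral w (Suc n) = (\<lambda>t. LINT x:{t..<1}|lborel. tail_integral w n x)"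

lemma power_integral_unit:
  fixes t x :: real
  assumes "0 \<le> t" "x < 1"
  shows "(LINT y|unit_lborel. (if t \<le> y \<and> y \<le> x then (x - y) ^ n / fact n else 0)) =
     (if t \<le> x then (x - t) ^ Suc n / fact (Suc n) else 0)"
proof -
  have "(LINT y|unit_lborel. (if t \<le> y \<and> y \<le> x then (x - y) ^ n / fact n else 0)) =
        (LINT y|lborel. indicator {0..<1} y *\<^sub>R (if t \<le> y \<and> y \<le> x then (x - y) ^ n / fact n else 0))"
    by (rule integral_restrict_space) simp
  also have "\<dots> = (LINT y|lborel. (x - y) ^ n / fact n * indicator {t..x} y)"
    by (rule Bochner_Integration.integral_cong) (use assms in \<open>auto split: split_indicator\<close>)
  also have "\<dots> = (if t \<le> x then (x - t) ^ Suc n / fact (Suc n) else 0)"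
  proof (cases "t \<le> x")
    case True
    have "(LINT y|lborel. (x - y) ^ n / fact n * indicator {t..x} y) =
       - ((x - x) ^ Suc n / fact (Suc n)) - (- ((x - t) ^ Suc n / fact (Suc n)))"
    proof (rule integral_FTC_Icc_real[OF True])
      fix y :: real
      have "((\<lambda>y. - ((x - y) ^ Suc n / fact (Suc n))) has_real_derivative
         - (real (Suc n) * (x - y) ^ n * (0 - 1) / fact (Suc n))) (at y)"
        by (rule derivative_eq_intros refl | simp)+
      moreover have "- (real (Suc n) * (x - y) ^ n * (0 - 1) / fact (Suc n)) = (x - y) ^ n / fact n"
        by (simp add: field_simps del: of_nat_Suc)
      ultimately show "((\<lambda>y. - ((x - y) ^ Suc n / fact (Suc n))) has_real_derivative (x - y) ^ n / fact n) (at y)"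
        by simp
    qed (auto intro!: continuous_intros)
    then show ?thesis using True by simp
  next
    case False
    then show ?thesis by simp
  qed
  finally show ?thesis .
qed

text \<open>Cauchy's formula for repeated integration, by induction with Fubini. Read from right to
  left, it turns an integral against the kernel of a Taylor remainder into an iterated tail
  integral.\<close>

lemma tail_integral_formula:
  assumes w: "w \<in> borel_measurable unit_lborel" "\<And>x. x \<in> {0..<1} \<Longrightarrow> norm (w x) \<le> B"
    and "t \<in> {0..<1}"
  shows "tail_integral w (Suc n) t =
    (LINT x|unit_lborel. of_real (if t \<le> x then (x - t) ^ n / fact n else 0) * w x)"
  using assms(3)
proof (induction n arbitrary: t)
  case 0
  then show ?case
    by (auto simp: tail_integral_unit intro!: Bochner_Integration.integral_cong)
next
  case (Suc n)
  interpret prob_space unit_lborel by (rule prob_space_unit_lborel)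
  interpret P: pair_prob_space unit_lborel unit_lborel ..
  note w(1)[measurable]
  have [measurable]: "(\<lambda>x. x) \<in> borel_measurable unit_lborel"
    by (rule measurable_restrict_space1) simp
  have B0: "B \<ge> 0" using w(2)[of 0] norm_ge_zero[of "w 0"] by (simp del: norm_ge_zero)
  define F where "F = (\<lambda>y x. of_real (if t \<le> y \<and> y \<le> x then (x - y) ^ n / fact n else 0) * w x)"
  have int: "integrable (unit_lborel \<Otimes>\<^sub>M unit_lborel) (\<lambda>(y, x). F y x)"
  proof (intro P.P.integrable_const_bound[where B = B] AE_I2)
    show "(\<lambda>(y, x). F y x) \<in> borel_measurable (unit_lborel \<Otimes>\<^sub>M unit_lborel)"
      unfolding F_def by measurable
    fix z assume "z \<in> space (unit_lborel \<Otimes>\<^sub>M unit_lborel)"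
    then obtain y x where z: "z = (y, x)" "y \<in> {0..<1}" "x \<in> {0..<1}"
      by (auto simp: space_pair_measure space_restrict_space)
    have "(x - y) ^ n / fact n \<le> 1" if "y \<le> x"
    proof -
      have "(x - y) ^ n \<le> 1" using that z by (intro power_le_one) auto
      moreover have "(1::real) \<le> fact n" by (rule fact_ge_1)
      ultimately have "(x - y) ^ n \<le> fact n" by (rule order_trans)
      then show ?thesis by (simp add: divide_le_eq)
    qed
    then have "norm (F y x) \<le> 1 * B"
      unfolding F_def norm_mult using z w(2) B0 by (intro mult_mono) auto
    then show "norm (case z of (y, x) \<Rightarrow> F y x) \<le> B" using z by simp
  qed
  have "tail_integral w (Suc (Suc n)) t = 
     (LINT y|unit_lborel. (if t \<le> y then tail_integral w (Suc n) y else 0))"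
    using Suc.prems by (subst tail_integral.simps(2)) (rule tail_integral_unit, simp)
  also have "\<dots> = (LINT y|unit_lborel. LINT x|unit_lborel. F y x)"
  proof (intro Bochner_Integration.integral_cong refl)
    fix y assume "y \<in> space unit_lborel"
    then have y: "y \<in> {0..<1}" by (simp add: space_restrict_space)
    show "(if t \<le> y then tail_integral w (Suc n) y else 0) = (LINT x|unit_lborel. F y x)"
      unfolding Suc.IH[OF y] F_def by (auto intro!: Bochner_Integration.integral_cong)
  qed
  also have "\<dots> = (LINT x|unit_lborel. LINT y|unit_lborel. F y x)"
    using P.Fubini_integral[OF int] by simp
  also have "\<dots> = (LINT x|unit_lborel. of_real (if t \<le> x then (x - t) ^ Suc n / fact (Suc n) else 0) * w x)"
  proof (intro Bochner_Integration.integral_cong refl)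
    fix x assume "x \<in> space unit_lborel"
    then have x: "x \<in> {0..<1}" by (simp add: space_restrict_space)
    have "(LINT y|unit_lborel. F y x) = 
      of_real (LINT y|unit_lborel. (if t \<le> y \<and> y \<le> x then (x - y) ^ n / fact n else 0)) * w x"
      unfolding F_def by (simp only: integral_mult_left_zero integral_complex_of_real)
    then show "(LINT y|unit_lborel. F y x) =
      of_real (if t \<le> x then (x - t) ^ Suc n / fact (Suc n) else 0) * w x"
      using x Suc.prems by (subst (asm) power_integral_unit) auto
  qed
  finally show ?case .
qed

section \<open>Characters of the finite field, and Walsh functions as products over digits\<close>

locale walsh_system =
  fixes p r :: nat and \<theta> :: "'a::{field,finite}" and \<phi> :: "nat \<Rightarrow> 'a"
  assumes p: "prime p" and r: "r \<ge> 1" and card: "CARD('a) = p ^ r"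
    and basis: "power_basis p r \<theta>"
    and bij: "bij_betw \<phi> {0..p ^ r - 1} UNIV" and \<phi>0: "\<phi> 0 = 0"
begin

abbreviation q :: nat where "q \<equiv> p ^ r"
abbreviation \<eta> :: "nat \<Rightarrow> nat \<Rightarrow> nat" where "\<eta> \<equiv> eta p r \<theta> \<phi>"

lemma q2: "q \<ge> 2"
proof -
  have "p \<ge> 2" using p prime_ge_2_nat by blast
  moreover from this have "p ^ 1 \<le> p ^ r" using r by (intro power_increasing) auto
  ultimately show ?thesis by simp
qed

text \<open>An additive character of the field, expressed through digits: the standard pairing of
  the coordinate vectors of \<open>\<phi> \<kappa>\<close> and \<open>\<phi> d\<close> modulo
  \<open>p\<close>.\<close>

definition character :: "nat \<Rightarrow> nat \<Rightarrow> complex" where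
  "character \<kappa> d = exp (2 * of_real pi * \<i> / of_nat p * of_nat (\<Sum>i = 1..r. \<eta> \<kappa> i * \<eta> d i))"

lemma finite_exponents: "finite {l. q ^ l \<le> k}"
proof (rule finite_subset)
  show "{l. q ^ l \<le> k} \<subseteq> {..k}"
  proof
    fix l assume "l \<in> {l. q ^ l \<le> k}"
    moreover have "l < q ^ l" using q2 by (intro power_gt_expt) auto
    ultimately show "l \<in> {..k}" by simp
  qed
qed simp

lemma wal1_eq_prod:
  "wal1 p r \<eta> k x = (\<Prod>l | q ^ l \<le> k. character (nat_digit q k l) (real_digit q x (l + 1)))"
  unfolding wal1_def character_def
  by (simp add: exp_sum[OF finite_exponents] sum_distrib_left)

lemma norm_character [simp]: "norm (character \<kappa> d) = 1"
  unfolding character_def by (simp add: norm_exp_eq_Re)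

lemma norm_wal1 [simp]: "norm (wal1 p r \<eta> k x) = 1"
  by (simp add: wal1_eq_prod flip: prod_norm)

lemma coords: "is_coords p r \<theta> x (coords p r \<theta> x)"
  using basis unfolding power_basis_def coords_def by (metis theI')

lemma coords_eq: "is_coords p r \<theta> x c \<Longrightarrow> coords p r \<theta> x = c"
  using basis coords unfolding power_basis_def by metis

lemma bij_coords: "bij_betw (coords p r \<theta>) UNIV (\<Pi>\<^sub>E i\<in>{1..r}. {..<p})"
proof (rule bij_betwI')
  fix x y show "(coords p r \<theta> x = coords p r \<theta> y) = (x = y)"
    using coords[of x] coords[of y] by (auto simp: is_coords_def)
next
  fix x show "coords p r \<theta> x \<in> (\<Pi>\<^sub>E i\<in>{1..r}. {..<p})"
    using coords[of x] unfolding is_coords_def by blast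
next
  fix c assume "c \<in> (\<Pi>\<^sub>E i\<in>{1..r}. {..<p})"
  then have "is_coords p r \<theta> (\<Sum>i = 1..r. of_nat (c i) * \<theta> ^ (i - 1)) c"
    by (simp add: is_coords_def)
  from coords_eq[OF this] show "\<exists>x\<in>UNIV. c = coords p r \<theta> x"
    by (intro bexI[of _ "\<Sum>i = 1..r. of_nat (c i) * \<theta> ^ (i - 1)"]) simp_all
qed

lemma eta_0: "i \<in> {1..r} \<Longrightarrow> \<eta> 0 i = 0"
proof -
  assume i: "i \<in> {1..r}"
  have "is_coords p r \<theta> 0 (\<lambda>i\<in>{1..r}. 0)"
    using p by (auto simp: is_coords_def prime_gt_0_nat)
  from coords_eq[OF this] show ?thesis using i \<phi>0 by (simp add: eta_def)
qed

lemma character_0 [simp]: "character 0 d = 1" "character \<kappa> 0 = 1"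
  by (simp_all add: character_def eta_0)

text \<open>The bijections \<open>\<phi>\<close> and \<open>coords\<close> turn the sum over digits
  into a sum over all coordinate vectors, which factors into one geometric sum per coordinate. A
  non-zero digit has a non-zero coordinate \<open>i\<close>, and there the sum runs over all powers
  of a \<open>p\<close>-th root of unity different from 1.\<close>

lemma character_sum:
  assumes "0 < \<kappa>" "\<kappa> < q"
  shows "(\<Sum>d<q. character \<kappa> d) = 0"
proof -
  have "\<phi> \<kappa> \<noteq> 0"
  proof
    assume "\<phi> \<kappa> = 0"
    then have "\<kappa> = 0"
      using bij \<phi>0 assms by (intro inj_onD[of \<phi> "{0..q - 1}" \<kappa> 0]) (auto simp: bij_betw_def)
    then show False using assms by simp
  qed
  have "\<exists>i\<in>{1..r}. \<eta> \<kappa> i \<noteq> 0"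
  proof (rule ccontr)
    assume "\<not> ?thesis"
    then have "\<phi> \<kappa> = (\<Sum>i = 1..r. of_nat 0 * \<theta> ^ (i - 1))"
      using coords[of "\<phi> \<kappa>"] by (simp add: is_coords_def eta_def)
    then show False using \<open>\<phi> \<kappa> \<noteq> 0\<close> by simp
  qed
  then obtain i where i: "i \<in> {1..r}" "\<eta> \<kappa> i \<noteq> 0" by blast
  have ip: "\<eta> \<kappa> i < p" using coords[of "\<phi> \<kappa>"] i by (auto simp: is_coords_def eta_def PiE_iff)
  define z where "z = (\<lambda>j. exp (2 * of_real pi * \<i> * of_nat (\<eta> \<kappa> j) / of_nat p))"
  have p1: "p \<ge> 1" using p prime_ge_1_nat by blast
  have "z i ^ p = 1" unfolding z_def using p1 by (intro complex_root_unity) auto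
  moreover have "z i \<noteq> 1"
    unfolding z_def using complex_root_unity_eq_1[OF p1, of "\<eta> \<kappa> i"] i ip
    by (auto dest: dvd_imp_le)
  ultimately have zi: "(\<Sum>c<p. z i ^ c) = 0" by (simp add: sum_gp_strict)
  have e: "{..<q} = {0..q - 1}" using q2 by auto
  have "(\<Sum>d<q. character \<kappa> d) = 
    (\<Sum>d\<in>{0..q-1}. (\<lambda>c. \<Prod>j\<in>{1..r}. z j ^ c j) (coords p r \<theta> (\<phi> d)))"
    unfolding e
  proof (intro sum.cong refl)
    fix d
    show "character \<kappa> d = (\<lambda>c. \<Prod>j\<in>{1..r}. z j ^ c j) (coords p r \<theta> (\<phi> d))"
    proof -
      have "character \<kappa> d =
          exp (\<Sum>j\<in>{1..r}. of_nat (\<eta> d j) * (2 * of_real pi * \<i> * of_nat (\<eta> \<kappa> j) / of_nat p))"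
        unfolding character_def of_nat_sum of_nat_mult sum_distrib_left
        by (intro arg_cong[where f = exp] sum.cong) (simp_all add: ac_simps)
      also have "\<dots> = (\<Prod>j\<in>{1..r}. exp (of_nat (\<eta> d j) * (2 * of_real pi * \<i> * of_nat (\<eta> \<kappa> j) / of_nat p)))"
        by (rule exp_sum) simp
      also have "\<dots> = (\<Prod>j\<in>{1..r}. z j ^ \<eta> d j)"
        unfolding z_def exp_of_nat_mult ..
      finally show ?thesis by (simp add: eta_def)
    qed
  qed
  also have "\<dots> = (\<Sum>x\<in>UNIV. (\<lambda>c. \<Prod>j\<in>{1..r}. z j ^ c j) (coords p r \<theta> x))"
    by (rule sum.reindex_bij_betw[OF bij])
  also have "\<dots> = (\<Sum>c\<in>(\<Pi>\<^sub>E i\<in>{1..r}. {..<p}). \<Prod>j\<in>{1..r}. z j ^ c j)"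
    by (rule sum.reindex_bij_betw[OF bij_coords])
  also have "\<dots> = (\<Prod>j\<in>{1..r}. \<Sum>c<p. z j ^ c)"
    by (rule prod_sum_PiE[symmetric]) auto
  also have "\<dots> = 0" using i zi by (intro prod_zero) auto
  finally show ?thesis .
qed

text \<open>Only the factor of digit \<open>a\<close> changes, from
  \<open>character \<kappa> 0 = 1\<close> to \<open>character \<kappa> d\<close>. The condition on
  \<open>k\<close> guarantees that this factor occurs in the product.\<close>

lemma wal1_equivariant:
  assumes "a \<ge> 1" "q ^ (a - 1) \<le> k"
  shows "digit_equivariant q a (\<lambda>d. cnj (character (nat_digit q k (a - 1)) d)) (\<lambda>x. cnj (wal1 p r \<eta> k x))"
  unfolding digit_equivariant_def
proof (intro ballI allI impI)
  fix x :: real and d assume x: "x \<in> {0..<1}" and d: "d < q" and 0: "real_digit q x a = 0"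
  let ?S = "{l. q ^ l \<le> k}"
  have aS: "a - 1 \<in> ?S" using assms by simp
  let ?f = "\<lambda>x l. character (nat_digit q k l) (real_digit q x (l + 1))"
  have "wal1 p r \<eta> k (x + real d / real q ^ a) = 
      ?f (x + real d / real q ^ a) (a - 1) * (\<Prod>l\<in>?S - {a - 1}. ?f (x + real d / real q ^ a) l)"
    unfolding wal1_eq_prod using prod.remove[OF finite_exponents aS] by simp
  also have "?f (x + real d / real q ^ a) (a - 1) = character (nat_digit q k (a - 1)) d"
    using real_digit_shift[OF q2 _ d 0, of a] x assms by simp
  also have "(\<Prod>l\<in>?S - {a - 1}. ?f (x + real d / real q ^ a) l) = (\<Prod>l\<in>?S - {a - 1}. ?f x l)"
    using real_digit_shift[OF q2 _ d 0] x assms by (intro prod.cong refl) auto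
  also have "\<dots> = wal1 p r \<eta> k x"
    unfolding wal1_eq_prod by (subst prod.remove[OF finite_exponents aS]) (use 0 assms in simp)
  finally show "cnj (wal1 p r \<eta> k (x + real d / real q ^ a)) = 
     cnj (character (nat_digit q k (a - 1)) d) * cnj (wal1 p r \<eta> k x)" by simp
qed

lemma wal1_measurable [measurable]: "wal1 p r \<eta> k \<in> borel_measurable borel"
proof -
  have [measurable]: "(\<lambda>x. character \<kappa> (real_digit q x l)) \<in> borel_measurable borel" for \<kappa> l
  proof -
    have "(\<lambda>x. real_digit q x l) \<in> measurable borel (count_space UNIV)"
      unfolding real_digit_def by measurable
    from measurable_compose[OF this, of "character \<kappa>" borel] show ?thesis by simp
  qed
  show ?thesis unfolding wal1_eq_prod[abs_def] by measurable
qed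

end

section \<open>Walsh kernels\<close>

lemma digit_positions:
  assumes "q \<ge> 2"
  shows "set (digit_positions q k) = {a. 1 \<le> a \<and> nat_digit q k (a - 1) \<noteq> 0}"
    and "sorted_wrt (>) (digit_positions q k)"
proof -
  have "{a. 1 \<le> a \<and> nat_digit q k (a - 1) \<noteq> 0} \<subseteq> {..Suc k}"
  proof
    fix a assume a: "a \<in> {a. 1 \<le> a \<and> nat_digit q k (a - 1) \<noteq> 0}"
    then have "k div q ^ (a - 1) \<noteq> 0" by (auto simp: nat_digit_def intro: Nat.gr0I)
    then have "q ^ (a - 1) \<le> k" by (metis div_less not_le)
    moreover have "a - 1 < q ^ (a - 1)" using assms by (intro power_gt_expt) auto
    ultimately show "a \<in> {..Suc k}" by simp
  qed
  then have fin: "finite {a. 1 \<le> a \<and> nat_digit q k (a - 1) \<noteq> 0}"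
    using finite_subset by blast
  then show "set (digit_positions q k) = {a. 1 \<le> a \<and> nat_digit q k (a - 1) \<noteq> 0}"
    by (simp add: digit_positions_def)
  show "sorted_wrt (>) (digit_positions q k)"
    unfolding digit_positions_def by (simp add: sorted_wrt_rev)
qed

lemma prod_inverse_powers:
  assumes "q \<ge> (2::nat)" "n \<le> length ps" "\<And>i. i < length ps \<Longrightarrow> ps ! i \<ge> 1"
  shows "(\<Prod>i<n. 1 / real q ^ (ps ! i - 1)) = real q ^ n * real q powr - real (sum_list (take n ps))"
  using assms(2)
proof (induction n)
  case 0
  then show ?case using assms by simp
next
  case (Suc n)
  obtain m where m: "ps ! n = Suc m"
    using assms(3)[of n] Suc.prems by (cases "ps ! n") auto
  have "1 / real q ^ (ps ! n - 1) = real q * real q powr - real (ps ! n)"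
    using assms(1) unfolding m by (simp add: powr_minus powr_realpow field_simps del: of_nat_Suc)
  moreover have "real q powr - real (sum_list (take (Suc n) ps)) =
      real q powr - real (sum_list (take n ps)) * real q powr - real (ps ! n)"
    using Suc.prems by (simp add: take_Suc_conv_app_nth flip: powr_add)
  ultimately show ?case using Suc by simp
qed

text \<open>Each of the \<open>n\<close> factors is \<open>q\<close> times the wanted decay;
  bounding \<open>q ^ n\<close> by \<open>q ^ \<delta>\<close> makes this loss independent of the
  number of digits.\<close>

lemma prod_inverse_powers_le:
  assumes "q \<ge> (2::nat)" "n \<le> length ps" "n \<le> \<delta>" "\<And>i. i < length ps \<Longrightarrow> ps ! i \<ge> 1"
  shows "(\<Prod>i<n. 1 / real q ^ (ps ! i - 1)) \<le> real q ^ \<delta> * real q powr - real (sum_list (take n ps))"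
proof -
  have "(\<Prod>i<n. 1 / real q ^ (ps ! i - 1)) = real q ^ n * real q powr - real (sum_list (take n ps))"
    using assms(1,2,4) by (rule prod_inverse_powers)
  also have "\<dots> \<le> real q ^ \<delta> * real q powr - real (sum_list (take n ps))"
    using assms(1,3) by (intro mult_right_mono power_increasing) auto
  finally show ?thesis .
qed

text \<open>The loss is \<open>q powr lam\<close>, replaced by \<open>q\<close> to be uniform in
  \<open>lam\<close>.\<close>

lemma power_pred_powr_le:
  assumes "q \<ge> (2::nat)" "a \<ge> 1" "0 < lam" "lam \<le> 1"
  shows "real (q ^ (a - 1)) powr - lam \<le> real q * real q powr (- lam * real a)"
proof -
  have "real (q ^ (a - 1)) = real q powr (real a - 1)"
    using assms by (simp add: of_nat_diff flip: powr_realpow)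
  then have "real (q ^ (a - 1)) powr - lam = real q powr (lam + - lam * real a)"
    by (simp add: powr_powr algebra_simps)
  also have "\<dots> = real q powr lam * real q powr (- lam * real a)"
    by (simp only: powr_add)
  also have "\<dots> \<le> real q * real q powr (- lam * real a)"
    using assms powr_mono[of lam 1 "real q"] by (intro mult_right_mono) auto
  finally show ?thesis .
qed

context walsh_system
begin

lemma q_ge_1: "1 \<le> real q"
proof -
  have "real 1 \<le> real q" using q2 unfolding of_nat_le_iff by linarith
  then show ?thesis by simp
qed

lemma cnj_wal1_measurable [measurable]: "(\<lambda>x. cnj (wal1 p r \<eta> k x)) \<in> borel_measurable borel"
  by (rule measurable_compose[OF wal1_measurable borel_measurable_continuous_onI])
     (intro continuous_intros)

lemma nat_digit_less: "nat_digit q k l < q"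
  unfolding nat_digit_def using q2 by (intro mod_less_divisor) linarith

definition kernel :: "nat \<Rightarrow> nat \<Rightarrow> real \<Rightarrow> complex" where
  "kernel k = tail_integral (\<lambda>x. cnj (wal1 p r \<eta> k x))"

lemma kernel_Suc: "kernel k (Suc n) = (\<lambda>t. LINT x:{t..<1}|lborel. kernel k n x)"
  by (simp add: kernel_def)

lemma kernel_measurable [measurable]: "kernel k n \<in> borel_measurable unit_lborel"
proof (induction n)
  case 0
  then show ?case unfolding kernel_def tail_integral.simps
    by (intro measurable_restrict_space1) measurable
next
  case (Suc n)
  then show ?case unfolding kernel_Suc by (rule tail_integral_measurable)
qed

lemma kernel_formula:
  assumes "t \<in> {0..<1}"
  shows "kernel k (Suc n) t = (LINT x|unit_lborel.
     of_real (if t \<le> x then (x - t) ^ n / fact n else 0) * cnj (wal1 p r \<eta> k x))"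
  unfolding kernel_def
  by (rule tail_integral_formula[OF _ _ assms, where B = 1])
     (auto intro!: measurable_restrict_space1)

abbreviation pos :: "nat \<Rightarrow> nat list" where "pos k \<equiv> digit_positions q k"
text \<open>Product of the cell lengths that belong to the first \<open>n\<close> positions of
  non-zero digits: the total gain after \<open>n\<close> tail integrals.\<close>

abbreviation posfac :: "nat \<Rightarrow> nat \<Rightarrow> real" where
  "posfac k n \<equiv> (\<Prod>i<n. 1 / real q ^ (pos k ! i - 1))"

lemma pos_nth:
  assumes "i < length (pos k)"
  shows "pos k ! i \<ge> 1" "nat_digit q k (pos k ! i - 1) \<noteq> 0"
  using digit_positions(1)[OF q2, of k] nth_mem[OF assms] by auto

lemma pos_decreasing: "i < j \<Longrightarrow> j < length (pos k) \<Longrightarrow> pos k ! j < pos k ! i"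
  using digit_positions(2)[OF q2, of k] by (simp add: sorted_wrt_iff_nth_less)

abbreviation posfun :: "nat \<Rightarrow> nat \<Rightarrow> nat \<Rightarrow> complex" where
  "posfun k i \<equiv> (\<lambda>d. cnj (character (nat_digit q k (pos k ! i - 1)) d))"

lemma posfun_sum:
  assumes "n < length (pos k)"
  shows "(\<Sum>d<q. posfun k n d) = 0"
proof -
  have "(\<Sum>d<q. posfun k n d) = cnj (\<Sum>d<q. character (nat_digit q k (pos k ! n - 1)) d)" by simp
  also have "\<dots> = 0"
    using pos_nth[OF assms] by (subst character_sum) (auto simp: nat_digit_less simp del: of_nat_power)
  finally show ?thesis .
qed

text \<open>The two halves feed each other. Equivariance at the position with list index
  \<open>n\<close> gives mean zero on its cells and hence the next bound; the tail integral keeps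
  equivariance for the later, smaller positions, while position \<open>n\<close> is used up in the
  step.\<close>

lemma kernel_structure:
  "n \<le> length (pos k) \<Longrightarrow>
     (\<forall>t\<in>{0..<1}. norm (kernel k n t) \<le> posfac k n) \<and>
     (\<forall>i. n \<le> i \<and> i < length (pos k) \<longrightarrow> digit_equivariant q (pos k ! i) (posfun k i) (kernel k n))"
proof (induction n)
  case 0
  have "digit_equivariant q (pos k ! i) (posfun k i) (kernel k 0)" if "i < length (pos k)" for i
    unfolding kernel_def tail_integral.simps
  proof (rule wal1_equivariant)
    show "1 \<le> pos k ! i" using pos_nth[OF that] by simp
    have "k div q ^ (pos k ! i - 1) \<noteq> 0"
      using pos_nth(2)[OF that] by (auto simp: nat_digit_def intro: Nat.gr0I)
    then show "q ^ (pos k ! i - 1) \<le> k" by (metis div_less not_le)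
  qed
  then show ?case by (simp add: kernel_def)
next
  case (Suc n)
  interpret E: equivariant_function q "pos k ! n" "posfun k n" "kernel k n" "posfac k n"
    by unfold_locales (use Suc pos_nth[of n k] posfun_sum[of n k] q2 in auto)
  have K: "kernel k (Suc n) = E.tail"
    unfolding kernel_Suc E.tail_def[abs_def] ..
  show ?case
  proof (intro conjI ballI allI impI)
    fix t :: real assume "t \<in> {0..<1}"
    then show "norm (kernel k (Suc n) t) \<le> posfac k (Suc n)"
      using E.norm_tail[of t] unfolding K by (simp add: mult.commute)
  next
    fix i assume i: "Suc n \<le> i \<and> i < length (pos k)"
    then show "digit_equivariant q (pos k ! i) (posfun k i) (kernel k (Suc n))"
      unfolding K using Suc pos_nth[of i k] pos_decreasing[of n i k]
      by (intro E.tail_equivariant) auto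
  qed
qed

lemma kernel_equivariant_function:
  assumes "n < length (pos k)"
  shows "equivariant_function q (pos k ! n) (posfun k n) (kernel k n) (posfac k n)"
  by unfold_locales (use assms kernel_structure[of n k] pos_nth[of n k] posfun_sum[of n k] q2 in auto)

text \<open>The tail from 0 is the integral over all cells, each of which contributes 0. This
  removes the Taylor terms at 0 whose order is below the number of non-zero digits.\<close>

lemma kernel_0: "n < length (pos k) \<Longrightarrow> kernel k (Suc n) 0 = 0"
  using equivariant_function.tail_0[OF kernel_equivariant_function]
  by (simp add: kernel_Suc equivariant_function.tail_def[OF kernel_equivariant_function])

text \<open>After the last digit there is no further cancellation, but a tail integral over the unit
  interval does not increase a bound either.\<close>

lemma kernel_bound_late: "length (pos k) \<le> n \<Longrightarrow> t \<in> {0..<1} \<Longrightarrow>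
  norm (kernel k n t) \<le> posfac k (length (pos k))"
proof (induction n arbitrary: t rule: dec_induct)
  case base
  then show ?case using kernel_structure[of "length (pos k)" k] by simp
next
  case (step n)
  then show ?case unfolding kernel_Suc by (intro tail_integral_bound) auto
qed

lemma posfac_le:
  assumes "n \<le> length (pos k)" "n \<le> \<delta>"
  shows "posfac k n \<le> real q ^ \<delta> * real q powr - real (sum_list (take n (pos k)))"
  using pos_nth(1)[of _ k] by (intro prod_inverse_powers_le[OF q2 assms]) auto

text \<open>Either a digit is left and the value is 0, or all digits, at most
  \<open>m < \<delta>\<close> many, have contributed and \<open>mu1\<close> is the sum of all
  positions.\<close>

lemma kernel_at_0_bound:
  assumes "m < \<delta>"
  shows "norm (kernel k (Suc m) 0) \<le> real q ^ \<delta> * real q powr - mu1 q \<delta> lam k"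
proof (cases "m < length (pos k)")
  case True
  then show ?thesis by (simp add: kernel_0)
next
  case False
  then have "norm (kernel k (Suc m) 0) \<le> posfac k (length (pos k))"
    by (intro kernel_bound_late) auto
  also have "\<dots> \<le> real q ^ \<delta> * real q powr - real (sum_list (take (length (pos k)) (pos k)))"
    using False assms by (intro posfac_le) auto
  finally show ?thesis using False assms by (simp add: mu1_def)
qed

text \<open>\<open>N\<close> is the number of cells on which the kernel has mean zero, given by the
  position of index \<open>\<delta> + 1\<close>. If there is no such position, \<open>N = 1\<close>
  records that no cancellation is claimed, and then \<open>mu1\<close> has no term with
  \<open>lam\<close>.\<close>

lemma kernel_oscillation:
  assumes "0 < lam" "lam \<le> 1"
  obtains N :: nat and M :: real where "N \<ge> 1" "M \<ge> 0"
    "\<And>t. t \<in> {0..<1} \<Longrightarrow> norm (kernel k \<delta> t) \<le> M"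
    "N = 1 \<or> (\<forall>i<N. (LINT x:cell N i|lborel. kernel k \<delta> x) = 0)"
    "M * real N powr - lam \<le> real q ^ Suc \<delta> * real q powr - mu1 q \<delta> lam k"
proof (cases "length (pos k) \<le> \<delta>")
  case True
  have "posfac k (length (pos k)) \<le> real q ^ \<delta> * real q powr - mu1 q \<delta> lam k"
    using posfac_le[of "length (pos k)" k \<delta>] True by (simp add: mu1_def)
  also have "\<dots> \<le> real q ^ Suc \<delta> * real q powr - mu1 q \<delta> lam k"
    using q_ge_1 by (intro mult_right_mono power_increasing) auto
  finally show ?thesis
    using kernel_bound_late[OF True] by (intro that[of 1 "posfac k (length (pos k))"]) (auto intro: prod_nonneg)
next
  case False
  interpret E: equivariant_function q "pos k ! \<delta>" "posfun k \<delta>" "kernel k \<delta>" "posfac k \<delta>"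
    using False by (intro kernel_equivariant_function) auto
  have N: "real E.N powr - lam \<le> real q * real q powr (- lam * real (pos k ! \<delta>))"
    using False pos_nth(1) assms by (intro power_pred_powr_le q2) auto
  have "posfac k \<delta> * real E.N powr - lam \<le>
      (real q ^ \<delta> * real q powr - real (sum_list (take \<delta> (pos k)))) *
      (real q * real q powr (- lam * real (pos k ! \<delta>)))"
    using posfac_le[of \<delta> k \<delta>] False N by (intro mult_mono) auto
  also have "\<dots> = real q ^ Suc \<delta> * real q powr - mu1 q \<delta> lam k"
  proof -
    have "real q powr - mu1 q \<delta> lam k = real q powr - real (sum_list (take \<delta> (pos k))) *
        real q powr (- lam * real (pos k ! \<delta>))"
      using False by (simp add: mu1_def Let_def flip: powr_add)
    then show ?thesis by (simp only: power_Suc ac_simps)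
  qed
  finally show ?thesis
    using E.bound E.cell_mean_zero q2
    by (intro that[of E.N "posfac k \<delta>"]) (auto intro: prod_nonneg)
qed

end

section \<open>Boxes and the Vitali variation\<close>

text \<open>Products of such neighbouring pairs are the boxes of a grid; grids are the only
  partitions that the estimates use.\<close>

definition gaps :: "real set \<Rightarrow> (real \<times> real) set" where
  "gaps B = {(x, y). x \<in> B \<and> y \<in> B \<and> x < y \<and> (\<forall>z\<in>B. \<not> (x < z \<and> z < y))}"

lemma finite_gaps: "finite B \<Longrightarrow> finite (gaps B)"
  by (rule finite_subset[of _ "B \<times> B"]) (auto simp: gaps_def)

lemma gaps_cover:
  assumes "finite B" "0 \<in> B" "1 \<in> B" "0 \<le> t" "t < 1"
  obtains x y where "(x, y) \<in> gaps B" "x \<le> t" "t < y"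
proof -
  define x where "x = Max {z\<in>B. z \<le> t}"
  define y where "y = Min {z\<in>B. t < z}"
  have "x \<in> {z\<in>B. z \<le> t}" unfolding x_def using assms by (intro Max_in) auto
  moreover have "y \<in> {z\<in>B. t < z}" unfolding y_def using assms by (intro Min_in) auto
  moreover have "z \<le> x" if "z \<in> B" "z \<le> t" for z unfolding x_def using assms that by (intro Max_ge) auto
  moreover have "y \<le> z" if "z \<in> B" "t < z" for z unfolding y_def using assms that by (intro Min_le) auto
  ultimately show ?thesis by (intro that[of x y]) (fastforce simp: gaps_def)+
qed

lemma gaps_unique:
  assumes "(x, y) \<in> gaps B" "(x', y') \<in> gaps B" "x \<le> t" "t < y" "x' \<le> t" "t < y'"
  shows "x = x'" "y = y'"
proof -
  have "\<not> x < x'" "\<not> x' < x" "\<not> y < y'" "\<not> y' < y"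
    using assms unfolding gaps_def by force+
  then show "x = x'" "y = y'" by auto
qed

definition product_box :: "nat set \<Rightarrow> (nat \<Rightarrow> real \<times> real) \<Rightarrow> pbox" where
  "product_box u c = (\<lambda>j\<in>u. fst (c j), \<lambda>j\<in>u. snd (c j))"

lemma box_partition_product:
  assumes "finite u" and B: "\<And>j. j \<in> u \<Longrightarrow> finite (B j) \<and> 0 \<in> B j \<and> 1 \<in> B j \<and> B j \<subseteq> {0..1}"
  shows "box_partition u (product_box u ` (\<Pi>\<^sub>E j\<in>u. gaps (B j)))" (is "box_partition u ?P")
  unfolding box_partition_def
proof (intro conjI ballI)
  show "finite ?P" using assms by (intro finite_imageI finite_PiE) (auto intro: finite_gaps)
next
  fix J assume "J \<in> ?P"
  then show "fst J \<in> extensional u" "snd J \<in> extensional u"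
    by (auto simp: product_box_def)
  fix j assume "j \<in> u"
  then show "fst J j < snd J j" using \<open>J \<in> ?P\<close>
    by (auto simp: product_box_def PiE_iff gaps_def case_prod_unfold)
next
  show "disjoint_family_on (box_set u) ?P"
    unfolding disjoint_family_on_def
  proof (intro ballI impI, rule ccontr)
    fix J J' assume J: "J \<in> ?P" "J' \<in> ?P" "J \<noteq> J'" "box_set u J \<inter> box_set u J' \<noteq> {}"
    then obtain c c' where c: "c \<in> (\<Pi>\<^sub>E j\<in>u. gaps (B j))" "c' \<in> (\<Pi>\<^sub>E j\<in>u. gaps (B j))"
      "J = product_box u c" "J' = product_box u c'" by blast
    obtain t where t: "t \<in> box_set u J" "t \<in> box_set u J'" using J by blast
    have "c j = c' j" if "j \<in> u" for j
    proof -
      have "(fst (c j), snd (c j)) \<in> gaps (B j)" "(fst (c' j), snd (c' j)) \<in> gaps (B j)"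
        using c that by auto
      moreover have "fst (c j) \<le> t j" "t j < snd (c j)" "fst (c' j) \<le> t j" "t j < snd (c' j)"
        using t that c by (auto simp: box_set_def product_box_def PiE_iff)
      ultimately show ?thesis using gaps_unique by (metis prod.collapse)
    qed
    then have "c = c'" using c by (metis PiE_ext)
    then show False using c J by simp
  qed
next
  show "(\<Union>J\<in>?P. box_set u J) = cube u"
  proof (intro subset_antisym subsetI)
    fix t assume "t \<in> (\<Union>J\<in>?P. box_set u J)"
    then obtain c where c: "c \<in> (\<Pi>\<^sub>E j\<in>u. gaps (B j))" "t \<in> box_set u (product_box u c)" by blast
    have "t j \<in> {0..<1}" if "j \<in> u" for j
    proof -
      have "c j \<in> gaps (B j)" using c that by auto
      then have "0 \<le> fst (c j)" "snd (c j) \<le> 1" using B[OF that] by (auto simp: gaps_def)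
      moreover have "fst (c j) \<le> t j" "t j < snd (c j)"
        using c that by (auto simp: box_set_def product_box_def PiE_iff)
      ultimately show ?thesis by auto
    qed
    then show "t \<in> cube u" using c by (auto simp: cube_def box_set_def PiE_iff)
  next
    fix t assume t: "t \<in> cube u"
    have "\<forall>j\<in>u. \<exists>c. c \<in> gaps (B j) \<and> fst c \<le> t j \<and> t j < snd c"
    proof
      fix j assume "j \<in> u"
      then show "\<exists>c. c \<in> gaps (B j) \<and> fst c \<le> t j \<and> t j < snd c"
        using gaps_cover[of "B j" "t j"] B[of j] t by (auto simp: cube_def PiE_iff) metis
    qed
    then obtain c where c: "\<And>j. j \<in> u \<Longrightarrow> c j \<in> gaps (B j) \<and> fst (c j) \<le> t j \<and> t j < snd (c j)"
      by metis
    then have "restrict c u \<in> (\<Pi>\<^sub>E j\<in>u. gaps (B j))" by auto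
    moreover have "t \<in> box_set u (product_box u (restrict c u))"
      using c t by (auto simp: box_set_def product_box_def cube_def PiE_iff)
    ultimately show "t \<in> (\<Union>J\<in>?P. box_set u J)" by blast
  qed
qed

text \<open>Normalising by \<open>c\<close> reduces the claim to Young's inequality with second
  factor 1. Weights of total at most 1, rather than exactly 1, allow for families of boxes that do
  not fill the cube.\<close>

lemma weighted_power_mean:
  fixes w x :: "'i \<Rightarrow> real"
  assumes "finite Q" "p \<ge> 1" "\<And>i. i \<in> Q \<Longrightarrow> w i \<ge> 0" "\<And>i. i \<in> Q \<Longrightarrow> x i \<ge> 0" "(\<Sum>i\<in>Q. w i) \<le> 1"
  shows "(\<Sum>i\<in>Q. w i * x i) \<le> (\<Sum>i\<in>Q. w i * x i powr p) powr (1 / p)"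
proof -
  define S where "S = (\<Sum>i\<in>Q. w i * x i powr p)"
  have S0: "S \<ge> 0" unfolding S_def using assms by (intro sum_nonneg) auto
  show ?thesis
  proof (cases "S = 0")
    case True
    then have "w i * x i powr p = 0" if "i \<in> Q" for i
      unfolding S_def using assms that by (subst (asm) sum_nonneg_eq_0_iff) auto
    then have "w i * x i = 0" if "i \<in> Q" for i using that by fastforce
    then have "(\<Sum>i\<in>Q. w i * x i) = 0" by (rule sum.neutral[OF ballI])
    then show ?thesis by simp
  next
    case False
    define c where "c = S powr (1 / p)"
    have c: "c > 0" "c powr p = S" using False S0 assms by (auto simp: c_def powr_powr)
    have young: "y \<le> y powr p / p + (1 - 1 / p)" if "y \<ge> 0" for y :: real
    \<comment> \<open>At \<open>p = 1\<close> the conjugate exponent \<open>p / (p - 1)\<close>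
      degenerates, but there the claim is an equality.\<close>
    proof (cases "p = 1")
      case False
      then have "y * 1 \<le> y powr p / p + 1 powr (p / (p - 1)) / (p / (p - 1))"
        using assms that by (intro Youngs_inequality) (auto simp: field_simps)
      also have "1 powr (p / (p - 1)) / (p / (p - 1)) = 1 - 1 / p"
        using assms by (simp add: field_simps)
      finally show ?thesis by simp
    qed (use that in simp)
    have "(\<Sum>i\<in>Q. w i * (x i / c)) \<le> (\<Sum>i\<in>Q. w i * ((x i / c) powr p / p + (1 - 1 / p)))"
      using assms c by (intro sum_mono mult_left_mono young) auto
    also have "\<dots> = (\<Sum>i\<in>Q. w i * (x i / c) powr p) / p + (\<Sum>i\<in>Q. w i) * (1 - 1 / p)"
      by (simp add: distrib_left sum.distrib sum_divide_distrib sum_distrib_right)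
    also have "(\<Sum>i\<in>Q. w i * (x i / c) powr p) = (\<Sum>i\<in>Q. w i * x i powr p) / S"
      using assms c unfolding sum_divide_distrib by (intro sum.cong refl) (auto simp: powr_divide)
    also have "\<dots> = 1" using False by (simp flip: S_def)
    also have "1 / p + (\<Sum>i\<in>Q. w i) * (1 - 1 / p) \<le> 1 / p + 1 * (1 - 1 / p)"
      using assms by (intro add_mono mult_right_mono) auto
    finally have "(\<Sum>i\<in>Q. w i * x i) / c \<le> 1" by (simp add: sum_divide_distrib)
    then show ?thesis using c by (simp add: field_simps flip: S_def c_def)
  qed
qed

text \<open>In the variation \<open>box_vol\<close> acts as a weight and the increment divided by
  \<open>box_vol powr lam\<close> as a value, so the power mean inequality removes
  \<open>\<pp>\<close> at no cost.\<close>

lemma vitali_variation_ge: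
  assumes V: "vitali_variation lam \<pp> u g = ennreal V" "V \<ge> 0"
    and "\<pp> \<ge> 1" "box_partition u P" "Q \<subseteq> P" "(\<Sum>J\<in>Q. box_vol u J) \<le> 1"
    and vert: "\<And>J v. J \<in> Q \<Longrightarrow> v \<subseteq> u \<Longrightarrow> box_vertex u J v \<in> cube u"
  shows "(\<Sum>J\<in>Q. box_vol u J powr (1 - lam) * \<bar>box_diff u g J\<bar>) \<le> V"
proof -
  let ?R = "{J \<in> P. \<forall>v\<subseteq>u. box_vertex u J v \<in> cube u}"
  have fin: "finite P" and pos: "\<And>J. J \<in> P \<Longrightarrow> box_vol u J > 0"
    using assms(4) by (auto simp: box_partition_def box_vol_def intro!: prod_pos)
  have pos0: "box_vol u J \<ge> 0" if "J \<in> P" for J using pos[OF that] by simp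
  have finQ: "finite Q" using fin assms(5) finite_subset by blast
  let ?x = "\<lambda>J. \<bar>box_diff u g J / box_vol u J powr lam\<bar>"
  have "(\<Sum>J\<in>Q. box_vol u J powr (1 - lam) * \<bar>box_diff u g J\<bar>) = (\<Sum>J\<in>Q. box_vol u J * ?x J)"
  proof (intro sum.cong refl)
    fix J assume "J \<in> Q"
    then have "box_vol u J > 0" using pos assms(5) by blast
    then show "box_vol u J powr (1 - lam) * \<bar>box_diff u g J\<bar> = box_vol u J * ?x J"
      by (simp add: powr_diff)
  qed
  also have "\<dots> \<le> (\<Sum>J\<in>Q. box_vol u J * ?x J powr \<pp>) powr (1 / \<pp>)"
    by (rule weighted_power_mean[OF finQ assms(3) _ _ assms(6)]) (use pos0 assms(5) in auto)
  also have "\<dots> \<le> (\<Sum>J\<in>?R. box_vol u J * ?x J powr \<pp>) powr (1 / \<pp>)"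
  proof (intro powr_mono2 sum_mono2 sum_nonneg)
    show "Q \<subseteq> ?R" using assms(5) vert by blast
  qed (use fin assms(3,5) pos0 in auto)
  also have "\<dots> \<le> V"
  proof -
    have "ennreal ((\<Sum>J\<in>?R. box_vol u J * ?x J powr \<pp>) powr (1 / \<pp>)) \<le> vitali_variation lam \<pp> u g"
      unfolding vitali_variation_def by (rule SUP_upper) (use assms in simp)
    then show ?thesis unfolding V using V by (simp add: ennreal_le_iff)
  qed
  finally show ?thesis .
qed

section \<open>Congruent boxes, one in each cell of a grid\<close>

definition cell_box :: "nat set \<Rightarrow> (nat \<Rightarrow> nat) \<Rightarrow> (nat \<Rightarrow> nat) \<Rightarrow> (nat \<Rightarrow> real) \<Rightarrow> (nat \<Rightarrow> real) \<Rightarrow> pbox" where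
  "cell_box u n i a b = (\<lambda>j\<in>u. (real (i j) + a j) / real (n j), \<lambda>j\<in>u. (real (i j) + b j) / real (n j))"

abbreviation cells :: "nat set \<Rightarrow> (nat \<Rightarrow> nat) \<Rightarrow> (nat \<Rightarrow> nat) set" where
  "cells u n \<equiv> (\<Pi>\<^sub>E j\<in>u. {..<n j})"

lemma cell_point_in_unit:
  assumes "i < n" "0 \<le> t" "t < 1"
  shows "0 \<le> (real i + t) / real n" "(real i + t) / real n < 1"
proof -
  have "real i + 1 \<le> real n" using assms by linarith
  then have "real i + t < real n" using assms by linarith
  then show "(real i + t) / real n < 1" using assms by (simp add: field_simps)
qed (use assms in simp)

text \<open>Chosen so that the sides with relative position from \<open>a\<close> to
  \<open>b\<close> occur in every cell of one single partition.\<close>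

definition breakpoints :: "nat \<Rightarrow> real \<Rightarrow> real \<Rightarrow> real set" where
  "breakpoints n a b = insert 1 ((\<lambda>(m, c). (real m + c) / real n) ` ({..<n} \<times> {0, a, b}))"

lemma breakpointsE:
  assumes "z \<in> breakpoints n a b"
  obtains "z = 1" | m c where "m < n" "c \<in> {0, a, b}" "z = (real m + c) / real n"
proof -
  have "z = 1 \<or> z \<in> (\<lambda>(m, c). (real m + c) / real n) ` ({..<n} \<times> {0, a, b})"
    using assms by (simp add: breakpoints_def)
  then show ?thesis
  proof
    assume "z \<in> (\<lambda>(m, c). (real m + c) / real n) ` ({..<n} \<times> {0, a, b})"
    then obtain x where x: "x \<in> {..<n} \<times> {0, a, b}" "z = (case x of (m, c) \<Rightarrow> (real m + c) / real n)"
      by blast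
    show ?thesis
      by (rule that(2)[of "fst x" "snd x"]) (use x in \<open>simp_all only: mem_Times_iff case_prod_unfold lessThan_iff\<close>)
  qed (rule that(1))
qed

lemma breakpointsI: "m < n \<Longrightarrow> c \<in> {0, a, b} \<Longrightarrow> (real m + c) / real n \<in> breakpoints n a b"
  unfolding breakpoints_def by (rule insertI2, rule image_eqI[of _ _ "(m, c)"]) simp_all

lemma gap_in_breakpoints:
  assumes "0 \<le> a" "a < b" "b < 1" "i < n"
  shows "((real i + a) / real n, (real i + b) / real n) \<in> gaps (breakpoints n a b)"
proof -
  have n: "real n > 0" using assms by simp
  have "\<not> ((real i + a) / real n < z \<and> z < (real i + b) / real n)" if zB: "z \<in> breakpoints n a b" for z
  proof
    assume z: "(real i + a) / real n < z \<and> z < (real i + b) / real n"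
    have "(real i + b) / real n < 1" using cell_point_in_unit assms by simp
    then have "z \<noteq> 1" using z by linarith
    from zB obtain m c where mc: "c \<in> {0, a, b}" "z = (real m + c) / real n"
      by (rule breakpointsE) (use \<open>z \<noteq> 1\<close> in simp, blast)
    then have "real i + a < real m + c" "real m + c < real i + b"
      using z n by (auto simp: divide_strict_right_mono field_simps)
    then have "m = i" using mc assms by auto
    then show False using \<open>real i + a < real m + c\<close> \<open>real m + c < real i + b\<close> mc assms by auto
  qed
  moreover have "(real i + a) / real n \<in> breakpoints n a b" "(real i + b) / real n \<in> breakpoints n a b"
    using assms by (auto intro!: breakpointsI)
  ultimately show ?thesis using assms n by (auto simp: gaps_def divide_strict_right_mono)
qed

lemma cell_box_inj:
  assumes "\<And>j. j \<in> u \<Longrightarrow> n j \<ge> (1::nat)"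
  shows "inj_on (\<lambda>i. cell_box u n i a b) (cells u n)"
proof (rule inj_onI)
  fix i i' assume i: "i \<in> cells u n" "i' \<in> cells u n" "cell_box u n i a b = cell_box u n i' a b"
  show "i = i'"
  proof (rule PiE_ext[OF i(1,2)])
    fix j assume j: "j \<in> u"
    have "fst (cell_box u n i a b) j = fst (cell_box u n i' a b) j" using i by simp
    then show "i j = i' j" using j assms[OF j] by (simp add: cell_box_def)
  qed
qed

text \<open>These boxes are congruent, belong to one grid and have total volume at most 1, so the
  common power of their volume comes out of the sum.\<close>

lemma cell_boxes_variation:
  assumes u: "finite u" and V: "vitali_variation lam \<pp> u g = ennreal V" "V \<ge> 0" and "\<pp> \<ge> 1"
    and n: "\<And>j. j \<in> u \<Longrightarrow> n j \<ge> 1"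
    and ab: "\<And>j. j \<in> u \<Longrightarrow> 0 \<le> a j \<and> a j < b j \<and> b j < 1"
  shows "(\<Prod>j\<in>u. (b j - a j) / real (n j)) powr (1 - lam) *
     (\<Sum>i\<in>cells u n. \<bar>box_diff u g (cell_box u n i a b)\<bar>) \<le> V"
proof -
  let ?B = "\<lambda>j. breakpoints (n j) (a j) (b j)"
  let ?P = "product_box u ` (\<Pi>\<^sub>E j\<in>u. gaps (?B j))"
  let ?Q = "(\<lambda>i. cell_box u n i a b) ` cells u n"
  have finB: "finite (?B j) \<and> 0 \<in> ?B j \<and> 1 \<in> ?B j \<and> ?B j \<subseteq> {0..1}" if "j \<in> u" for j
  proof -
    have "0 \<in> ?B j" using n[OF that] breakpointsI[of 0 "n j" 0 "a j" "b j"] by simp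
    moreover have "?B j \<subseteq> {0..1}"
    proof
      fix z assume "z \<in> ?B j"
      then show "z \<in> {0..1}"
      proof (cases rule: breakpointsE)
        case (2 m c)
        then show ?thesis using cell_point_in_unit[of m "n j" c] ab[OF that] by auto
      qed simp
    qed
    ultimately show ?thesis by (simp add: breakpoints_def)
  qed
  have part: "box_partition u ?P" by (rule box_partition_product[OF u finB])
  have sub: "?Q \<subseteq> ?P"
  proof
    fix J assume "J \<in> ?Q"
    then obtain i where i: "i \<in> cells u n" "J = cell_box u n i a b" by blast
    let ?c = "\<lambda>j\<in>u. ((real (i j) + a j) / real (n j), (real (i j) + b j) / real (n j))"
    have "J = product_box u ?c" unfolding i cell_box_def product_box_def by auto
    moreover have "?c \<in> (\<Pi>\<^sub>E j\<in>u. gaps (?B j))"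
      using i ab by (auto simp: PiE_iff intro!: gap_in_breakpoints)
    ultimately show "J \<in> ?P" by blast
  qed
  have vol: "box_vol u (cell_box u n i a b) = (\<Prod>j\<in>u. (b j - a j) / real (n j))" for i
    unfolding box_vol_def cell_box_def by (intro prod.cong refl) (simp add: diff_divide_distrib add_divide_distrib)
  have card: "card (cells u n) = (\<Prod>j\<in>u. n j)" using u by (simp add: card_PiE)
  have "(\<Sum>J\<in>?Q. box_vol u J) = (\<Sum>i\<in>cells u n. (\<Prod>j\<in>u. (b j - a j) / real (n j)))"
    by (subst sum.reindex[OF cell_box_inj[OF n]]) (auto simp: vol)
  also have "\<dots> = (\<Prod>j\<in>u. real (n j)) * (\<Prod>j\<in>u. (b j - a j) / real (n j))"
    by (simp add: card)
  also have "\<dots> = (\<Prod>j\<in>u. b j - a j)"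
    unfolding prod.distrib[symmetric] using n by (intro prod.cong refl) force
  also have "\<dots> \<le> 1" using ab by (intro prod_le_1) force
  finally have vol1: "(\<Sum>J\<in>?Q. box_vol u J) \<le> 1" .
  \<comment> \<open>\<open>b j < 1\<close> keeps every vertex in the half-open cube, even in the
    last cell, so the variation omits none of these boxes.\<close>
  have vert: "box_vertex u J v \<in> cube u" if J: "J \<in> ?Q" for J v
  proof -
    obtain i where i: "i \<in> cells u n" "J = cell_box u n i a b" using J by blast
    have "0 \<le> (real (i j) + a j) / real (n j) \<and> (real (i j) + a j) / real (n j) < 1 \<and>
          0 \<le> (real (i j) + b j) / real (n j) \<and> (real (i j) + b j) / real (n j) < 1" if "j \<in> u" for j
      using i ab[OF that] that by (intro conjI cell_point_in_unit) auto
    then show ?thesis unfolding i box_vertex_def cell_box_def cube_def by (auto simp: PiE_iff)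
  qed
  have "(\<Sum>J\<in>?Q. box_vol u J powr (1 - lam) * \<bar>box_diff u g J\<bar>) \<le> V"
    using vitali_variation_ge[OF V assms(4) part sub vol1 vert] by blast
  then show ?thesis
    by (subst (asm) sum.reindex[OF cell_box_inj[OF n]]) (auto simp: vol sum_distrib_left)
qed

lemma box_vertex_insert:
  assumes "j \<notin> u" "v \<subseteq> u"
  shows "box_vertex (insert j u) (x, y) v = (box_vertex u (x, y) v)(j := x j)"
    "box_vertex (insert j u) (x, y) (insert j v) = (box_vertex u (x, y) v)(j := y j)"
  using assms by (auto simp: box_vertex_def fun_eq_iff)

lemma box_diff_insert:
  assumes "finite u" "j \<notin> u"
  shows "box_diff (insert j u) g (x, y) = (\<Sum>v\<in>Pow u. (- 1) ^ card v *
    (g ((box_vertex u (x, y) v)(j := x j)) - g ((box_vertex u (x, y) v)(j := y j))))"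
proof -
  have "box_diff (insert j u) g (x, y) =
      (\<Sum>v\<in>Pow u. (- 1) ^ card v * g (box_vertex (insert j u) (x, y) v)) +
      (\<Sum>v\<in>insert j ` Pow u. (- 1) ^ card v * g (box_vertex (insert j u) (x, y) v))"
    unfolding box_diff_def Pow_insert using assms by (intro sum.union_disjoint) auto
  also have "(\<Sum>v\<in>insert j ` Pow u. (- 1) ^ card v * g (box_vertex (insert j u) (x, y) v)) =
      (\<Sum>v\<in>Pow u. (- 1) ^ card (insert j v) * g (box_vertex (insert j u) (x, y) (insert j v)))"
    using assms by (subst sum.reindex) (auto intro!: inj_onI)
  also have "\<dots> = (\<Sum>v\<in>Pow u. - ((- 1) ^ card v * g ((box_vertex u (x, y) v)(j := y j))))"
  proof (intro sum.cong refl)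
    fix v assume "v \<in> Pow u"
    then have "finite v" "j \<notin> v" "v \<subseteq> u" using assms finite_subset by auto
    then show "(- 1) ^ card (insert j v) * g (box_vertex (insert j u) (x, y) (insert j v)) =
        - ((- 1) ^ card v * g ((box_vertex u (x, y) v)(j := y j)))"
      using assms by (simp add: box_vertex_insert)
  qed
  also have "(\<Sum>v\<in>Pow u. (- 1) ^ card v * g (box_vertex (insert j u) (x, y) v)) =
      (\<Sum>v\<in>Pow u. (- 1) ^ card v * g ((box_vertex u (x, y) v)(j := x j)))"
    using assms by (intro sum.cong refl) (auto simp: box_vertex_insert)
  finally show ?thesis
    by (simp add: sum_subtractf right_diff_distrib sum_negf del: fun_upd_apply)
qed

text \<open>Both boxes on the right end at \<open>c\<close> in direction \<open>j\<close>, and the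
  terms of these vertices cancel. The point \<open>c\<close> is free, and will be taken far enough
  to the right to make both sides long.\<close>

lemma box_diff_additive:
  assumes "finite u" "j \<in> u"
  shows "box_diff u g (x, y) = box_diff u g (x, y(j := c)) - box_diff u g (x(j := y j), y(j := c))"
proof -
  define w where "w = u - {j}"
  have w: "u = insert j w" "j \<notin> w" "finite w" using assms by (auto simp: w_def)
  have v: "box_vertex w (x(j := d), y(j := e)) v = box_vertex w (x, y) v" for d e v
    using w by (auto simp: box_vertex_def fun_eq_iff)
  from v[of "x j"] have v': "box_vertex w (x, y(j := e)) v = box_vertex w (x, y) v" for e v
    by simp
  show ?thesis unfolding w(1) box_diff_insert[OF w(3,2)] v v'
    by (simp add: flip: sum_subtractf right_diff_distrib)
qed

lemma cell_box_upd:
  fixes a b :: "nat \<Rightarrow> real" and c d :: real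
  assumes "j \<in> u"
  shows "cell_box u n i (a(j := c)) (b(j := d)) =
    ((fst (cell_box u n i a b))(j := (real (i j) + c) / real (n j)),
     (snd (cell_box u n i a b))(j := (real (i j) + d) / real (n j)))"
  using assms by (auto simp: cell_box_def fun_eq_iff)

text \<open>Sides of relative length at least 1/4 bound the volume from below by a multiple of the
  cell volume. As \<open>1 - lam\<close> lies between 0 and 1, each side costs at most a factor 4,
  whatever \<open>lam\<close> is.\<close>

lemma cell_boxes_variation_long:
  assumes u: "finite u" and V: "vitali_variation lam \<pp> u g = ennreal V" "V \<ge> 0" and "\<pp> \<ge> 1"
    and lam: "0 < lam" "lam \<le> 1"
    and n: "\<And>j. j \<in> u \<Longrightarrow> n j \<ge> 1"
    and ab: "\<And>j. j \<in> u \<Longrightarrow> 0 \<le> a j \<and> a j + 1 / 4 \<le> b j \<and> b j < 1"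
  shows "(\<Sum>i\<in>cells u n. \<bar>box_diff u g (cell_box u n i a b)\<bar>) \<le>
     4 ^ card u * (\<Prod>j\<in>u. real (n j) powr (1 - lam)) * V"
proof -
  let ?S = "\<Sum>i\<in>cells u n. \<bar>box_diff u g (cell_box u n i a b)\<bar>"
  have S0: "?S \<ge> 0" by (intro sum_nonneg) auto
  have "(1 / 4) ^ card u * (\<Prod>j\<in>u. real (n j) powr (lam - 1)) =
        (\<Prod>j\<in>u. (1 / 4) * real (n j) powr (lam - 1))"
    using u by (simp only: prod.distrib prod_constant)
  also have "\<dots> \<le> (\<Prod>j\<in>u. ((b j - a j) / real (n j)) powr (1 - lam))"
  proof (intro prod_mono conjI)
    fix j assume j: "j \<in> u"
    have "(1 / 4) * real (n j) powr (lam - 1) \<le> (1 / 4) powr (1 - lam) * real (n j) powr (lam - 1)"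
      using powr_mono'[of "1 - lam" 1 "1/4"] lam by (intro mult_right_mono) auto
    also have "\<dots> \<le> (b j - a j) powr (1 - lam) * real (n j) powr (lam - 1)"
      using ab[OF j] lam by (intro mult_right_mono powr_mono2) auto
    also have "\<dots> = ((b j - a j) / real (n j)) powr (1 - lam)"
      using ab[OF j] n[OF j] by (simp add: powr_divide powr_diff)
    finally show "(1 / 4) * real (n j) powr (lam - 1) \<le> ((b j - a j) / real (n j)) powr (1 - lam)" .
  qed auto
  also have "\<dots> = (\<Prod>j\<in>u. (b j - a j) / real (n j)) powr (1 - lam)"
    using ab u by (subst prod_powr_distrib) (auto intro!: divide_nonneg_nonneg simp: algebra_simps
       elim: order_trans[rotated])
  finally have "(1 / 4) ^ card u * (\<Prod>j\<in>u. real (n j) powr (lam - 1)) * ?S \<le>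
      (\<Prod>j\<in>u. (b j - a j) / real (n j)) powr (1 - lam) * ?S"
    using S0 by (rule mult_right_mono)
  also have "\<dots> \<le> V" 
    by (rule cell_boxes_variation[OF u V assms(4) n]) (use ab in \<open>auto intro: less_le_trans\<close>, use ab in force)
  finally have *: "(1 / 4) ^ card u * (\<Prod>j\<in>u. real (n j) powr (lam - 1)) * ?S \<le> V" .
  have "(\<Prod>j\<in>u. real (n j) powr (1 - lam)) * (\<Prod>j\<in>u. real (n j) powr (lam - 1)) = 1"
    unfolding prod.distrib[symmetric] using n by (intro prod.neutral) (force simp flip: powr_add)
  then have "?S = 4 ^ card u * (\<Prod>j\<in>u. real (n j) powr (1 - lam)) *
     ((1 / 4) ^ card u * (\<Prod>j\<in>u. real (n j) powr (lam - 1)) * ?S)"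
    by (simp add: power_one_over field_simps)
  also have "\<dots> \<le> 4 ^ card u * (\<Prod>j\<in>u. real (n j) powr (1 - lam)) * V"
    by (intro mult_left_mono * mult_nonneg_nonneg prod_nonneg) auto
  finally show ?thesis .
qed

text \<open>If a side starts at the left end of the cell and is short, then it is the difference of two long sides
  with right end \<open>3/4\<close>. Short boxes have to be avoided because for \<open>lam < 1\<close> the
  variation gives no uniform control of the increments over them.\<close>

lemma cell_boxes_variation_mixed:
  assumes u: "finite u" and V: "vitali_variation lam \<pp> u g = ennreal V" "V \<ge> 0" and "\<pp> \<ge> 1"
    and lam: "0 < lam" "lam \<le> 1"
    and n: "\<And>j. j \<in> u \<Longrightarrow> n j \<ge> 1"
    and "finite w" "w \<subseteq> u"
    and ab: "\<And>j. j \<in> u - w \<Longrightarrow> 0 \<le> a j \<and> a j + 1 / 4 \<le> b j \<and> b j < 1"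
    and ab': "\<And>j. j \<in> w \<Longrightarrow> a j = 0 \<and> 0 \<le> b j \<and> b j < 1"
  shows "(\<Sum>i\<in>cells u n. \<bar>box_diff u g (cell_box u n i a b)\<bar>) \<le>
     2 ^ card w * (4 ^ card u * (\<Prod>j\<in>u. real (n j) powr (1 - lam)) * V)"
  using assms(8-)
proof (induction w arbitrary: a b rule: finite_induct)
  case empty
  then show ?case using cell_boxes_variation_long[OF u V assms(4) lam n, where a = a and b = b] by simp
next
  case (insert j w)
  let ?K = "4 ^ card u * (\<Prod>j\<in>u. real (n j) powr (1 - lam)) * V"
  have K0: "?K \<ge> 0" using V by (intro mult_nonneg_nonneg prod_nonneg) auto
  have j: "j \<in> u" using insert by simp
  show ?case
  proof (cases "b j \<ge> 1 / 4")
    case True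
    have "(\<Sum>i\<in>cells u n. \<bar>box_diff u g (cell_box u n i a b)\<bar>) \<le> 2 ^ card w * ?K"
    proof (rule insert.IH)
      fix l assume "l \<in> u - w"
      then show "0 \<le> a l \<and> a l + 1 / 4 \<le> b l \<and> b l < 1"
        using insert.prems(2)[of l] insert.prems(3)[of l] True by (cases "l = j") auto
    qed (use insert in auto)
    also have "\<dots> \<le> 2 ^ card (insert j w) * ?K"
      using insert K0 by (intro mult_right_mono) auto
    finally show ?thesis .
  next
    case False
    \<comment> \<open>Since \<open>b j < 1 / 4\<close>, the sides from 0 to \<open>3 / 4\<close> and
      from \<open>b j\<close> to \<open>3 / 4\<close> are both longer than \<open>1 / 4\<close>.
      Direction \<open>j\<close> thus becomes long at the price of a factor 2.\<close>
    let ?b = "b(j := 3 / 4)" and ?a = "a(j := b j)"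
    have bj: "a j = 0" "0 \<le> b j" using insert.prems(3)[of j] by auto
    have upd: "cell_box u n i a ?b = (fst (cell_box u n i a b), (snd (cell_box u n i a b))(j := (real (i j) + 3/4) / real (n j)))"
      "cell_box u n i ?a ?b = ((fst (cell_box u n i a b))(j := snd (cell_box u n i a b) j),
         (snd (cell_box u n i a b))(j := (real (i j) + 3/4) / real (n j)))" for i
      using cell_box_upd[OF j, where n = n and i = i and a = a and c = "a j" and b = b and d = "3/4"]
        cell_box_upd[OF j, where n = n and i = i and a = a and c = "b j" and b = b and d = "3/4"] j
      by (auto simp: cell_box_def fun_eq_iff)
    have "\<bar>box_diff u g (cell_box u n i a b)\<bar> \<le>
      \<bar>box_diff u g (cell_box u n i a ?b)\<bar> + \<bar>box_diff u g (cell_box u n i ?a ?b)\<bar>" for i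
      using box_diff_additive[OF u j, of g "fst (cell_box u n i a b)" "snd (cell_box u n i a b)"
          "(real (i j) + 3/4) / real (n j)"] unfolding upd by simp
    then have "(\<Sum>i\<in>cells u n. \<bar>box_diff u g (cell_box u n i a b)\<bar>) \<le>
      (\<Sum>i\<in>cells u n. \<bar>box_diff u g (cell_box u n i a ?b)\<bar>) + (\<Sum>i\<in>cells u n. \<bar>box_diff u g (cell_box u n i ?a ?b)\<bar>)"
      unfolding sum.distrib[symmetric] by (intro sum_mono)
    also have "\<dots> \<le> 2 ^ card w * ?K + 2 ^ card w * ?K"
    proof (intro add_mono insert.IH)
      fix l assume l: "l \<in> u - w"
      show "0 \<le> a l \<and> a l + 1 / 4 \<le> ?b l \<and> ?b l < 1"
        using insert.prems(2)[of l] bj l by (cases "l = j") auto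
      show "0 \<le> ?a l \<and> ?a l + 1 / 4 \<le> ?b l \<and> ?b l < 1"
        using insert.prems(2)[of l] bj l False by (cases "l = j") auto
    next
      fix l assume l: "l \<in> w"
      then have "l \<noteq> j" using insert by auto
      then show "a l = 0 \<and> 0 \<le> ?b l \<and> ?b l < 1" "?a l = 0 \<and> 0 \<le> ?b l \<and> ?b l < 1"
        using insert.prems(3)[of l] l by auto
    qed (use insert in auto)
    also have "\<dots> = 2 ^ card (insert j w) * ?K" using insert by simp
    finally show ?thesis .
  qed
qed

text \<open>Every side starts at the left end of its cell and may be short, so every direction may
  have to be split: 8 is 2 for the splitting times 4 for the long sides.\<close>

lemma cell_boxes_variation_anchored:
  assumes u: "finite u" and V: "vitali_variation lam \<pp> u g = ennreal V" "V \<ge> 0" and "\<pp> \<ge> 1"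
    and lam: "0 < lam" "lam \<le> 1"
    and n: "\<And>j. j \<in> u \<Longrightarrow> n j \<ge> 1"
    and t: "t \<in> cube u"
  shows "(\<Sum>i\<in>cells u n. \<bar>box_diff u g (cell_box u n i (\<lambda>_. 0) t)\<bar>) \<le>
     8 ^ card u * (\<Prod>j\<in>u. real (n j) powr (1 - lam)) * V"
proof -
  have "(\<Sum>i\<in>cells u n. \<bar>box_diff u g (cell_box u n i (\<lambda>_. 0) t)\<bar>) \<le>
     2 ^ card u * (4 ^ card u * (\<Prod>j\<in>u. real (n j) powr (1 - lam)) * V)"

    by (rule cell_boxes_variation_mixed[OF u V assms(4) lam n u]) (use t in \<open>auto simp: cube_def PiE_iff\<close>)
  also have "\<dots> = (2 * 4) ^ card u * (\<Prod>j\<in>u. real (n j) powr (1 - lam)) * V"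
    unfolding power_mult_distrib by (simp only: mult.assoc)
  finally show ?thesis by simp
qed

section \<open>Integrals over the cube\<close>

interpretation cube: product_prob_space "\<lambda>_::nat. unit_lborel" UNIV
  by (intro product_prob_space.intro product_sigma_finite.intro product_prob_space_axioms.intro
      prob_space_unit_lborel prob_space_imp_sigma_finite)

lemma space_unit_lborel: "space unit_lborel = {0..<1}"
  by (simp add: space_restrict_space)

lemma space_cube_measure: "space (cube_measure u) = cube u"
  by (simp add: cube_measure_def cube_def space_PiM space_unit_lborel)

lemma prob_space_cube_measure: "prob_space (cube_measure u)"
  unfolding cube_measure_def by (intro prob_space_PiM prob_space_unit_lborel)

lemma measurable_cube_component:
  "j \<in> u \<Longrightarrow> (\<lambda>x. x j) \<in> measurable (cube_measure u) unit_lborel"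
  unfolding cube_measure_def by (rule measurable_component_singleton)

lemma measurable_cube_component_comp:
  assumes "K \<in> borel_measurable unit_lborel" "j \<in> u"
  shows "(\<lambda>x. K (x j)) \<in> borel_measurable (cube_measure u)"
  using measurable_compose[OF measurable_cube_component assms(1)] assms(2) .

lemma measurable_id_unit_lborel: "(\<lambda>x. x) \<in> borel_measurable unit_lborel"
  by (rule measurable_restrict_space1) simp

lemma integrable_mult_bounded:
  fixes h :: "'b \<Rightarrow> complex" and f :: "'b \<Rightarrow> real"
  assumes "integrable M f" "h \<in> borel_measurable M" "\<And>x. x \<in> space M \<Longrightarrow> norm (h x) \<le> B"
  shows "integrable M (\<lambda>x. complex_of_real (f x) * h x)"
proof (rule Bochner_Integration.integrable_bound)
  show "integrable M (\<lambda>x. B * norm (f x))" using assms(1) by simp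
  show "(\<lambda>x. complex_of_real (f x) * h x) \<in> borel_measurable M"
    using assms(1,2) by (intro borel_measurable_times borel_measurable_of_real) auto
  show "AE x in M. norm (complex_of_real (f x) * h x) \<le> norm (B * norm (f x))"
  proof (rule AE_I2)
    fix x assume x: "x \<in> space M"
    have "norm (complex_of_real (f x) * h x) \<le> \<bar>f x\<bar> * B"
      unfolding norm_mult norm_of_real using assms(3)[OF x] by (intro mult_left_mono) auto
    also have "\<dots> \<le> \<bar>f x\<bar> * \<bar>B\<bar>" by (intro mult_left_mono) auto
    also have "\<dots> = norm (B * norm (f x))" by (simp add: mult.commute abs_mult)
    finally show "norm (complex_of_real (f x) * h x) \<le> norm (B * norm (f x))" .
  qed
qed

lemma norm_prod_le:
  fixes K :: "nat \<Rightarrow> real \<Rightarrow> complex"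
  assumes "\<And>j t. j \<in> u \<Longrightarrow> t \<in> {0..<1} \<Longrightarrow> norm (K j t) \<le> M j" "x \<in> cube u"
  shows "norm (\<Prod>j\<in>u. K j (x j)) \<le> (\<Prod>j\<in>u. M j)"
  unfolding prod_norm[symmetric] using assms by (intro prod_mono) (auto simp: cube_def PiE_iff)

lemma integrable_mult_prod:
  fixes K :: "nat \<Rightarrow> real \<Rightarrow> complex"
  assumes "integrable (cube_measure u) g"
    and "\<And>j. j \<in> u \<Longrightarrow> K j \<in> borel_measurable unit_lborel"
    and "\<And>j t. j \<in> u \<Longrightarrow> t \<in> {0..<1} \<Longrightarrow> norm (K j t) \<le> M j"
  shows "integrable (cube_measure u) (\<lambda>x. complex_of_real (g x) * (\<Prod>j\<in>u. K j (x j)))"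
  using assms norm_prod_le[of u K M]
  by (intro integrable_mult_bounded[where B = "\<Prod>j\<in>u. M j"] borel_measurable_prod)
     (auto simp: space_cube_measure intro: measurable_cube_component_comp)

lemma integrable_cube_restrict:
  fixes f :: "_ \<Rightarrow> real"
  assumes "finite w" "w \<subseteq> u" "integrable (cube_measure w) f"
  shows "integrable (cube_measure u) (\<lambda>x. f (restrict x w))"
proof -
  interpret product_prob_space "\<lambda>_::nat. unit_lborel" u
    by (intro product_prob_space.intro product_sigma_finite.intro product_prob_space_axioms.intro
        prob_space_unit_lborel prob_space_imp_sigma_finite)
  have d: "distr (cube_measure u) (cube_measure w) (\<lambda>x. restrict x w) = cube_measure w"
    unfolding cube_measure_def by (rule distr_PiM_restrict_finite[OF assms(1,2)])
  have m: "(\<lambda>x. restrict x w) \<in> measurable (cube_measure u) (cube_measure w)"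
    unfolding cube_measure_def using assms(2) by (rule measurable_restrict_subset)
  show ?thesis
    using assms(3) by (intro integrable_distr[OF m]) (simp add: d)
qed

lemma merge_empty: "y \<in> cube u \<Longrightarrow> merge {} u (x, y) = y"
  by (auto simp: cube_def PiE_iff merge_def extensional_def fun_eq_iff)

lemma marginals_exist_integrable:
  assumes "marginals_exist u g"
  shows "integrable (cube_measure u) g"
proof -
  have "(\<lambda>_. undefined) \<in> cube {}" by (simp add: cube_def)
  then have "integrable (cube_measure u) (\<lambda>y. g (merge {} u (\<lambda>_. undefined, y)))"
    using assms unfolding marginals_exist_def by (metis Diff_empty empty_subsetI)
  then show ?thesis
    by (rule Bochner_Integration.integrable_cong[THEN iffD1, rotated -1])
       (auto simp: space_cube_measure merge_empty)
qed

section \<open>Moving coordinates to the left ends of their cells\<close>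

definition left_end :: "nat \<Rightarrow> real \<Rightarrow> real" where
  "left_end n y = real (nat \<lfloor>y * real n\<rfloor>) / real n"

lemma cell_index:
  assumes "n \<ge> 1" "y \<in> {0..<1}"
  shows "nat \<lfloor>y * real n\<rfloor> < n" "left_end n y \<in> {0..<1}"
proof -
  have "y * real n < real n" using assms by simp
  then have "\<lfloor>y * real n\<rfloor> < int n" by (simp add: floor_less_iff)
  then show *: "nat \<lfloor>y * real n\<rfloor> < n" using assms by simp
  show "left_end n y \<in> {0..<1}"
    using cell_point_in_unit[OF *, of 0] by (simp add: left_end_def)
qed

lemma left_end_cell:
  assumes "i < n" "t \<in> {0..<1}"
  shows "left_end n ((real i + t) / real n) = real i / real n"
proof -
  have "\<lfloor>(real i + t) / real n * real n\<rfloor> = int i"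
    using assms by (intro floor_unique) auto
  then show ?thesis by (simp add: left_end_def)
qed

lemma cell_indicator:
  assumes "n \<ge> 1" "y \<in> {0..<1}" "i < n"
  shows "nat \<lfloor>y * real n\<rfloor> = i \<longleftrightarrow> y \<in> cell n i"
proof -
  have "nat \<lfloor>y * real n\<rfloor> = i \<longleftrightarrow> \<lfloor>y * real n\<rfloor> = int i" using assms by auto
  also have "\<dots> \<longleftrightarrow> real i \<le> y * real n \<and> y * real n < real i + 1" by (simp add: floor_eq_iff)
  also have "\<dots> \<longleftrightarrow> y \<in> cell n i"
    using assms by (auto simp: field_simps)
  finally show ?thesis .
qed

lemma cell_index_measurable_unit:
  "(\<lambda>y. nat \<lfloor>y * real n\<rfloor>) \<in> measurable unit_lborel (count_space UNIV)"
  by (rule measurable_restrict_space1) measurable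

text \<open>Left ends form a null set, so integrability of \<open>g\<close> over the cube says
  nothing about \<open>g\<close> there; existence of the marginals at every point does. If
  \<open>j\<close> is integrated out, the new function is a finite sum of sections with coordinate
  \<open>j\<close> fixed at a left end, each cut off to its cell.\<close>

lemma marginals_exist_left_end:
  assumes "finite u" "marginals_exist u g" "j \<in> u" "n \<ge> 1"
  shows "marginals_exist u (\<lambda>x. g (x(j := left_end n (x j))))"
  unfolding marginals_exist_def
proof (intro allI impI ballI)
  fix w x assume w: "w \<subseteq> u" and x: "x \<in> cube w"
  show "integrable (cube_measure (u - w)) (\<lambda>y. g ((merge w (u - w) (x, y))
      (j := left_end n (merge w (u - w) (x, y) j))))"
  proof (cases "j \<in> w")
    case True
    have "x(j := left_end n (x j)) \<in> cube w"
      using x True cell_index(2)[OF assms(4), of "x j"] by (auto simp: cube_def PiE_iff extensional_def)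
    then have "integrable (cube_measure (u - w)) (\<lambda>y. g (merge w (u - w) (x(j := left_end n (x j)), y)))"
      using assms(2) w unfolding marginals_exist_def by blast
    moreover have "merge w (u - w) (x(j := left_end n (x j)), y) =
       (merge w (u - w) (x, y))(j := left_end n (merge w (u - w) (x, y) j))" for y
      using True by (auto simp: merge_def fun_eq_iff)
    ultimately show ?thesis by simp
  next
    case False
    define v where "v = insert j w"
    have v: "v \<subseteq> u" "u - v \<subseteq> u - w" "finite (u - v)" using assms w by (auto simp: v_def)
    define X where "X i = x(j := real i / real n)" for i
    have "integrable (cube_measure (u - w))
      (\<lambda>y. \<Sum>i<n. indicator {y. nat \<lfloor>y j * real n\<rfloor> = i} y *\<^sub>R g (merge v (u - v) (X i, restrict y (u - v))))"
    proof (intro Bochner_Integration.integrable_sum integrable_real_mult_indicator)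
      fix i assume i: "i \<in> {..<n}"
      have "X i \<in> cube v"
        using x False i cell_point_in_unit[of i n 0] by (auto simp: X_def v_def cube_def PiE_iff extensional_def)
      then have "integrable (cube_measure (u - v)) (\<lambda>y. g (merge v (u - v) (X i, y)))"
        using assms(2) v unfolding marginals_exist_def by blast
      from integrable_cube_restrict[OF v(3,2) this]
      have int: "integrable (cube_measure (u - w)) (\<lambda>y. g (merge v (u - v) (X i, restrict y (u - v))))" .
      have "(\<lambda>y. nat \<lfloor>y j * real n\<rfloor>) \<in> measurable (cube_measure (u - w)) (count_space UNIV)"
        using False assms(3)
        by (intro measurable_compose[OF measurable_cube_component cell_index_measurable_unit]) auto
      from measurable_sets[OF this, of "{i}"]
      have "{y \<in> space (cube_measure (u - w)). nat \<lfloor>y j * real n\<rfloor> = i} \<in> sets (cube_measure (u - w))"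
        by (simp add: vimage_def Int_def conj_commute)
      from integrable_mult_indicator[OF this int]
      show "integrable (cube_measure (u - w)) (\<lambda>y. indicator {y. nat \<lfloor>y j * real n\<rfloor> = i} y *\<^sub>R
          g (merge v (u - v) (X i, restrict y (u - v))))"
        by (rule Bochner_Integration.integrable_cong[THEN iffD1, rotated -1]) (auto simp: indicator_def)
    qed
    then show ?thesis
    proof (rule Bochner_Integration.integrable_cong[THEN iffD1, rotated -1])
      fix y assume "y \<in> space (cube_measure (u - w))"
      then have y: "y \<in> cube (u - w)" by (simp add: space_cube_measure)
      then have yj: "y j \<in> {0..<1}" using assms(3) False by (auto simp: cube_def PiE_iff)
      define c where "c = nat \<lfloor>y j * real n\<rfloor>"
      have c: "c < n" using cell_index(1)[OF assms(4) yj] by (simp add: c_def)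
      have "(\<Sum>i<n. indicator {y. nat \<lfloor>y j * real n\<rfloor> = i} y *\<^sub>R g (merge v (u - v) (X i, restrict y (u - v)))) =
         (\<Sum>i<n. if c = i then g (merge v (u - v) (X i, restrict y (u - v))) else 0)"
        by (intro sum.cong refl) (auto simp: c_def)
      also have "\<dots> = g (merge v (u - v) (X c, restrict y (u - v)))" using c by simp
      also have "merge v (u - v) (X c, restrict y (u - v)) =
        (merge w (u - w) (x, y))(j := left_end n (merge w (u - w) (x, y) j))"
        using False assms(3) x by (auto simp: merge_def fun_eq_iff v_def X_def left_end_def c_def
            cube_def PiE_iff extensional_def)
      finally show "(\<Sum>i<n. indicator {y. nat \<lfloor>y j * real n\<rfloor> = i} y *\<^sub>R g (merge v (u - v) (X i, restrict y (u - v)))) =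
        g ((merge w (u - w) (x, y))(j := left_end n (merge w (u - w) (x, y) j)))" .
    qed simp
  qed
qed

text \<open>Within a cell the first factor does not depend on coordinate \<open>j\<close>, and the
  integral of \<open>K j\<close> over the cell is 0.\<close>

lemma integral_left_end_zero:
  fixes K :: "nat \<Rightarrow> real \<Rightarrow> complex"
  assumes "finite u" "marginals_exist u g" "j \<in> u" "n \<ge> 1"
    and K: "\<And>j. j \<in> u \<Longrightarrow> K j \<in> borel_measurable unit_lborel"
      "\<And>j t. j \<in> u \<Longrightarrow> t \<in> {0..<1} \<Longrightarrow> norm (K j t) \<le> M j"
    and zero: "\<And>i. i < n \<Longrightarrow> (LINT x:cell n i|lborel. K j x) = 0"
  shows "(LINT x|cube_measure u. complex_of_real (g (x(j := left_end n (x j)))) * (\<Prod>l\<in>u. K l (x l))) = 0"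
proof -
  define w where "w = u - {j}"
  have w: "u = insert j w" "finite w" "j \<notin> w" using assms(1,3) by (auto simp: w_def)
  have int: "integrable (cube_measure u) (\<lambda>x. complex_of_real (g (x(j := left_end n (x j)))) * (\<Prod>l\<in>u. K l (x l)))"
    by (rule integrable_mult_prod[OF marginals_exist_integrable[OF marginals_exist_left_end] K]) (use assms in auto)
  have "(LINT x|cube_measure u. complex_of_real (g (x(j := left_end n (x j)))) * (\<Prod>l\<in>u. K l (x l))) =
    (LINT x|cube_measure w. LINT y|unit_lborel.
      complex_of_real (g (x(j := left_end n y))) * (\<Prod>l\<in>u. K l ((x(j := y)) l)))"
    unfolding w(1) cube_measure_def
    by (subst cube.product_integral_insert[OF w(2,3) int[unfolded w(1) cube_measure_def]]) simp
  also have "\<dots> = (LINT x|cube_measure w. 0)"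
  proof (intro Bochner_Integration.integral_cong refl)
    fix x assume "x \<in> space (cube_measure w)"
    let ?P = "\<Prod>l\<in>w. K l (x l)" and ?G = "\<lambda>i. complex_of_real (g (x(j := real i / real n)))"
    have cell: "(LINT y|unit_lborel. indicator (cell n i) y *\<^sub>R K j y) = 0"
      "integrable unit_lborel (\<lambda>y. indicator (cell n i) y *\<^sub>R K j y)"
      if i: "i < n" for i
    proof -
      have le: "(real i + 1) / real n \<le> 1" using i by (simp add: field_simps)
      have "(LINT y|unit_lborel. indicator (cell n i) y *\<^sub>R K j y) =
        (LINT y|lborel. indicator {0..<1} y *\<^sub>R indicator (cell n i) y *\<^sub>R K j y)"
        by (rule integral_restrict_space) simp
      also have "\<dots> = (LINT x:cell n i|lborel. K j x)"
        unfolding set_lebesgue_integral_def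
        by (rule Bochner_Integration.integral_cong) (use le in \<open>auto simp: indicator_def intro: order_trans[rotated]\<close>)
      finally show "(LINT y|unit_lborel. indicator (cell n i) y *\<^sub>R K j y) = 0"
        using zero[OF i] by simp
      have "cell n i \<subseteq> {0..<1}" using le by (auto intro: order_trans[rotated])
      then have "cell n i \<in> sets unit_lborel"
        by (subst sets_restrict_space_iff) auto
      then show "integrable unit_lborel (\<lambda>y. indicator (cell n i) y *\<^sub>R K j y)"
        using K assms(3) by (intro integrable_mult_indicator integrable_unit_lborel[where B = "M j"]) auto
    qed
    have "(LINT y|unit_lborel. complex_of_real (g (x(j := left_end n y))) * (\<Prod>l\<in>u. K l ((x(j := y)) l))) =
      (LINT y|unit_lborel. (\<Sum>i<n. (?G i * ?P) *
        (indicator (cell n i) y *\<^sub>R K j y)))"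
    proof (intro Bochner_Integration.integral_cong refl)
      fix y assume "y \<in> space unit_lborel"
      then have y: "y \<in> {0..<1}" by (simp add: space_unit_lborel)
      define c where "c = nat \<lfloor>y * real n\<rfloor>"
      have c: "c < n" using cell_index(1)[OF assms(4) y] by (simp add: c_def)
      have P: "(\<Prod>l\<in>u. K l ((x(j := y)) l)) = K j y * ?P"
        unfolding w(1) using w by (simp add: prod.insert) (intro disjI2 prod.cong, auto)
      have "(\<Sum>i<n. (?G i * ?P) *
          (indicator (cell n i) y *\<^sub>R K j y)) =
        (\<Sum>i<n. if c = i then (?G i * ?P) * K j y else 0)"
        using cell_indicator[OF assms(4) y] unfolding c_def
        by (intro sum.cong refl) (auto simp: indicator_def)
      also have "\<dots> = (complex_of_real (g (x(j := real c / real n))) * ?P) * K j y" using c by simp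
      finally show "complex_of_real (g (x(j := left_end n y))) * (\<Prod>l\<in>u. K l ((x(j := y)) l)) =
        (\<Sum>i<n. (?G i * ?P) *
          (indicator (cell n i) y *\<^sub>R K j y))"
        unfolding P by (simp add: left_end_def c_def ac_simps)
    qed
    also have "\<dots> = (\<Sum>i<n. LINT y|unit_lborel. (?G i * ?P) *
        (indicator (cell n i) y *\<^sub>R K j y))"
      using cell by (intro Bochner_Integration.integral_sum integrable_mult_right) auto
    also have "\<dots> = 0"
      by (intro sum.neutral ballI) (subst integral_mult_right_zero, subst cell(1), auto)
    finally show "(LINT y|unit_lborel. complex_of_real (g (x(j := left_end n y))) * (\<Prod>l\<in>u. K l ((x(j := y)) l))) = 0" .
  qed
  finally show ?thesis by simp
qed

definition snap :: "(nat \<Rightarrow> nat) \<Rightarrow> nat set \<Rightarrow> (nat \<Rightarrow> real) \<Rightarrow> nat \<Rightarrow> real" where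
  "snap n v x = (\<lambda>j. if j \<in> v then left_end (n j) (x j) else x j)"

lemma snap_insert: "j \<notin> v \<Longrightarrow> snap n (insert j v) x = snap n v (x(j := left_end (n j) (x j)))"
  by (auto simp: snap_def fun_eq_iff)

lemma marginals_exist_snap:
  assumes "finite u" "marginals_exist u g" "\<And>j. j \<in> u \<Longrightarrow> n j \<ge> 1" "finite v" "v \<subseteq> u"
  shows "marginals_exist u (\<lambda>x. g (snap n v x))"
  using assms(4,5)
proof (induction v)
  case empty
  then show ?case using assms(2) by (simp add: snap_def)
next
  case (insert j v)
  then show ?case
    using marginals_exist_left_end[of u "\<lambda>x. g (snap n v x)" j "n j"] assms
    by (simp add: snap_insert)
qed

text \<open>Complementing the vertex set exchanges the two corners. This turns the reversed boxes
  that run from a point back to the left ends into genuine ones, up to sign.\<close>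

lemma box_diff_swap:
  assumes "finite u"
  shows "box_diff u g (x, y) = (- 1) ^ card u * box_diff u g (y, x)"
proof -
  have "box_diff u g (x, y) = (\<Sum>v\<in>Pow u. (- 1) ^ card (u - v) * g (box_vertex u (x, y) (u - v)))"
    unfolding box_diff_def
    by (rule sum.reindex_bij_witness[of _ "\<lambda>v. u - v" "\<lambda>v. u - v"]) (auto simp: double_diff)
  also have "\<dots> = (\<Sum>v\<in>Pow u. (- 1) ^ card u * ((- 1) ^ card v * g (box_vertex u (y, x) v)))"
  proof (intro sum.cong refl)
    fix v assume v: "v \<in> Pow u"
    then have "card u = card (u - v) + card v"
      using assms by (metis Pow_iff add.commute card_Diff_subset card_mono finite_subset le_add_diff_inverse)
    then have "(- 1 :: real) ^ card u * (- 1) ^ card v = (- 1) ^ card (u - v)"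
      by (simp add: power_add mult.assoc flip: power_mult_distrib)
    moreover have "box_vertex u (x, y) (u - v) = box_vertex u (y, x) v"
      using v by (auto simp: box_vertex_def fun_eq_iff)
    ultimately show "(- 1) ^ card (u - v) * g (box_vertex u (x, y) (u - v)) =
        (- 1) ^ card u * ((- 1) ^ card v * g (box_vertex u (y, x) v))"
      by (simp add: mult.assoc[symmetric])
  qed
  finally show ?thesis by (simp add: box_diff_def sum_distrib_left)
qed

text \<open>Inclusion and exclusion: in the expansion of the increment every vertex with some
  coordinate at a left end integrates to 0, and the only other vertex gives \<open>g\<close>
  itself.\<close>

lemma integral_eq_box_diff:
  fixes K :: "nat \<Rightarrow> real \<Rightarrow> complex"
  assumes "finite u" "marginals_exist u g" and n: "\<And>j. j \<in> u \<Longrightarrow> n j \<ge> 1"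
    and K: "\<And>j. j \<in> u \<Longrightarrow> K j \<in> borel_measurable unit_lborel"
      "\<And>j t. j \<in> u \<Longrightarrow> t \<in> {0..<1} \<Longrightarrow> norm (K j t) \<le> M j"
    and zero: "\<And>j i. j \<in> u \<Longrightarrow> i < n j \<Longrightarrow>
      (LINT x:cell (n j) i|lborel. K j x) = 0"
  defines "D \<equiv> \<lambda>x. box_diff u g (x, \<lambda>j\<in>u. left_end (n j) (x j))"
  shows "integrable (cube_measure u) D"
    and "(LINT x|cube_measure u. complex_of_real (g x) * (\<Prod>l\<in>u. K l (x l))) =
      (LINT x|cube_measure u. complex_of_real (D x) * (\<Prod>l\<in>u. K l (x l)))"
proof -
  have int: "integrable (cube_measure u) (\<lambda>x. g (snap n v x))" if "v \<in> Pow u" for v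
    using that assms finite_subset by (intro marginals_exist_integrable marginals_exist_snap) auto
  have int': "integrable (cube_measure u) (\<lambda>x. complex_of_real (g (snap n v x)) * (\<Prod>l\<in>u. K l (x l)))"
    if "v \<in> Pow u" for v
    by (rule integrable_mult_prod[OF int[OF that] K])
  have D: "D x = (\<Sum>v\<in>Pow u. (- 1) ^ card v * g (snap n v x))" if "x \<in> cube u" for x
    unfolding D_def box_diff_def
  proof (intro sum.cong refl arg_cong2[where f = times] arg_cong[where f = g])
    fix v assume "v \<in> Pow u"
    then show "box_vertex u (x, \<lambda>j\<in>u. left_end (n j) (x j)) v = snap n v x"
      using that by (auto simp: box_vertex_def snap_def fun_eq_iff cube_def PiE_iff extensional_def)
  qed
  show "integrable (cube_measure u) D"
    by (subst Bochner_Integration.integrable_cong[OF refl D])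
       (auto simp: space_cube_measure intro!: Bochner_Integration.integrable_sum int)
  have z: "(LINT x|cube_measure u. complex_of_real (g (snap n v x)) * (\<Prod>l\<in>u. K l (x l))) = 0"
    if v: "v \<in> Pow u" "v \<noteq> {}" for v
  proof -
    obtain j where j: "j \<in> v" using v by blast
    define v' where "v' = v - {j}"
    have v': "v = insert j v'" "j \<notin> v'" "finite v'" "v' \<subseteq> u" "j \<in> u"
      using v j assms(1) finite_subset by (auto simp: v'_def)
    have "(LINT x|cube_measure u. complex_of_real (g (snap n v' (x(j := left_end (n j) (x j))))) * (\<Prod>l\<in>u. K l (x l))) = 0"
      using v' assms(1,2) n zero
      by (intro integral_left_end_zero[where g = "\<lambda>x. g (snap n v' x)", OF _ _ _ _ K] marginals_exist_snap) auto
    then show ?thesis using v' by (simp add: snap_insert)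
  qed
  have "(LINT x|cube_measure u. complex_of_real (D x) * (\<Prod>l\<in>u. K l (x l))) =
    (LINT x|cube_measure u. (\<Sum>v\<in>Pow u. (- 1) ^ card v * (complex_of_real (g (snap n v x)) * (\<Prod>l\<in>u. K l (x l)))))"
    by (intro Bochner_Integration.integral_cong refl)
       (simp add: D space_cube_measure sum_distrib_right mult.assoc)
  also have "\<dots> = (\<Sum>v\<in>Pow u. (- 1) ^ card v * (LINT x|cube_measure u. complex_of_real (g (snap n v x)) * (\<Prod>l\<in>u. K l (x l))))"
    using int' by (subst Bochner_Integration.integral_sum) auto
  also have "\<dots> = (\<Sum>v\<in>{{}}. (- 1) ^ card v * (LINT x|cube_measure u. complex_of_real (g (snap n v x)) * (\<Prod>l\<in>u. K l (x l))))"
    using assms(1) z by (intro sum.mono_neutral_right) auto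
  finally show "(LINT x|cube_measure u. complex_of_real (g x) * (\<Prod>l\<in>u. K l (x l))) =
      (LINT x|cube_measure u. complex_of_real (D x) * (\<Prod>l\<in>u. K l (x l)))"
    by (simp add: snap_def)
qed

section \<open>Averaging over relative positions inside cells\<close>

lemma nn_integral_unit_cells:
  assumes "n \<ge> 1" and \<phi>: "\<phi> \<in> borel_measurable unit_lborel"
  shows "of_nat n * (\<integral>\<^sup>+ y. \<phi> y \<partial>unit_lborel) = (\<Sum>c<n. \<integral>\<^sup>+ y. \<phi> ((real c + y) / real n) \<partial>unit_lborel)"
proof -
  define \<psi> where "\<psi> = (\<lambda>y. \<phi> y * indicator {0..<1} y)"
  have [measurable]: "\<psi> \<in> borel_measurable borel"
    using \<phi> unfolding \<psi>_def by (subst (asm) borel_measurable_restrict_space_iff_ennreal) auto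
  have n: "real n > 0" using assms by simp
  have "(\<integral>\<^sup>+ y. \<phi> y \<partial>unit_lborel) = (\<integral>\<^sup>+ y. \<psi> y \<partial>lborel)"
    unfolding \<psi>_def by (rule nn_integral_restrict_space) simp
  also have "\<dots> = (\<integral>\<^sup>+ y. (\<Sum>c<n. \<psi> y * indicator (cell n c) y) \<partial>lborel)"
  proof (intro nn_integral_cong)
    fix y :: real
    show "\<psi> y = (\<Sum>c<n. \<psi> y * indicator (cell n c) y)"
    proof (cases "y \<in> {0..<1}")
      case True
      have "(\<Sum>c<n. \<psi> y * indicator (cell n c) y) = (\<Sum>c<n. if nat \<lfloor>y * real n\<rfloor> = c then \<psi> y else 0)"
        using cell_indicator[OF assms(1) True] by (intro sum.cong refl) (auto simp: indicator_def)
      also have "\<dots> = \<psi> y" using cell_index(1)[OF assms(1) True] by simp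
      finally show ?thesis ..
    qed (simp add: \<psi>_def)
  qed
  also have "\<dots> = (\<Sum>c<n. \<integral>\<^sup>+ y. \<psi> y * indicator (cell n c) y \<partial>lborel)"
    by (intro nn_integral_sum) auto
  also have "\<dots> = (\<Sum>c<n. ennreal (1 / real n) * (\<integral>\<^sup>+ y. \<phi> ((real c + y) / real n) \<partial>unit_lborel))"
  proof (intro sum.cong refl)
    fix c assume c: "c \<in> {..<n}"
    have "(\<integral>\<^sup>+ y. \<psi> y * indicator (cell n c) y \<partial>lborel) = ennreal \<bar>1 / real n\<bar> *
      (\<integral>\<^sup>+ y. \<psi> (real c / real n + 1 / real n * y) * indicator (cell n c) (real c / real n + 1 / real n * y) \<partial>lborel)"
      using n by (intro nn_integral_real_affine) auto
    also have "(\<integral>\<^sup>+ y. \<psi> (real c / real n + 1 / real n * y) * indicator (cell n c) (real c / real n + 1 / real n * y) \<partial>lborel) =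
       (\<integral>\<^sup>+ y. \<phi> ((real c + y) / real n) * indicator {0..<1} y \<partial>lborel)"
    proof (intro nn_integral_cong)
      fix y :: real
      have e: "real c / real n + 1 / real n * y = (real c + y) / real n" by (simp add: add_divide_distrib)
      have "(real c + y) / real n \<in> cell n c \<longleftrightarrow> y \<in> {0..<1}" using n by (auto simp: field_simps)
      moreover have "(real c + y) / real n \<in> {0..<1}" if "y \<in> {0..<1}"
        using cell_point_in_unit[of c n y] c that by simp
      ultimately show "\<psi> (real c / real n + 1 / real n * y) * indicator (cell n c) (real c / real n + 1 / real n * y) =
        \<phi> ((real c + y) / real n) * indicator {0..<1} y"
        unfolding e \<psi>_def by (auto simp: indicator_def)
    qed
    also have "\<dots> = (\<integral>\<^sup>+ y. \<phi> ((real c + y) / real n) \<partial>unit_lborel)"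
      by (rule nn_integral_restrict_space[symmetric]) simp
    finally show "(\<integral>\<^sup>+ y. \<psi> y * indicator (cell n c) y \<partial>lborel) =
      ennreal (1 / real n) * (\<integral>\<^sup>+ y. \<phi> ((real c + y) / real n) \<partial>unit_lborel)" by simp
  qed
  finally have "of_nat n * (\<integral>\<^sup>+ y. \<phi> y \<partial>unit_lborel) = 
    ennreal (real n) * ennreal (1 / real n) * (\<Sum>c<n. \<integral>\<^sup>+ y. \<phi> ((real c + y) / real n) \<partial>unit_lborel)"
    by (simp add: sum_distrib_left mult.assoc ennreal_of_nat_eq_real_of_nat)
  also have "ennreal (real n) * ennreal (1 / real n) = 1"
    using n by (simp flip: ennreal_mult)
  finally show ?thesis by simp
qed

lemma sum_over_PiE_insert:
  assumes "l \<notin> A"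
  shows "(\<Sum>i\<in>Pi\<^sub>E A B. \<Sum>c\<in>B l. h (i(l := c))) = (\<Sum>i\<in>Pi\<^sub>E (insert l A) B. h i)"
proof -
  have "(\<Sum>i\<in>Pi\<^sub>E (insert l A) B. h i) = (\<Sum>z\<in>B l \<times> Pi\<^sub>E A B. h (case z of (c, i) \<Rightarrow> i(l := c)))"
    unfolding PiE_insert_eq using inj_combinator[OF assms, of B]
    by (subst sum.reindex) (auto simp: comp_def)
  also have "\<dots> = (\<Sum>c\<in>B l. \<Sum>i\<in>Pi\<^sub>E A B. h (i(l := c)))"
    by (simp add: sum.cartesian_product case_prod_unfold)
  finally show ?thesis by (simp add: sum.swap[of _ "Pi\<^sub>E A B"])
qed

text \<open>Substituting \<open>(i + t) / n\<close> in each cell makes the left-hand side an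
  integral over relative positions \<open>t\<close> of the sum over cells. A bound for each
  \<open>t\<close> separately therefore suffices, and each \<open>t\<close> may use its own
  partition.\<close>

lemma nn_integral_cube_cells:
  fixes B :: ennreal
  assumes "finite u" "\<And>j. j \<in> u \<Longrightarrow> n j \<ge> 1" "\<Phi> \<in> borel_measurable (cube_measure u)"
    and "\<And>t. t \<in> cube u \<Longrightarrow> (\<Sum>i\<in>cells u n. \<Phi> (\<lambda>j\<in>u. (real (i j) + t j) / real (n j))) \<le> B"
  shows "(\<Prod>j\<in>u. of_nat (n j)) * (\<integral>\<^sup>+ x. \<Phi> x \<partial>cube_measure u) \<le> B"
  using assms
proof (induction u arbitrary: \<Phi> rule: finite_induct)
  case empty
  interpret prob_space "cube_measure {}" by (rule prob_space_cube_measure)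
  have "(\<integral>\<^sup>+ x. \<Phi> x \<partial>cube_measure {}) \<le> (\<integral>\<^sup>+ x. B \<partial>cube_measure {})"
    using empty(3) by (intro nn_integral_mono) (auto simp: space_cube_measure cube_def)
  then show ?case by (simp add: emeasure_space_1)
next
  case (insert j w)
  note \<Phi> = insert.prems(2)
  have m: "(\<lambda>(x, y). \<Phi> (x(j := y))) \<in> borel_measurable (cube_measure w \<Otimes>\<^sub>M unit_lborel)"
    using measurable_compose[OF measurable_add_dim[of j w "\<lambda>_. unit_lborel"] \<Phi>[unfolded cube_measure_def]]
    by (simp add: cube_measure_def case_prod_unfold del: fun_upd_apply)
  interpret C: prob_space "cube_measure w" by (rule prob_space_cube_measure)
  have m1: "(\<lambda>y. \<integral>\<^sup>+ x. \<Phi> (x(j := y)) \<partial>cube_measure w) \<in> borel_measurable unit_lborel"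
  proof (rule C.borel_measurable_nn_integral)
    show "(\<lambda>(y, x). \<Phi> (x(j := y))) \<in> borel_measurable (unit_lborel \<Otimes>\<^sub>M cube_measure w)"
      using measurable_compose[OF measurable_pair_swap' m] by (simp add: case_prod_unfold)
  qed
  have m2: "(\<lambda>x. \<Phi> (x(j := y))) \<in> borel_measurable (cube_measure w)" if "y \<in> {0..<1}" for y
    using measurable_compose[OF measurable_Pair2'[of y unit_lborel "cube_measure w"] m] that
      measurable_compose[OF measurable_Pair1' m] by (simp add: space_unit_lborel)
  have m3: "(\<lambda>y. \<integral>\<^sup>+ x. \<Phi> (x(j := (real c + y) / real (n j))) \<partial>cube_measure w) \<in> borel_measurable unit_lborel"
    if "c < n j" for c
  proof -
    have "(\<lambda>y. (real c + y) / real (n j)) \<in> measurable unit_lborel unit_lborel"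
      using cell_point_in_unit[of c "n j"] that measurable_id_unit_lborel
      by (intro measurable_restrict_space2) (auto simp: space_unit_lborel)
    from measurable_compose[OF this m1] show ?thesis .
  qed
  have nj: "n j \<ge> 1" using insert.prems(1) by simp
  have "(\<Prod>l\<in>insert j w. of_nat (n l)) * (\<integral>\<^sup>+ x. \<Phi> x \<partial>cube_measure (insert j w)) =
    (\<Prod>l\<in>w. of_nat (n l)) * (of_nat (n j) * (\<integral>\<^sup>+ y. \<integral>\<^sup>+ x. \<Phi> (x(j := y)) \<partial>cube_measure w \<partial>unit_lborel))"
    using cube.product_nn_integral_insert_rev[OF insert.hyps \<Phi>[unfolded cube_measure_def]] insert.hyps
    by (simp add: cube_measure_def ac_simps del: fun_upd_apply)
  also have "of_nat (n j) * (\<integral>\<^sup>+ y. \<integral>\<^sup>+ x. \<Phi> (x(j := y)) \<partial>cube_measure w \<partial>unit_lborel) =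
    (\<Sum>c<n j. \<integral>\<^sup>+ y. \<integral>\<^sup>+ x. \<Phi> (x(j := (real c + y) / real (n j))) \<partial>cube_measure w \<partial>unit_lborel)"
    by (rule nn_integral_unit_cells[OF nj m1])
  also have "\<dots> = (\<integral>\<^sup>+ y. (\<Sum>c<n j. \<integral>\<^sup>+ x. \<Phi> (x(j := (real c + y) / real (n j))) \<partial>cube_measure w) \<partial>unit_lborel)"
  proof (rule nn_integral_sum[symmetric])
    fix c assume c: "c \<in> {..<n j}"
    then show "(\<lambda>y. \<integral>\<^sup>+ x. \<Phi> (x(j := (real c + y) / real (n j))) \<partial>cube_measure w) \<in> borel_measurable unit_lborel"
      by (intro m3) simp
  qed
  also have "(\<Prod>l\<in>w. of_nat (n l)) * \<dots> \<le> (\<integral>\<^sup>+ y. B \<partial>unit_lborel)"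
  proof (subst nn_integral_cmult[symmetric], goal_cases)
    case 1
    show ?case by (intro borel_measurable_sum m3) simp
  next
    case 2
    show ?case
    proof (intro nn_integral_mono)
      fix y assume "y \<in> space unit_lborel"
      then have y: "y \<in> {0..<1}" by (simp add: space_unit_lborel)
      have cy: "(real c + y) / real (n j) \<in> {0..<1}" if "c < n j" for c
        using cell_point_in_unit[of c "n j" y] that y by auto
      have "(\<Sum>c<n j. \<integral>\<^sup>+ x. \<Phi> (x(j := (real c + y) / real (n j))) \<partial>cube_measure w) =
        (\<integral>\<^sup>+ x. (\<Sum>c<n j. \<Phi> (x(j := (real c + y) / real (n j)))) \<partial>cube_measure w)"
        using m2[OF cy] by (intro nn_integral_sum[symmetric]) auto
      also have "(\<Prod>l\<in>w. of_nat (n l)) * \<dots> \<le> B"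
      proof (rule insert.IH)
        show "(\<lambda>x. \<Sum>c<n j. \<Phi> (x(j := (real c + y) / real (n j)))) \<in> borel_measurable (cube_measure w)"
          using m2[OF cy] by (intro borel_measurable_sum) auto
        fix t assume t: "t \<in> cube w"
        let ?h = "\<lambda>i. \<Phi> (\<lambda>l\<in>insert j w. (real (i l) + (t(j := y)) l) / real (n l))"
        have "(\<lambda>l\<in>w. (real (i l) + t l) / real (n l))(j := (real c + y) / real (n j)) =
          (\<lambda>l\<in>insert j w. (real ((i(j := c)) l) + (t(j := y)) l) / real (n l))" for i c
          using insert.hyps by (auto simp: fun_eq_iff)
        then have "(\<Sum>i\<in>cells w n. \<Sum>c<n j. \<Phi> ((\<lambda>l\<in>w. (real (i l) + t l) / real (n l))(j := (real c + y) / real (n j)))) =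
          (\<Sum>i\<in>cells w n. \<Sum>c<n j. ?h (i(j := c)))" by simp
        also have "\<dots> = (\<Sum>i\<in>cells (insert j w) n. ?h i)"
          by (rule sum_over_PiE_insert[OF insert.hyps(2)])
        also have "\<dots> \<le> B"
        proof (rule insert.prems(3))
          show "t(j := y) \<in> cube (insert j w)" using t y by (auto simp: cube_def PiE_iff extensional_def)
        qed
        finally show "(\<Sum>i\<in>cells w n. \<Sum>c<n j. \<Phi> ((\<lambda>l\<in>w. (real (i l) + t l) / real (n l))(j := (real c + y) / real (n j)))) \<le> B" .
      qed (use insert.prems(1) in auto)
      finally show "(\<Prod>l\<in>w. of_nat (n l)) * (\<Sum>c<n j. \<integral>\<^sup>+ x. \<Phi> (x(j := (real c + y) / real (n j))) \<partial>cube_measure w) \<le> B" .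
    qed
  qed
  also have "\<dots> = B" by (simp add: emeasure_restrict_space space_unit_lborel)
  finally show ?case .
qed

text \<open>Once \<open>g\<close> is replaced by \<open>D\<close>, the kernels enter only through
  their bounds. The sum of the increments over the cells has size \<open>n powr (1 - lam)\<close>
  per direction, and averaging over the cells divides it by \<open>n\<close>.\<close>

lemma oscillation_bound:
  fixes K :: "nat \<Rightarrow> real \<Rightarrow> complex"
  assumes "finite u" "marginals_exist u g"
    and V: "vitali_variation lam \<pp> u g = ennreal V" "V \<ge> 0" and pp: "\<pp> \<ge> 1"
    and lam: "0 < lam" "lam \<le> 1"
    and n: "\<And>j. j \<in> u \<Longrightarrow> n j \<ge> 1"
    and K: "\<And>j. j \<in> u \<Longrightarrow> K j \<in> borel_measurable unit_lborel"
      "\<And>j t. j \<in> u \<Longrightarrow> t \<in> {0..<1} \<Longrightarrow> norm (K j t) \<le> M j"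
    and zero: "\<And>j i. j \<in> u \<Longrightarrow> i < n j \<Longrightarrow>
      (LINT x:cell (n j) i|lborel. K j x) = 0"
  shows "norm (LINT x|cube_measure u. complex_of_real (g x) * (\<Prod>l\<in>u. K l (x l))) \<le>
    8 ^ card u * (\<Prod>j\<in>u. M j * real (n j) powr - lam) * V"
proof -
  define D where "D = (\<lambda>x. box_diff u g (x, \<lambda>j\<in>u. left_end (n j) (x j)))"
  have D: "integrable (cube_measure u) D"
    "(LINT x|cube_measure u. complex_of_real (g x) * (\<Prod>l\<in>u. K l (x l))) =
      (LINT x|cube_measure u. complex_of_real (D x) * (\<Prod>l\<in>u. K l (x l)))"
    unfolding D_def by (rule integral_eq_box_diff[OF assms(1,2) n K zero]; assumption)+
  have M0: "M j \<ge> 0" if "j \<in> u" for j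
    using K(2)[OF that, of 0] norm_ge_zero[of "K j 0"] by (simp del: norm_ge_zero)
  let ?P = "\<Prod>j\<in>u. M j"
  have P0: "?P \<ge> 0" using M0 by (rule prod_nonneg)
  let ?B = "8 ^ card u * (\<Prod>j\<in>u. real (n j) powr (1 - lam)) * V"
  let ?n = "\<Prod>j\<in>u. real (n j)"
  have n0: "?n > 0" using n by (intro prod_pos) force
  have "norm (LINT x|cube_measure u. complex_of_real (D x) * (\<Prod>l\<in>u. K l (x l))) \<le>
    (LINT x|cube_measure u. \<bar>D x\<bar> * ?P)"
  proof (rule order_trans[OF integral_norm_bound], rule integral_mono)
    show "integrable (cube_measure u) (\<lambda>x. norm (complex_of_real (D x) * (\<Prod>l\<in>u. K l (x l))))"
      by (rule integrable_norm[OF integrable_mult_prod[OF D(1) K]])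
    show "integrable (cube_measure u) (\<lambda>x. \<bar>D x\<bar> * ?P)" using D(1) by auto
    fix x assume "x \<in> space (cube_measure u)"
    then have "norm (\<Prod>l\<in>u. K l (x l)) \<le> ?P"
      using K(2) by (intro norm_prod_le) (auto simp: space_cube_measure)
    then show "norm (complex_of_real (D x) * (\<Prod>l\<in>u. K l (x l))) \<le> \<bar>D x\<bar> * ?P"
      unfolding norm_mult norm_of_real by (intro mult_left_mono) auto
  qed
  also have "\<dots> = (LINT x|cube_measure u. \<bar>D x\<bar>) * ?P" by simp
  also have "(LINT x|cube_measure u. \<bar>D x\<bar>) \<le> ?B / ?n"
  proof -
    have "(\<Prod>j\<in>u. of_nat (n j)) * (\<integral>\<^sup>+ x. ennreal \<bar>D x\<bar> \<partial>cube_measure u) \<le> ennreal ?B"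
    proof (rule nn_integral_cube_cells[OF assms(1) n])
      show "(\<lambda>x. ennreal \<bar>D x\<bar>) \<in> borel_measurable (cube_measure u)" using D(1) by auto
      fix t assume t: "t \<in> cube u"
      have e: "\<bar>D (\<lambda>j\<in>u. (real (i j) + t j) / real (n j))\<bar> = \<bar>box_diff u g (cell_box u n i (\<lambda>_. 0) t)\<bar>"
        if i: "i \<in> cells u n" for i
      proof -
        have "left_end (n j) ((real (i j) + t j) / real (n j)) = real (i j) / real (n j)" if "j \<in> u" for j
          using i t that by (intro left_end_cell) (auto simp: cube_def)
        then have "D (\<lambda>j\<in>u. (real (i j) + t j) / real (n j)) =
          box_diff u g (\<lambda>j\<in>u. (real (i j) + t j) / real (n j), \<lambda>j\<in>u. (real (i j) + 0) / real (n j))"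
          unfolding D_def by (intro arg_cong[where f = "box_diff u g"]) (auto simp: fun_eq_iff)
        also have "\<dots> = (- 1) ^ card u * box_diff u g (cell_box u n i (\<lambda>_. 0) t)"
          unfolding cell_box_def by (rule box_diff_swap[OF assms(1)])
        finally show ?thesis by (simp add: abs_mult power_abs)
      qed
      have "(\<Sum>i\<in>cells u n. ennreal \<bar>D (\<lambda>j\<in>u. (real (i j) + t j) / real (n j))\<bar>) =
        (\<Sum>i\<in>cells u n. ennreal \<bar>box_diff u g (cell_box u n i (\<lambda>_. 0) t)\<bar>)"
        using e by (intro sum.cong refl) simp
      also have "\<dots> = ennreal (\<Sum>i\<in>cells u n. \<bar>box_diff u g (cell_box u n i (\<lambda>_. 0) t)\<bar>)"
        by (rule sum_ennreal) simp
      also have "\<dots> \<le> ennreal ?B"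
        by (intro ennreal_leI cell_boxes_variation_anchored[OF assms(1) V pp lam n t])
      finally show "(\<Sum>i\<in>cells u n. ennreal \<bar>D (\<lambda>j\<in>u. (real (i j) + t j) / real (n j))\<bar>) \<le> ennreal ?B" .
    qed
    also have "(\<integral>\<^sup>+ x. ennreal \<bar>D x\<bar> \<partial>cube_measure u) = ennreal (LINT x|cube_measure u. \<bar>D x\<bar>)"
      using D(1) by (intro nn_integral_eq_integral) auto
    also have "(\<Prod>j\<in>u. of_nat (n j)) = ennreal ?n"
      by (simp add: prod_ennreal ennreal_of_nat_eq_real_of_nat)
    finally have "ennreal (?n * (LINT x|cube_measure u. \<bar>D x\<bar>)) \<le> ennreal ?B"
      using n0 by (simp add: ennreal_mult')
    moreover have "?B \<ge> 0" using V by (intro mult_nonneg_nonneg prod_nonneg) auto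
    ultimately have "?n * (LINT x|cube_measure u. \<bar>D x\<bar>) \<le> ?B" by (simp add: ennreal_le_iff)
    then show ?thesis using n0 by (simp add: field_simps)
  qed
  also have "?B / ?n * ?P = 8 ^ card u * (\<Prod>j\<in>u. M j * real (n j) powr - lam) * V"
  proof -
    have "(\<Prod>j\<in>u. real (n j) powr (1 - lam)) / ?n = (\<Prod>j\<in>u. real (n j) powr - lam)"
      unfolding prod_dividef[symmetric]
    proof (intro prod.cong refl)
      fix j assume "j \<in> u"
      then show "real (n j) powr (1 - lam) / real (n j) = real (n j) powr - lam"
        using n[of j] by (simp add: powr_diff powr_minus_divide)
    qed
    moreover have "?B / ?n * ?P = 8 ^ card u * (?P * ((\<Prod>j\<in>u. real (n j) powr (1 - lam)) / ?n)) * V"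
      by (simp add: ac_simps)
    ultimately show ?thesis by (simp only: prod.distrib)
  qed
  finally show ?thesis using D(2) P0 by (simp add: mult_right_mono)
qed

section \<open>Fubini for marginals\<close>

lemma integrable_merge:
  fixes f :: "_ \<Rightarrow> 'b::{banach, second_countable_topology}"
  assumes "finite u" "w \<subseteq> u" "integrable (cube_measure u) f"
  shows "integrable (cube_measure w \<Otimes>\<^sub>M cube_measure (u - w)) (\<lambda>z. f (merge w (u - w) z))"
proof -
  have e: "w \<union> (u - w) = u" and fw: "finite w" using assms finite_subset by auto
  have "distr (cube_measure w \<Otimes>\<^sub>M cube_measure (u - w)) (cube_measure u) (merge w (u - w)) = cube_measure u"
    using cube.distr_merge[of w "u - w"] assms(1) fw unfolding e cube_measure_def by simp
  moreover have "merge w (u - w) \<in> measurable (cube_measure w \<Otimes>\<^sub>M cube_measure (u - w)) (cube_measure u)"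
    using measurable_merge[of w "u - w" "\<lambda>_. unit_lborel"] assms(2)
    by (simp add: cube_measure_def Un_absorb1)
  ultimately show ?thesis using assms(3) by (metis integrable_distr)
qed

lemma integral_merge:
  fixes f :: "_ \<Rightarrow> 'b::{banach, second_countable_topology}"
  assumes "finite u" "w \<subseteq> u" "integrable (cube_measure u) f"
  shows "(LINT x|cube_measure u. f x) =
    (LINT x|cube_measure w. LINT y|cube_measure (u - w). f (merge w (u - w) (x, y)))"
proof -
  have e: "w \<union> (u - w) = u" using assms(2) by auto
  have "finite w" using assms finite_subset by blast
  then show ?thesis
    using cube.product_integral_fold[of w "u - w" f] assms unfolding cube_measure_def e by simp
qed

lemma marginals_exist_marginal:
  assumes "finite u" "marginals_exist u g" "w \<subseteq> u"
  shows "marginals_exist w (marginal u w g)"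
  unfolding marginals_exist_def
proof (intro allI impI ballI)
  fix v x assume v: "v \<subseteq> w" and x: "x \<in> cube v"
  let ?G = "\<lambda>y. g (merge v (u - v) (x, y))"
  have "integrable (cube_measure (u - v)) ?G"
    using assms(2,3) v x unfolding marginals_exist_def by blast
  then have "integrable (cube_measure (w - v) \<Otimes>\<^sub>M cube_measure ((u - v) - (w - v)))
      (\<lambda>z. ?G (merge (w - v) ((u - v) - (w - v)) z))"
    using assms by (intro integrable_merge) auto
  moreover have e: "(u - v) - (w - v) = u - w" using v by auto
  ultimately have int: "integrable (cube_measure (w - v) \<Otimes>\<^sub>M cube_measure (u - w))
      (\<lambda>z. ?G (merge (w - v) (u - w) z))" by simp
  interpret A: prob_space "cube_measure (w - v)" by (rule prob_space_cube_measure)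
  interpret B: prob_space "cube_measure (u - w)" by (rule prob_space_cube_measure)
  interpret pair_sigma_finite "cube_measure (w - v)" "cube_measure (u - w)" ..
  have "merge v (u - v) (x, merge (w - v) (u - w) (y, z)) = merge w (u - w) (merge v (w - v) (x, y), z)" for y z
    using v assms(3) by (auto simp: merge_def fun_eq_iff)
  then show "integrable (cube_measure (w - v)) (\<lambda>y. marginal u w g (merge v (w - v) (x, y)))"
    using integrable_fst'[OF int] by (simp add: marginal_def)
qed

lemma integral_marginal:
  fixes H :: "nat \<Rightarrow> real \<Rightarrow> complex"
  assumes "finite u" "integrable (cube_measure u) g" "w \<subseteq> u"
    and "\<And>j. j \<in> w \<Longrightarrow> H j \<in> borel_measurable unit_lborel"
    and "\<And>j t. j \<in> w \<Longrightarrow> t \<in> {0..<1} \<Longrightarrow> norm (H j t) \<le> M j"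
  shows "integrable (cube_measure u) (\<lambda>x. complex_of_real (g x) * (\<Prod>j\<in>w. H j (x j)))"
    and "(LINT x|cube_measure u. complex_of_real (g x) * (\<Prod>j\<in>w. H j (x j))) =
      (LINT x|cube_measure w. complex_of_real (marginal u w g x) * (\<Prod>j\<in>w. H j (x j)))"
proof -
  let ?F = "\<lambda>x. complex_of_real (g x) * (\<Prod>j\<in>w. H j (x j))"
  show int: "integrable (cube_measure u) ?F"
  proof (rule integrable_mult_bounded[OF assms(2), where B = "\<Prod>j\<in>w. M j"])
    show "(\<lambda>x. \<Prod>j\<in>w. H j (x j)) \<in> borel_measurable (cube_measure u)"
      using assms(3,4) by (intro borel_measurable_prod measurable_cube_component_comp) auto
    fix x assume "x \<in> space (cube_measure u)"
    then have "x j \<in> {0..<1}" if "j \<in> w" for j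
      using assms(3) that by (auto simp: space_cube_measure cube_def PiE_iff)
    then show "norm (\<Prod>j\<in>w. H j (x j)) \<le> (\<Prod>j\<in>w. M j)"
      unfolding prod_norm[symmetric] using assms(5) by (intro prod_mono) auto
  qed
  have "(LINT y|cube_measure (u - w). ?F (merge w (u - w) (x, y))) =
      complex_of_real (marginal u w g x) * (\<Prod>j\<in>w. H j (x j))" for x
  proof -
    have "(\<Prod>j\<in>w. H j (merge w (u - w) (x, y) j)) = (\<Prod>j\<in>w. H j (x j))" for y
      by (intro prod.cong) (auto simp: merge_def)
    then show ?thesis
      unfolding marginal_def by (simp only: integral_mult_left_zero integral_complex_of_real)
  qed
  then show "(LINT x|cube_measure u. ?F x) =
      (LINT x|cube_measure w. complex_of_real (marginal u w g x) * (\<Prod>j\<in>w. H j (x j)))"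
    by (subst integral_merge[OF assms(1,3) int]) (simp only:)
qed

section \<open>Extended powers, and the Hardy and Krause sum\<close>

lemma epowr_mono: "0 \<le> a \<Longrightarrow> x \<le> y \<Longrightarrow> epowr x a \<le> epowr y a"
  by (auto simp: epowr_def top_unique intro!: ennreal_leI powr_mono2 enn2real_mono
      simp: top.not_eq_extremum)

lemma epowr_epowr_inverse: "a > 0 \<Longrightarrow> epowr (epowr x a) (1 / a) = x"
  by (auto simp: epowr_def powr_powr top.not_eq_extremum)

lemma epowr_eq_0_iff: "epowr x a = 0 \<longleftrightarrow> x = 0"
  by (cases x) (auto simp: epowr_def)

lemma epowr_eq_top_iff: "epowr x a = \<infinity> \<longleftrightarrow> x = \<infinity>"
  by (auto simp: epowr_def)

text \<open>A finite sum norm dominates each of its terms with constant 1, so its exponent leaves no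
  trace in later estimates.\<close>

lemma le_epowr_sum:
  assumes "finite A" "i \<in> A" "a > 0"
  shows "X i \<le> epowr (\<Sum>i\<in>A. epowr (X i) a) (1 / a)"
proof -
  have "epowr (X i) a \<le> (\<Sum>i\<in>A. epowr (X i) a)"
    using assms by (intro member_le_sum) auto
  from epowr_mono[OF _ this, of "1 / a"] show ?thesis
    using assms by (simp add: epowr_epowr_inverse)
qed

lemma hk_variation_ge:
  assumes "finite u" "w \<subseteq> u" "\<qq> \<ge> 1" "hk_variation lam \<pp> \<qq> u g \<noteq> \<infinity>"
  shows "marginals_exist u g"
    and "(if w = {} then ennreal \<bar>marginal u {} g (\<lambda>_. undefined)\<bar>
          else vitali_variation lam \<pp> w (marginal u w g)) \<le> hk_variation lam \<pp> \<qq> u g"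
proof -
  show m: "marginals_exist u g" using assms(4) by (auto simp: hk_variation_def split: if_splits)
  show "(if w = {} then ennreal \<bar>marginal u {} g (\<lambda>_. undefined)\<bar>
          else vitali_variation lam \<pp> w (marginal u w g)) \<le> hk_variation lam \<pp> \<qq> u g"
    using le_epowr_sum[of "Pow u" w \<qq> "\<lambda>w. if w = {} then ennreal \<bar>marginal u {} g (\<lambda>_. undefined)\<bar>
          else vitali_variation lam \<pp> w (marginal u w g)"] assms m
    by (simp add: hk_variation_def)
qed

text \<open>In each variable the kernel is split into its mean, which leads to a marginal of \<open>g\<close>, and an
  oscillating part.\<close>

lemma hk_variation_bound:
  fixes K :: "nat \<Rightarrow> real \<Rightarrow> complex"
  assumes u: "finite u" and hk: "hk_variation lam \<pp> \<qq> u g = ennreal h" "h \<ge> 0"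
    and pq: "\<pp> \<ge> 1" "\<qq> \<ge> 1" and lam: "0 < lam" "lam \<le> 1"
    and n: "\<And>j. j \<in> u \<Longrightarrow> n j \<ge> 1"
    and K: "\<And>j. j \<in> u \<Longrightarrow> K j \<in> borel_measurable unit_lborel"
      "\<And>j t. j \<in> u \<Longrightarrow> t \<in> {0..<1} \<Longrightarrow> norm (K j t) \<le> M j"
    and zero: "\<And>j. j \<in> u \<Longrightarrow> n j = 1 \<or> (\<forall>i<n j.
      (LINT x:cell (n j) i|lborel. K j x) = 0)"
  shows "norm (LINT x|cube_measure u. complex_of_real (g x) * (\<Prod>j\<in>u. K j (x j))) \<le>
    32 ^ card u * (\<Prod>j\<in>u. M j * real (n j) powr - lam) * h"
proof -
  define m where "m = (\<lambda>j. LINT x|unit_lborel. K j x)"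
  define H where "H = (\<lambda>j x. K j x - m j)"
  define R where "R = (\<lambda>j. M j * real (n j) powr - lam)"
  have M0: "M j \<ge> 0" if "j \<in> u" for j
    using K(2)[OF that, of 0] norm_ge_zero[of "K j 0"] by (simp del: norm_ge_zero)
  have R0: "R j \<ge> 0" if "j \<in> u" for j using M0[OF that] by (simp add: R_def)
  have intK: "integrable unit_lborel (K j)" if "j \<in> u" for j
    using K that by (intro integrable_unit_lborel[where B = "M j"]) auto
  have m_le: "norm (m j) \<le> M j" if "j \<in> u" for j
  proof -
    have "norm (m j) \<le> (LINT x|unit_lborel. norm (K j x))"
      unfolding m_def by (rule integral_norm_bound)
    also have "\<dots> \<le> M j"
      using intK[OF that] K(2)[OF that] by (intro cube.M.integral_le_const) (auto simp: space_unit_lborel)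
    finally show ?thesis .
  qed
  \<comment> \<open>The cells cover the unit interval, so mean zero on each of them gives total mean
    zero.\<close>
  have m_zero: "m j = 0" if j: "j \<in> u" and "n j \<noteq> 1" for j
  proof -
    have z: "(LINT x:cell (n j) i|lborel. K j x) = 0" if "i < n j" for i
      using zero[OF j] \<open>n j \<noteq> 1\<close> that by blast
    have n0: "real (n j) > 0" using n[OF j] by simp
    have "set_integrable lborel {0..<1} (K j)"
      using intK[OF j] by (simp add: integrable_restrict_space set_integrable_def)
    then have "(LINT x:{0..<0 + real (n j) * (1 / real (n j))}|lborel. K j x) =
      (\<Sum>d<n j. LINT x:{0 + real d * (1 / real (n j))..<0 + real d * (1 / real (n j)) + 1 / real (n j)}|lborel. K j x)"
      using n0 by (intro set_integral_cells) auto
    also have "\<dots> = 0"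
      using z by (intro sum.neutral) (simp add: add_divide_distrib)
    finally have "(LINT x:{0..<1}|lborel. K j x) = 0" using n0 by simp
    then show ?thesis unfolding m_def
      by (subst integral_restrict_space) (auto simp: set_lebesgue_integral_def)
  qed
  \<comment> \<open>For \<open>n j = 1\<close> the factor \<open>n j powr - lam\<close> is 1,
    otherwise the mean is 0; in both cases the mean obeys the bound wanted for direction
    \<open>j\<close>.\<close>
  have m_R: "norm (m j) \<le> R j" if "j \<in> u" for j
    using m_le[OF that] m_zero[OF that] R0[OF that] by (cases "n j = 1") (auto simp: R_def)
  have H1: "H j \<in> borel_measurable unit_lborel" if "j \<in> u" for j
    using K(1)[OF that] unfolding H_def by measurable
  have H2: "norm (H j t) \<le> 2 * M j" if "j \<in> u" "t \<in> {0..<1}" for j t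
    using K(2)[OF that] m_le[OF that(1)] norm_triangle_ineq4[of "K j t" "m j"] by (simp add: H_def)
  \<comment> \<open>If \<open>n j = 1\<close>, the only cell is the whole interval and subtracting
    the mean produces mean zero there; otherwise the subtracted mean is 0 and the property is
    inherited from \<open>K j\<close>.\<close>
  have H3: "(LINT x:cell (n j) i|lborel. H j x) = 0"
    if j: "j \<in> u" and i: "i < n j" for j i
  proof (cases "n j = 1")
    case True
    then have "cell (n j) i = {0..<1}" using i by auto
    then have "(LINT x:cell (n j) i|lborel. H j x) =
        (LINT x|unit_lborel. H j x)"
      by (simp add: set_lebesgue_integral_def integral_restrict_space)
    also have "\<dots> = 0"
      unfolding H_def using intK[OF j] by (simp add: m_def measure_restrict_space space_unit_lborel)
    finally show ?thesis .
  next
    case False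
    then show ?thesis using zero[OF j] m_zero[OF j] i by (simp add: H_def)
  qed
  have fin: "hk_variation lam \<pp> \<qq> u g \<noteq> \<infinity>" using hk by simp
  have me: "marginals_exist u g" using hk_variation_ge(1)[OF u _ pq(2) fin] by blast
  have intg: "integrable (cube_measure u) g" by (rule marginals_exist_integrable[OF me])
  have wb: "norm (LINT x|cube_measure w. complex_of_real (marginal u w g x) * (\<Prod>j\<in>w. H j (x j))) \<le>
    8 ^ card w * (\<Prod>j\<in>w. (2 * M j) * real (n j) powr - lam) * h" if w: "w \<in> Pow u" for w
  proof (cases "w = {}")
    case True
    interpret prob_space "cube_measure {}" by (rule prob_space_cube_measure)
    have "\<bar>marginal u {} g (\<lambda>_. undefined)\<bar> \<le> h"
      using hk_variation_ge(2)[OF u _ pq(2) fin, of "{}"] hk by simp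
    moreover have "(LINT x|cube_measure {}. complex_of_real (marginal u {} g x) * (\<Prod>j\<in>{}. H j (x j))) =
      (LINT x|cube_measure {}. complex_of_real (marginal u {} g (\<lambda>_. undefined)))"
      by (intro Bochner_Integration.integral_cong) (auto simp: space_cube_measure cube_def)
    ultimately show ?thesis using True by (simp add: prob_space)
  next
    case False
    have le: "vitali_variation lam \<pp> w (marginal u w g) \<le> ennreal h"
      using hk_variation_ge(2)[OF u _ pq(2) fin, of w] hk w False by simp
    then obtain V where V: "vitali_variation lam \<pp> w (marginal u w g) = ennreal V" "V \<ge> 0"
      by (cases "vitali_variation lam \<pp> w (marginal u w g)") (auto simp: top_unique)
    have "V \<le> h" using le V hk by (simp add: ennreal_le_iff)
    have "norm (LINT x|cube_measure w. complex_of_real (marginal u w g x) * (\<Prod>j\<in>w. H j (x j))) \<le>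
      8 ^ card w * (\<Prod>j\<in>w. (2 * M j) * real (n j) powr - lam) * V"
    proof (rule oscillation_bound[OF _ marginals_exist_marginal[OF u me] V pq(1) lam])
      show "finite w" using w u finite_subset by auto
    qed (use w n H1 H2 H3 in auto)
    also have "\<dots> \<le> 8 ^ card w * (\<Prod>j\<in>w. (2 * M j) * real (n j) powr - lam) * h"
      using \<open>V \<le> h\<close> M0 w by (intro mult_left_mono mult_nonneg_nonneg prod_nonneg) auto
    finally show ?thesis .
  qed
  have int: "integrable (cube_measure u) (\<lambda>x. complex_of_real (g x) * (\<Prod>j\<in>w. H j (x j)))"
    "(LINT x|cube_measure u. complex_of_real (g x) * (\<Prod>j\<in>w. H j (x j))) =
      (LINT x|cube_measure w. complex_of_real (marginal u w g x) * (\<Prod>j\<in>w. H j (x j)))"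
    if "w \<in> Pow u" for w
    using that by (intro integral_marginal[OF u intg, where M = "\<lambda>j. 2 * M j"] H1 H2; auto)+
  have "(LINT x|cube_measure u. complex_of_real (g x) * (\<Prod>j\<in>u. K j (x j))) =
    (LINT x|cube_measure u. (\<Sum>w\<in>Pow u. (\<Prod>j\<in>u - w. m j) * (complex_of_real (g x) * (\<Prod>j\<in>w. H j (x j)))))"
  proof (intro Bochner_Integration.integral_cong refl)
    fix x
    have "(\<Prod>j\<in>u. K j (x j)) = (\<Prod>j\<in>u. H j (x j) + m j)" by (simp add: H_def)
    also have "\<dots> = (\<Sum>w\<in>Pow u. (\<Prod>j\<in>w. H j (x j)) * (\<Prod>j\<in>u - w. m j))"
      by (rule prod_add[OF u])
    finally show "complex_of_real (g x) * (\<Prod>j\<in>u. K j (x j)) =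
      (\<Sum>w\<in>Pow u. (\<Prod>j\<in>u - w. m j) * (complex_of_real (g x) * (\<Prod>j\<in>w. H j (x j))))"
      by (simp add: sum_distrib_left ac_simps)
  qed
  also have "\<dots> = (\<Sum>w\<in>Pow u. (\<Prod>j\<in>u - w. m j) *
      (LINT x|cube_measure w. complex_of_real (marginal u w g x) * (\<Prod>j\<in>w. H j (x j))))"
    by (subst Bochner_Integration.integral_sum) (auto simp: int intro!: integrable_mult_right int)
  \<comment> \<open>16 is 8 from the oscillation estimate times 2 from the doubled bound of
    \<open>H j\<close>; the \<open>2 ^ card u\<close> subsets \<open>w\<close> turn it into
    32.\<close>
  also have "norm \<dots> \<le> (\<Sum>w\<in>Pow u. 16 ^ card u * (\<Prod>j\<in>u. R j) * h)"
  proof (rule sum_norm_le)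
    fix w assume w: "w \<in> Pow u"
    then have fw: "finite w" and cw: "card w \<le> card u" using u finite_subset card_mono by auto
    have "norm ((\<Prod>j\<in>u - w. m j) * (LINT x|cube_measure w. complex_of_real (marginal u w g x) * (\<Prod>j\<in>w. H j (x j)))) \<le>
      (\<Prod>j\<in>u - w. R j) * (8 ^ card w * (\<Prod>j\<in>w. (2 * M j) * real (n j) powr - lam) * h)"
      unfolding norm_mult
    proof (intro mult_mono wb[OF w])
      show "norm (\<Prod>j\<in>u - w. m j) \<le> (\<Prod>j\<in>u - w. R j)"
        unfolding prod_norm[symmetric] using m_R by (intro prod_mono) auto
      show "0 \<le> (\<Prod>j\<in>u - w. R j)" using R0 by (intro prod_nonneg) auto
    qed auto
    also have "(\<Prod>j\<in>w. (2 * M j) * real (n j) powr - lam) = 2 ^ card w * (\<Prod>j\<in>w. R j)"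
      unfolding R_def by (simp add: prod.distrib mult.assoc)
    also have "(\<Prod>j\<in>u - w. R j) * (8 ^ card w * (2 ^ card w * (\<Prod>j\<in>w. R j)) * h) =
      (8 ^ card w * 2 ^ card w) * ((\<Prod>j\<in>u - w. R j) * (\<Prod>j\<in>w. R j)) * h" by (simp add: ac_simps)
    also have "(\<Prod>j\<in>u - w. R j) * (\<Prod>j\<in>w. R j) = (\<Prod>j\<in>u. R j)"
      using w u by (intro prod.subset_diff[symmetric]) auto
    also have "(8 :: real) ^ card w * 2 ^ card w = 16 ^ card w"
      by (simp flip: power_mult_distrib)
    also have "(16::real) ^ card w * (\<Prod>j\<in>u. R j) * h \<le> 16 ^ card u * (\<Prod>j\<in>u. R j) * h"
      using cw R0 hk by (intro mult_right_mono power_increasing prod_nonneg) auto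
    finally show "norm ((\<Prod>j\<in>u - w. m j) *
      (LINT x|cube_measure w. complex_of_real (marginal u w g x) * (\<Prod>j\<in>w. H j (x j)))) \<le>
      16 ^ card u * (\<Prod>j\<in>u. R j) * h" .
  qed
  also have "\<dots> = (2 ^ card u * 16 ^ card u) * (\<Prod>j\<in>u. R j) * h"
    using u by (simp add: card_Pow)
  also have "(2 :: real) ^ card u * 16 ^ card u = 32 ^ card u"
    by (simp flip: power_mult_distrib)
  finally show ?thesis unfolding R_def .
qed

section \<open>Taylor expansion\<close>

definition point :: "nat set \<Rightarrow> (nat \<Rightarrow> real) \<Rightarrow> (nat \<Rightarrow> real) \<Rightarrow> nat \<Rightarrow> real" where
  "point u z t = (\<lambda>j. if j \<in> u then t j else z j)"

text \<open>The remainder kernel of Taylor's formula with \<open>n + 1\<close> polynomial terms. At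
  \<open>t = 0\<close> it is the normalised monomial of degree \<open>n\<close> for
  \<open>x \<ge> 0\<close>, so that both kinds of Taylor terms lead to the same iterated tail
  integrals.\<close>

definition truncated_power :: "nat \<Rightarrow> real \<Rightarrow> real \<Rightarrow> real" where
  "truncated_power n x t = (if t \<le> x then (x - t) ^ n / fact n else 0)"

lemma point_in_cube: "u \<subseteq> v \<Longrightarrow> z \<in> cube v \<Longrightarrow> t \<in> cube u \<Longrightarrow> point u z t \<in> cube v"
  by (auto simp: cube_def PiE_iff point_def extensional_def)

lemma truncated_power_bounds:
  assumes "x \<in> {0..<1}" "t \<in> {0..<1}"
  shows "0 \<le> truncated_power n x t" "truncated_power n x t \<le> 1"
proof -
  show "0 \<le> truncated_power n x t" by (simp add: truncated_power_def)
  have "(x - t) ^ n \<le> fact n" if "t \<le> x"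
  proof -
    have "(x - t) ^ n \<le> 1" using that assms by (intro power_le_one) auto
    also have "(1::real) \<le> fact n" by (rule fact_ge_1)
    finally show ?thesis .
  qed
  then show "truncated_power n x t \<le> 1" by (simp add: truncated_power_def divide_le_eq)
qed

lemma truncated_power_measurable [measurable]:
  assumes [measurable]: "f \<in> borel_measurable M" "g \<in> borel_measurable M"
  shows "(\<lambda>z. truncated_power n (f z) (g z)) \<in> borel_measurable M"
  unfolding truncated_power_def by measurable

text \<open>Extensional functions are constant outside \<open>u\<close>, so the box is a product of
  compact sets over all indices and Tychonoff's theorem applies.\<close>

lemma compact_box: "compact (\<Pi>\<^sub>E j\<in>u. {0..c j :: real})" for u :: "nat set"
proof -
  let ?S = "\<lambda>j. if j \<in> u then {0..c j} else {undefined}"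
  have "(\<Pi>\<^sub>E j\<in>u. {0..c j}) = (\<Pi>\<^sub>E j\<in>UNIV. ?S j)"
    by (auto simp: PiE_iff extensional_def split: if_splits)
  moreover have "compactin (product_topology (\<lambda>j. euclidean) UNIV) (\<Pi>\<^sub>E j\<in>UNIV. ?S j)"
    unfolding compactin_PiE by auto
  ultimately show ?thesis by (simp add: euclidean_product_topology)
qed

lemma point_measurable:
  assumes "continuous_on (cube v) G" "u \<subseteq> v" "z \<in> cube v"
  shows "(\<lambda>t. G (point u z t)) \<in> borel_measurable (cube_measure u)"
proof -
  have c: "(\<lambda>t. point u z t j) \<in> borel_measurable (cube_measure u)" for j
    using measurable_cube_component_comp[OF measurable_id_unit_lborel, of j u]
    by (cases "j \<in> u") (simp_all add: point_def)
  have "point u z \<in> measurable (cube_measure u) (\<Pi>\<^sub>M j\<in>UNIV. borel)"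
    using measurable_PiM_single'[of UNIV "\<lambda>j t. point u z t j" "cube_measure u" "\<lambda>_. borel"] c by simp
  then have "point u z \<in> borel_measurable (cube_measure u)"
    by (simp cong: measurable_cong_sets add: sets_PiM_equal_borel)
  then have "point u z \<in> measurable (cube_measure u) (restrict_space borel (cube v))"
    using assms by (intro measurable_restrict_space2) (auto simp: space_cube_measure intro: point_in_cube)
  from measurable_compose[OF this borel_measurable_continuous_on_restrict[OF assms(1)]] show ?thesis .
qed

text \<open>\<open>G\<close> may be unbounded near the open faces of the cube, but the product
  vanishes unless \<open>t j \<le> x j\<close> for all \<open>j\<close> in \<open>u\<close>. This
  confines the arguments of \<open>G\<close> to a compact box; the maximum with \<open>z\<close>
  makes room for the coordinates that are held fixed.\<close>

lemma truncated_product_integrable: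
  assumes fin: "finite u" and G: "continuous_on (cube v) G" and u: "u \<subseteq> v" and z: "z \<in> cube v" and x: "x \<in> cube v"
  shows "integrable (cube_measure u) (\<lambda>t. G (point u z t) * (\<Prod>j\<in>u. truncated_power n (x j) (t j)))"
proof -
  let ?c = "\<lambda>j. max (x j) (z j)"
  have sub: "(\<Pi>\<^sub>E j\<in>v. {0..?c j}) \<subseteq> cube v"
    using z x by (fastforce simp: cube_def PiE_iff)
  have "compact (G ` (\<Pi>\<^sub>E j\<in>v. {0..?c j}))"
    by (intro compact_continuous_image compact_box continuous_on_subset[OF G sub])
  then have "bounded (G ` (\<Pi>\<^sub>E j\<in>v. {0..?c j}))" by (rule compact_imp_bounded)
  then obtain B where B: "B > 0" "\<And>y. y \<in> (\<Pi>\<^sub>E j\<in>v. {0..?c j}) \<Longrightarrow> norm (G y) \<le> B"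
    unfolding bounded_pos by blast
  interpret prob_space "cube_measure u" by (rule prob_space_cube_measure)
  show ?thesis
  proof (rule integrable_const_bound[where B = B], rule AE_I2)
    fix t assume "t \<in> space (cube_measure u)"
    then have t: "t \<in> cube u" by (simp add: space_cube_measure)
    let ?P = "\<Prod>j\<in>u. truncated_power n (x j) (t j)"
    have tx: "t j \<in> {0..<1}" "x j \<in> {0..<1}" if "j \<in> u" for j
      using t x u that by (auto simp: cube_def PiE_iff)
    show "norm (G (point u z t) * ?P) \<le> B"
    proof (cases "?P = 0")
      case True
      then show ?thesis using B(1) by simp
    next
      case False
      have "norm (G (point u z t)) \<le> B"
      proof -
        have "t j \<le> x j" if "j \<in> u" for j
          using False that fin by (auto simp: truncated_power_def split: if_splits)
        then show ?thesis
          using t z u by (intro B(2)) (auto simp: cube_def PiE_iff point_def extensional_def le_max_iff_disj)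
      qed
      moreover have "0 \<le> ?P" "?P \<le> 1"
        using tx truncated_power_bounds by (auto intro!: prod_nonneg prod_le_1)
      ultimately have "norm (G (point u z t)) * \<bar>?P\<bar> \<le> B * 1" by (intro mult_mono) auto
      then show ?thesis by (simp add: abs_mult)
    qed
  next
    show "(\<lambda>t. G (point u z t) * (\<Prod>j\<in>u. truncated_power n (x j) (t j))) \<in> borel_measurable (cube_measure u)"
      using measurable_cube_component_comp[OF measurable_id_unit_lborel]
      by (intro borel_measurable_times point_measurable[OF G u z] borel_measurable_prod
          truncated_power_measurable) auto
  qed
qed

lemma count_list_replicate_eq: "count_list (replicate n a) b = (if a = b then n else 0)"
  by (induction n) auto

text \<open>The head of a derivative list is applied last, so further differentiation in
  \<open>m\<close> prepends to \<open>js\<close>. The segment from 0 to \<open>x m\<close> is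
  compact inside the half-open interval, so the continuous highest derivative is integrable along it
  and Taylor's formula with integral remainder holds.\<close>

lemma taylor_coordinate:
  assumes f: "mixed_differentiable s \<delta> f" and \<delta>: "\<delta> \<ge> 1"
    and js: "set js \<subseteq> {1..s}" "\<And>j. count_list js j \<le> \<delta>" and m: "m \<in> {1..s}" "m \<notin> set js"
    and x: "x \<in> cube {1..s}"
  shows "iterated_deriv js f x =
    (\<Sum>n<\<delta>. x m ^ n / fact n * iterated_deriv (replicate n m @ js) f (x(m := 0))) +
    (LINT y|unit_lborel. truncated_power (\<delta> - 1) (x m) y * iterated_deriv (replicate \<delta> m @ js) f (x(m := y)))"
proof -
  define \<phi> where "\<phi> n y = iterated_deriv (replicate n m @ js) f (x(m := y))" for n y
  have xm: "0 \<le> x m" "x m < 1" using x m by (auto simp: cube_def PiE_iff)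
  have upd: "x(m := y) \<in> cube {1..s}" if "y \<in> {0..<1}" for y
    using x m that by (auto simp: cube_def PiE_iff extensional_def)
  have cm: "count_list js m = 0" using m(2) by (simp add: count_list_0_iff)
  have count: "count_list (replicate n m @ js) j \<le> \<delta>" if "n \<le> \<delta>" for n j
    using js(2)[of j] cm that by (cases "j = m") (auto simp: count_list_append count_list_replicate_eq)
  have set_js: "set (replicate n m @ js) \<subseteq> {1..s}" for n using js m by auto
  have deriv: "(\<phi> n has_vector_derivative \<phi> (Suc n) y) (at y within {0..<1})"
    if n: "n < \<delta>" and y: "y \<in> {0..<1}" for n y
  proof -
    have "count_list (replicate n m @ js) m < \<delta>"
      using n cm by (simp add: count_list_append count_list_replicate_eq)
    then have "(\<lambda>t. iterated_deriv (replicate n m @ js) f ((x(m := y))(m := t)))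
        differentiable (at ((x(m := y)) m) within {0..<1})"
      using f set_js[of n] count[of n] n m(1) upd[OF y] unfolding mixed_differentiable_def
      by (meson less_imp_le)
    then have "(\<phi> n has_vector_derivative vector_derivative (\<phi> n) (at y within {0..<1})) (at y within {0..<1})"
      unfolding \<phi>_def[abs_def] by (simp add: vector_derivative_works)
    moreover have "\<phi> (Suc n) y = vector_derivative (\<phi> n) (at y within {0..<1})"
      by (simp add: \<phi>_def[abs_def] iterated_deriv_def partial_deriv_def)
    ultimately show ?thesis by simp
  qed
  have cont: "continuous_on {0..x m} (\<phi> \<delta>)"
  proof -
    have "continuous_on (cube {1..s}) (iterated_deriv (replicate \<delta> m @ js) f)"
      using f set_js[of \<delta>] count[of \<delta>] unfolding mixed_differentiable_def by blast
    moreover have "continuous_on {0..x m} (\<lambda>y. x(m := y))"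
    proof (intro continuous_on_coordinatewise_then_product)
      fix i show "continuous_on {0..x m} (\<lambda>y. (x(m := y)) i)"
        by (cases "i = m") (auto intro: continuous_intros)
    qed
    moreover have "(\<lambda>y. x(m := y)) ` {0..x m} \<subseteq> cube {1..s}" using upd xm by auto
    ultimately show ?thesis
      unfolding \<phi>_def[abs_def] by (rule continuous_on_compose2)
  qed
  have hi: "((\<lambda>y. ((x m - y) ^ (\<delta> - 1) / fact (\<delta> - 1)) *\<^sub>R \<phi> \<delta> y) has_integral
      \<phi> 0 (x m) - (\<Sum>i<\<delta>. ((x m - 0) ^ i / fact i) *\<^sub>R \<phi> i 0)) {0..x m}"
  proof (rule Taylor_has_integral)
    fix n t assume "n < \<delta>" "0 \<le> t" "t \<le> x m"
    then show "(\<phi> n has_vector_derivative \<phi> (Suc n) t) (at t within {0..x m})"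
      using xm by (intro has_vector_derivative_within_subset[OF deriv]) auto
  qed (use \<delta> xm in auto)
  have si: "set_integrable lborel {0..x m} (\<lambda>y. ((x m - y) ^ (\<delta> - 1) / fact (\<delta> - 1)) *\<^sub>R \<phi> \<delta> y)"
    by (intro borel_integrable_atLeastAtMost' continuous_intros cont) auto
  have "(LINT y:{0..x m}|lborel. ((x m - y) ^ (\<delta> - 1) / fact (\<delta> - 1)) *\<^sub>R \<phi> \<delta> y) =
      \<phi> 0 (x m) - (\<Sum>i<\<delta>. ((x m - 0) ^ i / fact i) *\<^sub>R \<phi> i 0)"
    by (rule trans[OF set_borel_integral_eq_integral(2)[OF si] integral_unique[OF hi]])
  moreover have "(LINT y|unit_lborel. truncated_power (\<delta> - 1) (x m) y * \<phi> \<delta> y) =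
    (LINT y:{0..x m}|lborel. ((x m - y) ^ (\<delta> - 1) / fact (\<delta> - 1)) *\<^sub>R \<phi> \<delta> y)"
  proof -
    have "(LINT y|unit_lborel. truncated_power (\<delta> - 1) (x m) y * \<phi> \<delta> y) =
      (LINT y|lborel. indicator {0..<1} y *\<^sub>R (truncated_power (\<delta> - 1) (x m) y * \<phi> \<delta> y))"
      by (rule integral_restrict_space) simp
    also have "\<dots> = (LINT y:{0..x m}|lborel. ((x m - y) ^ (\<delta> - 1) / fact (\<delta> - 1)) *\<^sub>R \<phi> \<delta> y)"
      unfolding set_lebesgue_integral_def
      by (rule Bochner_Integration.integral_cong)
         (use xm in \<open>auto simp: truncated_power_def indicator_def\<close>)
    finally show ?thesis .
  qed
  moreover have "\<phi> 0 (x m) = iterated_deriv js f x" by (simp add: \<phi>_def)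
  ultimately show ?thesis by (simp add: \<phi>_def)
qed

text \<open>Taylor's formula in coordinate \<open>l\<close> is applied under the integral, and
  Fubini makes its remainder variable a new coordinate of \<open>t\<close>. The point
  \<open>z\<close> carries the coordinates that are not integrated, with coordinate \<open>l\<close>
  passing from \<open>x l\<close> to 0.\<close>

lemma taylor_step:
  assumes f: "mixed_differentiable s \<delta> f" and \<delta>: "\<delta> \<ge> 1"
    and js: "set js \<subseteq> {1..s}" "\<And>j. count_list js j \<le> \<delta>" and l: "l \<in> {1..s}" "l \<notin> set js" "l \<notin> u"
    and u: "u \<subseteq> {1..s}" and x: "x \<in> cube {1..s}" and z: "z \<in> cube {1..s}" "z l = x l"
  defines "T \<equiv> \<lambda>u t. \<Prod>j\<in>u. truncated_power (\<delta> - 1) (x j) (t j)"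
  shows "(LINT t|cube_measure u. iterated_deriv js f (point u z t) * T u t) =
    (\<Sum>c<\<delta>. x l ^ c / fact c *
      (LINT t|cube_measure u. iterated_deriv (replicate c l @ js) f (point u (z(l := 0)) t) * T u t)) +
    (LINT t|cube_measure (insert l u).
      iterated_deriv (replicate \<delta> l @ js) f (point (insert l u) (z(l := 0)) t) * T (insert l u) t)"
proof -
  let ?F = "\<lambda>c t. iterated_deriv (replicate c l @ js) f (point u (z(l := 0)) t) * T u t"
  have fu: "finite u" using u finite_subset by blast
  have cl: "count_list js l = 0" using l(2) by (simp add: count_list_0_iff)
  have cont: "continuous_on (cube {1..s}) (iterated_deriv (replicate c l @ js) f)" if "c \<le> \<delta>" for c
  proof -
    have "count_list (replicate c l @ js) j \<le> \<delta>" for j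
      using js(2)[of j] cl that by (cases "j = l") (auto simp: count_list_append count_list_replicate_eq)
    moreover have "set (replicate c l @ js) \<subseteq> {1..s}" using js l by auto
    ultimately show ?thesis using f unfolding mixed_differentiable_def by blast
  qed
  have z0: "z(l := 0) \<in> cube {1..s}" using z l by (auto simp: cube_def PiE_iff extensional_def)
  have int0: "integrable (cube_measure u) (\<lambda>t. iterated_deriv js f (point u z t) * T u t)"
    using truncated_product_integrable[OF fu cont[of 0] u z(1) x] unfolding T_def by simp
  have intc: "integrable (cube_measure u)
      (\<lambda>t. ?F c t)" if "c < \<delta>" for c
    using truncated_product_integrable[OF fu cont[of c] u z0 x] that unfolding T_def by simp
  let ?G = "iterated_deriv (replicate \<delta> l @ js) f"
  let ?I = "\<lambda>t. ?G (point (insert l u) (z(l := 0)) t) * T (insert l u) t"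
  have intl: "integrable (cube_measure (insert l u)) ?I"
    using truncated_product_integrable[OF _ cont[of \<delta>] _ z0 x, of "insert l u"] l(1) u fu unfolding T_def by simp
  have split: "iterated_deriv js f (point u z t) * T u t =
     (\<Sum>c<\<delta>. x l ^ c / fact c * (?F c t)) +
     (LINT y|unit_lborel. ?I (t(l := y)))" if t: "t \<in> cube u" for t
  proof -
    have X: "point u z t \<in> cube {1..s}" by (rule point_in_cube[OF u z(1) t])
    have e: "point u z t l = x l" using l z by (simp add: point_def)
    have e0: "(point u z t)(l := 0) = point u (z(l := 0)) t"
      using l by (auto simp: point_def fun_eq_iff)
    have ey: "(point u z t)(l := y) = point (insert l u) (z(l := 0)) (t(l := y))" for y
      by (auto simp: point_def fun_eq_iff)
    have Ty: "T (insert l u) (t(l := y)) = truncated_power (\<delta> - 1) (x l) y * T u t" for y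
    proof -
      have "(\<Prod>j\<in>u. truncated_power (\<delta> - 1) (x j) ((t(l := y)) j)) = T u t"
        unfolding T_def using l by (intro prod.cong) auto
      then show ?thesis unfolding T_def using l fu by simp
    qed
    have "(LINT y|unit_lborel. ?I (t(l := y))) =
      (LINT y|unit_lborel. truncated_power (\<delta> - 1) (x l) y * ?G ((point u z t)(l := y))) * T u t"
      unfolding Ty ey by (subst integral_mult_left_zero[symmetric]) (simp add: ac_simps)
    then show ?thesis
      unfolding taylor_coordinate[OF f \<delta> js l(1,2) X] e e0
      by (simp only: distrib_right sum_distrib_right mult.assoc)
  qed
  have intc': "integrable (cube_measure u)
      (\<lambda>t. \<Sum>c<\<delta>. x l ^ c / fact c * (?F c t))"
    using intc by (intro Bochner_Integration.integrable_sum integrable_mult_right) auto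
  \<comment> \<open>By the Taylor formula above, the inner integral is the difference of two
    integrable functions.\<close>
  have intr: "integrable (cube_measure u) (\<lambda>t. LINT y|unit_lborel. ?I (t(l := y)))"
    using Bochner_Integration.integrable_diff[OF int0 intc']
    by (rule Bochner_Integration.integrable_cong[THEN iffD1, rotated -1])
       (auto simp: space_cube_measure split)
  have "(LINT t|cube_measure u. iterated_deriv js f (point u z t) * T u t) =
    (LINT t|cube_measure u.
     (\<Sum>c<\<delta>. x l ^ c / fact c * (?F c t)) +
     (LINT y|unit_lborel. ?I (t(l := y))))"
    by (intro Bochner_Integration.integral_cong refl split) (simp add: space_cube_measure)
  also have "\<dots> = (LINT t|cube_measure u.
     (\<Sum>c<\<delta>. x l ^ c / fact c * (?F c t))) +
     (LINT t|cube_measure u. LINT y|unit_lborel. ?I (t(l := y)))"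
    by (rule Bochner_Integration.integral_add[OF intc' intr])
  also have "(LINT t|cube_measure u. LINT y|unit_lborel. ?I (t(l := y))) = (LINT t|cube_measure (insert l u). ?I t)"
    unfolding cube_measure_def
    by (rule cube.product_integral_insert[OF fu l(3) intl[unfolded cube_measure_def], symmetric])
  also have "(LINT t|cube_measure u.
     (\<Sum>c<\<delta>. x l ^ c / fact c * (?F c t))) =
    (\<Sum>c<\<delta>. x l ^ c / fact c *
      (LINT t|cube_measure u. ?F c t))"
    using intc by (subst Bochner_Integration.integral_sum) auto
  finally show ?thesis .
qed

text \<open>The part of the list in \<open>mixed_deriv\<close> that belongs to the variables above
  \<open>m\<close>. The last variable is differentiated first, so the variables are expanded from
  \<open>s\<close> downwards.\<close>

definition deriv_list :: "nat \<Rightarrow> nat \<Rightarrow> (nat \<Rightarrow> nat) \<Rightarrow> nat list" where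
  "deriv_list m s \<tau> = concat (map (\<lambda>j. replicate (\<tau> j) j) [Suc m..<s + 1])"

lemma deriv_list_upd:
  assumes "m < s"
  shows "deriv_list m s (\<tau>(Suc m := c)) = replicate c (Suc m) @ deriv_list (Suc m) s \<tau>"
proof -
  have e: "[Suc m..<s + 1] = Suc m # [Suc (Suc m)..<s + 1]" using assms by (simp add: upt_rec)
  have "map (\<lambda>j. replicate ((\<tau>(Suc m := c)) j) j) [Suc (Suc m)..<s + 1] =
      map (\<lambda>j. replicate (\<tau> j) j) [Suc (Suc m)..<s + 1]"
    by (intro map_cong) auto
  then show ?thesis unfolding deriv_list_def e list.map concat.simps by (simp only: fun_upd_same)
qed

lemma set_deriv_list: "set (deriv_list m s \<tau>) \<subseteq> {Suc m..s}"
  by (auto simp: deriv_list_def)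

lemma count_deriv_list:
  "count_list (deriv_list m s \<tau>) j = (if j \<in> {Suc m..s} then \<tau> j else 0)"
proof (cases "m \<le> s")
  case True
  then show ?thesis
  proof (induction m rule: inc_induct)
    case base
    then show ?case by (simp add: deriv_list_def)
  next
    case (step n)
    then show ?case using deriv_list_upd[of n s \<tau> "\<tau> (Suc n)"]
      by (auto simp: count_list_append count_list_replicate_eq)
  qed
qed (simp add: deriv_list_def)

text \<open>The intermediate stage in which the variables up to \<open>m\<close> are still at
  \<open>x\<close>. In each expanded variable \<open>\<tau> j < \<delta>\<close> selects a
  polynomial term and \<open>\<tau> j = \<delta>\<close> the remainder, so expanding one more
  variable extends the index functions \<open>\<tau>\<close> by one coordinate.\<close>

lemma taylor_expansion_partial:
  assumes f: "mixed_differentiable s \<delta> f" and \<delta>: "\<delta> \<ge> 1" and x: "x \<in> cube {1..s}" and "m \<le> s"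
  shows "f x = (\<Sum>\<tau>\<in>(\<Pi>\<^sub>E j\<in>{Suc m..s}. {0..\<delta>}).
    (\<Prod>j\<in>{Suc m..s} - {j\<in>{Suc m..s}. \<tau> j = \<delta>}. x j ^ \<tau> j / fact (\<tau> j)) *
    (LINT t|cube_measure {j\<in>{Suc m..s}. \<tau> j = \<delta>}.
      iterated_deriv (deriv_list m s \<tau>) f
        (point {j\<in>{Suc m..s}. \<tau> j = \<delta>} (\<lambda>j\<in>{1..s}. if j \<le> m then x j else 0) t) *
      (\<Prod>j\<in>{j\<in>{Suc m..s}. \<tau> j = \<delta>}. truncated_power (\<delta> - 1) (x j) (t j))))"
  using assms(4)
proof (induction m rule: inc_induct)
  case base
  interpret prob_space "cube_measure {}" by (rule prob_space_cube_measure)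
  have "(\<lambda>j\<in>{1..s}. if j \<le> s then x j else 0) = x"
    using x by (auto simp: fun_eq_iff cube_def PiE_iff extensional_def)
  moreover have "point {} x t = x" for t by (simp add: point_def)
  ultimately show ?case by (simp add: deriv_list_def iterated_deriv_def prob_space)
next
  case (step m)
  let ?l = "Suc m"
  let ?A = "{Suc (Suc m)..s}"
  let ?U = "\<lambda>\<tau>. {j\<in>?A. \<tau> j = \<delta>}" and ?U' = "\<lambda>\<tau>. {j\<in>{Suc m..s}. \<tau> j = \<delta>}"
  let ?z = "\<lambda>m. \<lambda>j\<in>{1..s}. if j \<le> m then x j else 0"
  let ?T = "\<lambda>u t. \<Prod>j\<in>u. truncated_power (\<delta> - 1) (x j) (t j)"
  let ?h = "\<lambda>\<tau>. (\<Prod>j\<in>{Suc m..s} - ?U' \<tau>. x j ^ \<tau> j / fact (\<tau> j)) *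
    (LINT t|cube_measure (?U' \<tau>). iterated_deriv (deriv_list m s \<tau>) f (point (?U' \<tau>) (?z m) t) * ?T (?U' \<tau>) t)"
  have A: "{Suc m..s} = insert ?l ?A" "?l \<notin> ?A" using step.hyps by auto
  have z: "?z k \<in> cube {1..s}" for k using x by (auto simp: cube_def PiE_iff)
  have zl: "?z ?l ?l = x ?l" "(?z ?l)(?l := 0) = ?z m" using step.hyps by (auto simp: fun_eq_iff)
  have "f x = (\<Sum>\<tau>\<in>(\<Pi>\<^sub>E j\<in>?A. {0..\<delta>}). \<Sum>c\<in>{0..\<delta>}. ?h (\<tau>(?l := c)))"
    unfolding step.IH
  proof (intro sum.cong refl)
    fix \<tau> assume \<tau>: "\<tau> \<in> (\<Pi>\<^sub>E j\<in>?A. {0..\<delta>})"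
    let ?js = "deriv_list ?l s \<tau>"
    let ?P = "\<Prod>j\<in>?A - ?U \<tau>. x j ^ \<tau> j / fact (\<tau> j)"
    let ?X = "\<lambda>c. LINT t|cube_measure (?U \<tau>).
        iterated_deriv (replicate c ?l @ ?js) f (point (?U \<tau>) (?z m) t) * ?T (?U \<tau>) t"
      and ?Y = "LINT t|cube_measure (insert ?l (?U \<tau>)). iterated_deriv (replicate \<delta> ?l @ ?js) f
        (point (insert ?l (?U \<tau>)) (?z m) t) * ?T (insert ?l (?U \<tau>)) t"
      and ?Z = "LINT t|cube_measure (?U \<tau>). iterated_deriv ?js f (point (?U \<tau>) (?z ?l) t) * ?T (?U \<tau>) t"
    have cnt: "count_list ?js j \<le> \<delta>" for j using \<tau> by (auto simp: count_deriv_list PiE_iff)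
    have h1: "?h (\<tau>(?l := c)) = ?P * (x ?l ^ c / fact c *
      ?X c)"
      if c: "c < \<delta>" for c
    proof -
      have U: "?U' (\<tau>(?l := c)) = ?U \<tau>" using c by auto
      have "(\<Prod>j\<in>{Suc m..s} - ?U \<tau>. x j ^ (\<tau>(?l := c)) j / fact ((\<tau>(?l := c)) j)) =
        (\<Prod>j\<in>insert ?l (?A - ?U \<tau>). x j ^ (\<tau>(?l := c)) j / fact ((\<tau>(?l := c)) j))"
        using A by (intro prod.cong) auto
      also have "\<dots> = x ?l ^ c / fact c * (\<Prod>j\<in>?A - ?U \<tau>. x j ^ (\<tau>(?l := c)) j / fact ((\<tau>(?l := c)) j))"
        by (subst prod.insert) auto
      also have "(\<Prod>j\<in>?A - ?U \<tau>. x j ^ (\<tau>(?l := c)) j / fact ((\<tau>(?l := c)) j)) = ?P"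
        by (intro prod.cong) auto
      finally show ?thesis unfolding U deriv_list_upd[OF step.hyps(2)] by (simp only: ac_simps)
    qed
    have h2: "?h (\<tau>(?l := \<delta>)) = ?P * 
      ?Y"
    proof -
      have U: "?U' (\<tau>(?l := \<delta>)) = insert ?l (?U \<tau>)" using step.hyps by auto
      have "(\<Prod>j\<in>{Suc m..s} - insert ?l (?U \<tau>). x j ^ (\<tau>(?l := \<delta>)) j / fact ((\<tau>(?l := \<delta>)) j)) = ?P"
        using A by (intro prod.cong) auto
      then show ?thesis unfolding U deriv_list_upd[OF step.hyps(2)] by (simp only:)
    qed
    have "?Z =
      (\<Sum>c<\<delta>. x ?l ^ c / fact c *
        ?X c) +
      ?Y"
      unfolding zl(2)[symmetric]
    proof (rule taylor_step[OF f \<delta> _ cnt _ _ _ _ x z zl(1)])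
      show "set ?js \<subseteq> {1..s}" "?l \<notin> set ?js" using set_deriv_list[of ?l s \<tau>] by auto
    qed (use step.hyps in auto)
    then have "?P * ?Z =
      (\<Sum>c<\<delta>. ?P * (x ?l ^ c / fact c *
        ?X c)) +
      ?P * ?Y"
      by (simp only: distrib_left sum_distrib_left)
    also have "\<dots> = (\<Sum>c<\<delta>. ?h (\<tau>(?l := c))) + ?h (\<tau>(?l := \<delta>))"
      unfolding h2 by (intro arg_cong2[where f = plus] sum.cong refl h1[symmetric]) simp
    also have "\<dots> = (\<Sum>c\<in>{0..\<delta>}. ?h (\<tau>(?l := c)))"
      by (simp only: atLeast0AtMost lessThan_Suc_atMost[symmetric] sum.lessThan_Suc)
    finally show "?P * ?Z =
      (\<Sum>c\<in>{0..\<delta>}. ?h (\<tau>(?l := c)))" .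
  qed
  also have "\<dots> = (\<Sum>\<tau>\<in>(\<Pi>\<^sub>E j\<in>{Suc m..s}. {0..\<delta>}). ?h \<tau>)"
    unfolding A(1) by (rule sum_over_PiE_insert[OF A(2)])
  finally show ?case .
qed

lemma taylor_expansion:
  assumes "mixed_differentiable s \<delta> f" "\<delta> \<ge> 1" "x \<in> cube {1..s}"
  shows "f x = (\<Sum>\<tau>\<in>(\<Pi>\<^sub>E j\<in>{1..s}. {0..\<delta>}).
    (\<Prod>j\<in>{1..s} - top_vars s \<delta> \<tau>. x j ^ \<tau> j / fact (\<tau> j)) *
    (LINT t|cube_measure (top_vars s \<delta> \<tau>). mixed_deriv s \<tau> f (zero_extend s (top_vars s \<delta> \<tau>) t) *
      (\<Prod>j\<in>top_vars s \<delta> \<tau>. truncated_power (\<delta> - 1) (x j) (t j))))"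
proof -
  have T: "{j\<in>{Suc 0..s}. \<tau> j = \<delta>} = top_vars s \<delta> \<tau>" for \<tau>
    by (simp add: top_vars_def)
  have D: "iterated_deriv (deriv_list 0 s \<tau>) f = mixed_deriv s \<tau> f" for \<tau>
    by (simp add: mixed_deriv_def deriv_list_def del: upt_Suc)
  have P: "point (top_vars s \<delta> \<tau>) (\<lambda>j\<in>{1..s}. if j \<le> 0 then x j else 0) t =
      zero_extend s (top_vars s \<delta> \<tau>) t" for \<tau> t
    by (auto simp: point_def zero_extend_def top_vars_def fun_eq_iff)
  show ?thesis
    using taylor_expansion_partial[OF assms, of 0] unfolding T D P by simp
qed

section \<open>Walsh coefficients\<close>

lemma integrable_pair_snd:
  fixes f :: "'b \<Rightarrow> real"
  assumes "prob_space M" "prob_space N" "integrable N f"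
  shows "integrable (M \<Otimes>\<^sub>M N) (\<lambda>z. f (snd z))"
proof -
  interpret M: prob_space M by fact
  interpret N: prob_space N by fact
  interpret pair_prob_space M N ..
  show ?thesis
  proof (rule Fubini_integrable)
    show "(\<lambda>z. f (snd z)) \<in> borel_measurable (M \<Otimes>\<^sub>M N)"
      using assms(3) by (intro measurable_compose[OF measurable_snd]) auto
  qed (use assms(3) in auto)
qed

context walsh_system
begin

text \<open>For fixed \<open>t\<close> the double integrand \<open>Q\<close> is a product of
  functions of single variables, so after the exchange one integral per variable remains, and
  Cauchy's formula makes it a kernel. Joint integrability holds because \<open>F\<close> is
  integrable and the other factors are bounded by 1.\<close>

lemma walsh_integrals_exchange:
  fixes F :: "(nat \<Rightarrow> real) \<Rightarrow> real" and \<tau> :: "nat \<Rightarrow> nat" and n s :: nat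
  assumes F: "integrable (cube_measure u) F" and u: "u \<subseteq> {1..s}"
  defines "E \<equiv> \<lambda>x. (\<Prod>j\<in>{1..s} - u. x j ^ \<tau> j / fact (\<tau> j)) *
    (LINT t|cube_measure u. F t * (\<Prod>j\<in>u. truncated_power n (x j) (t j)))"
  shows "integrable (cube_measure {1..s}) (\<lambda>x. complex_of_real (E x) * cnj (wal p r \<eta> s k x))"
    and "(LINT x|cube_measure {1..s}. complex_of_real (E x) * cnj (wal p r \<eta> s k x)) =
      (\<Prod>j\<in>{1..s} - u. kernel (k j) (Suc (\<tau> j)) 0) *
      (LINT t|cube_measure u. complex_of_real (F t) * (\<Prod>j\<in>u. kernel (k j) (Suc n) (t j)))"
proof -
  let ?S = "{1..s}"
  let ?PM = "cube_measure ?S \<Otimes>\<^sub>M cube_measure u"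
  interpret X: prob_space "cube_measure ?S" by (rule prob_space_cube_measure)
  interpret T: prob_space "cube_measure u" by (rule prob_space_cube_measure)
  interpret P: pair_prob_space "cube_measure ?S" "cube_measure u" ..
  define c where "c j x t = complex_of_real (if j \<in> u then truncated_power n x t else x ^ \<tau> j / fact (\<tau> j)) *
      cnj (wal1 p r \<eta> (k j) x)" for j x t
  define Q where "Q x t = complex_of_real (F t) * (\<Prod>j\<in>?S. c j (x j) (t j))" for x t
  have c_le: "norm (c j x t) \<le> 1" if "x \<in> {0..<1}" "j \<in> u \<Longrightarrow> t \<in> {0..<1}" for j x t
  proof -
    have "x ^ \<tau> j \<le> fact (\<tau> j)"
      using that by (intro order_trans[OF power_le_one fact_ge_1]) auto
    then show ?thesis
      using that truncated_power_bounds[of x t n] by (simp add: c_def norm_mult divide_le_eq)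
  qed
  have mx: "(\<lambda>z. fst z j) \<in> measurable ?PM unit_lborel" if "j \<in> ?S" for j
    by (rule measurable_compose[OF measurable_fst measurable_cube_component[OF that]])
  have mt: "(\<lambda>z. snd z j) \<in> measurable ?PM unit_lborel" if "j \<in> u" for j
    by (rule measurable_compose[OF measurable_snd measurable_cube_component[OF that]])
  have cm: "(\<lambda>z. c j (fst z j) (snd z j)) \<in> borel_measurable ?PM"
    if j: "j \<in> ?S" for j
  proof -
    note [measurable] = measurable_compose[OF mx[OF j] measurable_id_unit_lborel]
    have w: "(\<lambda>z. cnj (wal1 p r \<eta> (k j) (fst z j))) \<in> borel_measurable ?PM"
      by (rule measurable_compose[OF _ cnj_wal1_measurable]) measurable
    have "(\<lambda>z. if j \<in> u then truncated_power n (fst z j) (snd z j) else fst z j ^ \<tau> j / fact (\<tau> j))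
      \<in> borel_measurable ?PM"
    proof (cases "j \<in> u")
      case True
      have "(\<lambda>z. truncated_power n (fst z j) (snd z j)) \<in> borel_measurable ?PM"
        by (intro truncated_power_measurable measurable_compose[OF mx[OF j] measurable_id_unit_lborel]
            measurable_compose[OF mt[OF True] measurable_id_unit_lborel])
      then show ?thesis using True by (simp only: if_True)
    next
      case False
      have "(\<lambda>z. fst z j ^ \<tau> j / fact (\<tau> j)) \<in> borel_measurable ?PM"
        by (intro borel_measurable_divide borel_measurable_power borel_measurable_const
            measurable_compose[OF mx[OF j] measurable_id_unit_lborel])
      then show ?thesis using False by (simp only: if_False)
    qed
    from measurable_compose[OF this borel_measurable_of_real] w show ?thesis
      unfolding c_def by (rule borel_measurable_times)
  qed
  have int: "integrable ?PM (\<lambda>z. Q (fst z) (snd z))"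
    unfolding Q_def
  proof (rule integrable_mult_bounded[where B = 1])
    show "integrable ?PM (\<lambda>z. F (snd z))"
      by (rule integrable_pair_snd[OF X.prob_space_axioms T.prob_space_axioms F])
    show "(\<lambda>z. \<Prod>j\<in>?S. c j (fst z j) (snd z j)) \<in> borel_measurable ?PM"
      by (intro borel_measurable_prod cm)
    fix z assume "z \<in> space ?PM"
    then have z: "fst z \<in> cube ?S" "snd z \<in> cube u" by (auto simp: space_pair_measure space_cube_measure)
    show "norm (\<Prod>j\<in>?S. c j (fst z j) (snd z j)) \<le> 1"
      unfolding prod_norm[symmetric] using z by (intro prod_le_1 conjI c_le) (auto simp: cube_def PiE_iff)
  qed
  have int': "integrable ?PM (case_prod Q)"
    using int by (simp add: case_prod_unfold)
  have EQ: "complex_of_real (E x) * cnj (wal p r \<eta> s k x) = (LINT t|cube_measure u. Q x t)" for x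
  proof -
    have "Q x t = complex_of_real (F t * (\<Prod>j\<in>u. truncated_power n (x j) (t j))) *
      (complex_of_real (\<Prod>j\<in>?S - u. x j ^ \<tau> j / fact (\<tau> j)) * cnj (wal p r \<eta> s k x))" for t
    proof -
      have "(\<Prod>j\<in>?S. complex_of_real (if j \<in> u then truncated_power n (x j) (t j) else x j ^ \<tau> j / fact (\<tau> j))) =
        complex_of_real (\<Prod>j\<in>?S - u. x j ^ \<tau> j / fact (\<tau> j)) * complex_of_real (\<Prod>j\<in>u. truncated_power n (x j) (t j))"
        by (subst prod.subset_diff[OF u]) (auto simp: of_real_prod intro!: arg_cong2[where f = times] prod.cong)
      then show ?thesis
        unfolding Q_def c_def wal_def by (simp add: prod.distrib ac_simps)
    qed
    then have "(LINT t|cube_measure u. Q x t) =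
      complex_of_real (LINT t|cube_measure u. F t * (\<Prod>j\<in>u. truncated_power n (x j) (t j))) *
      (complex_of_real (\<Prod>j\<in>?S - u. x j ^ \<tau> j / fact (\<tau> j)) * cnj (wal p r \<eta> s k x))"
      by (simp only: integral_mult_left_zero integral_complex_of_real)
    then show ?thesis unfolding E_def by (simp only: of_real_mult ac_simps)
  qed
  show "integrable (cube_measure ?S) (\<lambda>x. complex_of_real (E x) * cnj (wal p r \<eta> s k x))"
    unfolding EQ using P.integrable_fst'[OF int] by simp
  have "(LINT x|cube_measure ?S. complex_of_real (E x) * cnj (wal p r \<eta> s k x)) =
    (LINT t|cube_measure u. LINT x|cube_measure ?S. Q x t)"
    unfolding EQ by (rule P.Fubini_integral[OF int', symmetric])
  also have "\<dots> = (LINT t|cube_measure u. (\<Prod>j\<in>?S - u. kernel (k j) (Suc (\<tau> j)) 0) *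
      (complex_of_real (F t) * (\<Prod>j\<in>u. kernel (k j) (Suc n) (t j))))"
  proof (intro Bochner_Integration.integral_cong refl)
    fix t assume "t \<in> space (cube_measure u)"
    then have t: "t \<in> cube u" by (simp add: space_cube_measure)
    have tj: "t j \<in> {0..<1}" if "j \<in> u" for j using t that by (auto simp: cube_def PiE_iff)
    have ci: "integrable unit_lborel (\<lambda>x. c j x (t j))" if "j \<in> ?S" for j
    proof (rule integrable_unit_lborel[where B = 1])
      show "norm (c j x (t j)) \<le> 1" if "x \<in> {0..<1}" for x using c_le[OF that tj] .
      have "(\<lambda>x. if j \<in> u then truncated_power n x (t j) else x ^ \<tau> j / fact (\<tau> j)) \<in> borel_measurable borel"
        by (cases "j \<in> u") simp_all
      from borel_measurable_times[OF measurable_compose[OF this borel_measurable_of_real] cnj_wal1_measurable]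
      have "(\<lambda>x. c j x (t j)) \<in> borel_measurable borel" unfolding c_def .
      then have "(\<lambda>x. c j x (t j)) \<in> borel_measurable lborel" by simp
      then show "(\<lambda>x. c j x (t j)) \<in> borel_measurable unit_lborel"
        by (rule measurable_restrict_space1)
    qed
    have "(LINT x|cube_measure ?S. Q x t) = complex_of_real (F t) * (\<Prod>j\<in>?S. LINT x|unit_lborel. c j x (t j))"
      unfolding Q_def cube_measure_def
      using cube.product_integral_prod[of ?S "\<lambda>j x. c j x (t j)"] ci by simp
    also have "(\<Prod>j\<in>?S. LINT x|unit_lborel. c j x (t j)) =
      (\<Prod>j\<in>?S. if j \<in> u then kernel (k j) (Suc n) (t j) else kernel (k j) (Suc (\<tau> j)) 0)"
    proof (intro prod.cong refl)
      fix j
      show "(LINT x|unit_lborel. c j x (t j)) =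
        (if j \<in> u then kernel (k j) (Suc n) (t j) else kernel (k j) (Suc (\<tau> j)) 0)"
      proof (cases "j \<in> u")
        case True
        then show ?thesis by (simp add: c_def truncated_power_def kernel_formula[OF tj])
      next
        case False
        \<comment> \<open>A monomial is the truncated power with \<open>t = 0\<close>, hence the
          kernel is evaluated at 0.\<close>
        have "kernel (k j) (Suc (\<tau> j)) 0 = (LINT x|unit_lborel. c j x (t j))"
        proof (subst kernel_formula)
          show "(LINT x|unit_lborel. complex_of_real (if 0 \<le> x then (x - 0) ^ \<tau> j / fact (\<tau> j) else 0) *
              cnj (wal1 p r \<eta> (k j) x)) = (LINT x|unit_lborel. c j x (t j))"
            by (rule Bochner_Integration.integral_cong[OF refl])
               (use False in \<open>simp add: c_def space_unit_lborel\<close>)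
        qed simp
        then show ?thesis using False by simp
      qed
    qed
    also have "\<dots> = (\<Prod>j\<in>?S - u. kernel (k j) (Suc (\<tau> j)) 0) * (\<Prod>j\<in>u. kernel (k j) (Suc n) (t j))"
      by (subst prod.subset_diff[OF u]) (auto intro!: arg_cong2[where f = times] prod.cong)
    finally show "(LINT x|cube_measure ?S. Q x t) = (\<Prod>j\<in>?S - u. kernel (k j) (Suc (\<tau> j)) 0) *
      (complex_of_real (F t) * (\<Prod>j\<in>u. kernel (k j) (Suc n) (t j)))" by (simp only: ac_simps)
  qed
  also have "\<dots> = (\<Prod>j\<in>?S - u. kernel (k j) (Suc (\<tau> j)) 0) *
      (LINT t|cube_measure u. complex_of_real (F t) * (\<Prod>j\<in>u. kernel (k j) (Suc n) (t j)))"
    by (rule integral_mult_right_zero)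
  finally show "(LINT x|cube_measure ?S. complex_of_real (E x) * cnj (wal p r \<eta> s k x)) =
    (\<Prod>j\<in>?S - u. kernel (k j) (Suc (\<tau> j)) 0) *
      (LINT t|cube_measure u. complex_of_real (F t) * (\<Prod>j\<in>u. kernel (k j) (Suc n) (t j)))" .
qed

lemma walsh_coeff_expansion:
  assumes f: "mixed_differentiable s \<delta> f" and \<delta>: "\<delta> \<ge> 1"
    and int: "\<And>\<tau>. \<tau> \<in> (\<Pi>\<^sub>E j\<in>{1..s}. {0..\<delta>}) \<Longrightarrow> integrable (cube_measure (top_vars s \<delta> \<tau>))
      (\<lambda>t. mixed_deriv s \<tau> f (zero_extend s (top_vars s \<delta> \<tau>) t))"
  shows "walsh_coeff p r \<eta> s f k = (\<Sum>\<tau>\<in>(\<Pi>\<^sub>E j\<in>{1..s}. {0..\<delta>}).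
    (\<Prod>j\<in>{1..s} - top_vars s \<delta> \<tau>. kernel (k j) (Suc (\<tau> j)) 0) *
    (LINT t|cube_measure (top_vars s \<delta> \<tau>).
       complex_of_real (mixed_deriv s \<tau> f (zero_extend s (top_vars s \<delta> \<tau>) t)) *
       (\<Prod>j\<in>top_vars s \<delta> \<tau>. kernel (k j) \<delta> (t j))))"
proof -
  let ?E = "\<lambda>\<tau> x. (\<Prod>j\<in>{1..s} - top_vars s \<delta> \<tau>. x j ^ \<tau> j / fact (\<tau> j)) *
    (LINT t|cube_measure (top_vars s \<delta> \<tau>). mixed_deriv s \<tau> f (zero_extend s (top_vars s \<delta> \<tau>) t) *
      (\<Prod>j\<in>top_vars s \<delta> \<tau>. truncated_power (\<delta> - 1) (x j) (t j)))"
  have sub: "top_vars s \<delta> \<tau> \<subseteq> {1..s}" for \<tau> by (auto simp: top_vars_def)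
  have \<delta>': "Suc (\<delta> - 1) = \<delta>" using \<delta> by simp
  have "walsh_coeff p r \<eta> s f k = (LINT x|cube_measure {1..s}.
      (\<Sum>\<tau>\<in>(\<Pi>\<^sub>E j\<in>{1..s}. {0..\<delta>}). complex_of_real (?E \<tau> x) * cnj (wal p r \<eta> s k x)))"
    unfolding walsh_coeff_def
  proof (intro Bochner_Integration.integral_cong refl)
    fix x assume "x \<in> space (cube_measure {1..s})"
    then have x: "x \<in> cube {1..s}" by (simp add: space_cube_measure)
    show "complex_of_real (f x) * cnj (wal p r \<eta> s k x) =
      (\<Sum>\<tau>\<in>(\<Pi>\<^sub>E j\<in>{1..s}. {0..\<delta>}). complex_of_real (?E \<tau> x) * cnj (wal p r \<eta> s k x))"
      by (subst taylor_expansion[OF f \<delta> x]) (simp only: of_real_sum sum_distrib_right)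
  qed
  also have "\<dots> = (\<Sum>\<tau>\<in>(\<Pi>\<^sub>E j\<in>{1..s}. {0..\<delta>}).
      LINT x|cube_measure {1..s}. complex_of_real (?E \<tau> x) * cnj (wal p r \<eta> s k x))"
    by (rule Bochner_Integration.integral_sum) (rule walsh_integrals_exchange(1)[OF int sub])
  also have "\<dots> = (\<Sum>\<tau>\<in>(\<Pi>\<^sub>E j\<in>{1..s}. {0..\<delta>}).
    (\<Prod>j\<in>{1..s} - top_vars s \<delta> \<tau>. kernel (k j) (Suc (\<tau> j)) 0) *
    (LINT t|cube_measure (top_vars s \<delta> \<tau>).
       complex_of_real (mixed_deriv s \<tau> f (zero_extend s (top_vars s \<delta> \<tau>) t)) *
       (\<Prod>j\<in>top_vars s \<delta> \<tau>. kernel (k j) \<delta> (t j))))"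
    by (intro sum.cong refl walsh_integrals_exchange(2)[OF int sub, where n = "\<delta> - 1", unfolded \<delta>'])
  finally show ?thesis .
qed

text \<open>Polynomial and remainder directions obey the same bound \<open>?R j\<close>, the former
  by \<open>kernel_at_0_bound\<close> and the latter by \<open>kernel_oscillation\<close>. Hence the
  decay in \<open>k\<close> is the same for every \<open>\<tau>\<close>.\<close>

lemma walsh_term_bound:
  assumes lam: "0 < lam" "lam \<le> 1" and pq: "\<pp> \<ge> 1" "\<qq> \<ge> 1"
    and \<tau>: "\<tau> \<in> (\<Pi>\<^sub>E j\<in>{1..s}. {0..\<delta>})"
    and b: "N_bracket s \<delta> lam \<pp> \<qq> f \<tau> = ennreal b" "b \<ge> 0"
  defines "u \<equiv> top_vars s \<delta> \<tau>"
  shows "norm ((\<Prod>j\<in>{1..s} - u. kernel (k j) (Suc (\<tau> j)) 0) *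
    (LINT t|cube_measure u. complex_of_real (mixed_deriv s \<tau> f (zero_extend s u t)) *
       (\<Prod>j\<in>u. kernel (k j) \<delta> (t j)))) \<le>
    (32 * real q ^ Suc \<delta>) ^ s * (\<Prod>j\<in>{1..s}. real q powr - mu1 q \<delta> lam (k j)) * b"
proof -
  let ?g = "\<lambda>t. mixed_deriv s \<tau> f (zero_extend s u t)"
  let ?R = "\<lambda>j. real q ^ Suc \<delta> * real q powr - mu1 q \<delta> lam (k j)"
  have u: "u \<subseteq> {1..s}" by (auto simp: u_def top_vars_def)
  then have fu: "finite u" using finite_subset by blast
  have R0: "?R j \<ge> 0" for j by simp
  have "\<forall>j. \<exists>N M. N \<ge> 1 \<and> M \<ge> 0 \<and> (\<forall>t\<in>{0..<1}. norm (kernel (k j) \<delta> t) \<le> M) \<and>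
    (N = 1 \<or> (\<forall>i<N. (LINT x:cell N i|lborel. kernel (k j) \<delta> x) = 0)) \<and>
    M * real N powr - lam \<le> ?R j"
  proof
    fix j
    show "\<exists>N M. N \<ge> 1 \<and> M \<ge> 0 \<and> (\<forall>t\<in>{0..<1}. norm (kernel (k j) \<delta> t) \<le> M) \<and>
      (N = 1 \<or> (\<forall>i<N. (LINT x:cell N i|lborel. kernel (k j) \<delta> x) = 0)) \<and>
      M * real N powr - lam \<le> ?R j"
      by (rule kernel_oscillation[OF lam, of "k j" \<delta>]) blast
  qed
  then obtain N :: "nat \<Rightarrow> nat" and M :: "nat \<Rightarrow> real" where NM: "\<And>j. N j \<ge> 1" "\<And>j. M j \<ge> 0"
    "\<And>j t. t \<in> {0..<1} \<Longrightarrow> norm (kernel (k j) \<delta> t) \<le> M j"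
    "\<And>j. N j = 1 \<or> (\<forall>i<N j. (LINT x:cell (N j) i|lborel. kernel (k j) \<delta> x) = 0)"
    "\<And>j. M j * real (N j) powr - lam \<le> ?R j"
    by metis
  have A: "norm (\<Prod>j\<in>{1..s} - u. kernel (k j) (Suc (\<tau> j)) 0) \<le> (\<Prod>j\<in>{1..s} - u. ?R j)"
    unfolding prod_norm[symmetric]
  proof (intro prod_mono conjI)
    fix j assume "j \<in> {1..s} - u"
    then have "\<tau> j \<le> \<delta>" "\<tau> j \<noteq> \<delta>" using \<tau> by (auto simp: u_def top_vars_def PiE_iff)
    then have "norm (kernel (k j) (Suc (\<tau> j)) 0) \<le> real q ^ \<delta> * real q powr - mu1 q \<delta> lam (k j)"
      by (intro kernel_at_0_bound) simp
    also have "\<dots> \<le> ?R j" using q_ge_1 by (intro mult_right_mono power_increasing) auto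
    finally show "norm (kernel (k j) (Suc (\<tau> j)) 0) \<le> ?R j" .
  qed simp
  have B: "norm (LINT t|cube_measure u. complex_of_real (?g t) * (\<Prod>j\<in>u. kernel (k j) \<delta> (t j))) \<le>
    32 ^ card u * (\<Prod>j\<in>u. ?R j) * b"
  proof (cases "u = {}")
    case True
    interpret prob_space "cube_measure {}" by (rule prob_space_cube_measure)
    have "zero_extend s {} t = (\<lambda>j\<in>{1..s}. 0)" for t by (simp add: zero_extend_def)
    moreover have "\<bar>mixed_deriv s \<tau> f (\<lambda>j\<in>{1..s}. 0)\<bar> = b"
      using b True by (simp add: N_bracket_def Let_def u_def)
    ultimately show ?thesis using True by (simp add: prob_space)
  next
    case False
    have hk: "hk_variation lam \<pp> \<qq> u ?g = ennreal b"
      using b(1) False by (simp add: N_bracket_def Let_def u_def)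
    have "norm (LINT t|cube_measure u. complex_of_real (?g t) * (\<Prod>j\<in>u. kernel (k j) \<delta> (t j))) \<le>
      32 ^ card u * (\<Prod>j\<in>u. M j * real (N j) powr - lam) * b"
      by (rule hk_variation_bound[OF fu hk b(2) pq lam, where K = "\<lambda>j. kernel (k j) \<delta>"])
         (use NM kernel_measurable in auto)
    also have "\<dots> \<le> 32 ^ card u * (\<Prod>j\<in>u. ?R j) * b"
      using NM b(2) by (intro mult_right_mono mult_left_mono prod_mono) auto
    finally show ?thesis .
  qed
  have cu: "card u \<le> s" using card_mono[OF _ u] by simp
  have "norm ((\<Prod>j\<in>{1..s} - u. kernel (k j) (Suc (\<tau> j)) 0) *
    (LINT t|cube_measure u. complex_of_real (?g t) * (\<Prod>j\<in>u. kernel (k j) \<delta> (t j)))) \<le>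
    (\<Prod>j\<in>{1..s} - u. ?R j) * (32 ^ card u * (\<Prod>j\<in>u. ?R j) * b)"
    unfolding norm_mult by (intro mult_mono A B prod_nonneg) (auto intro: R0)
  also have "\<dots> = 32 ^ card u * ((\<Prod>j\<in>{1..s} - u. ?R j) * (\<Prod>j\<in>u. ?R j)) * b" by (simp only: ac_simps)
  also have "(\<Prod>j\<in>{1..s} - u. ?R j) * (\<Prod>j\<in>u. ?R j) = (\<Prod>j\<in>{1..s}. ?R j)"
    by (rule prod.subset_diff[OF u, symmetric]) simp
  also have "32 ^ card u * (\<Prod>j\<in>{1..s}. ?R j) * b \<le> 32 ^ s * (\<Prod>j\<in>{1..s}. ?R j) * b"
    using cu b(2) by (intro mult_right_mono power_increasing prod_nonneg) auto
  also have "(\<Prod>j\<in>{1..s}. ?R j) = (real q ^ Suc \<delta>) ^ s * (\<Prod>j\<in>{1..s}. real q powr - mu1 q \<delta> lam (k j))"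
    by (simp add: prod.distrib)
  also have "32 ^ s * ((real q ^ Suc \<delta>) ^ s * (\<Prod>j\<in>{1..s}. real q powr - mu1 q \<delta> lam (k j))) * b =
    (32 * real q ^ Suc \<delta>) ^ s * (\<Prod>j\<in>{1..s}. real q powr - mu1 q \<delta> lam (k j)) * b"
    by (simp only: power_mult_distrib ac_simps)
  finally show ?thesis .
qed

end

section \<open>Weights, and the assembly of the constant\<close>

lemma powr_inverse_le_max:
  fixes a :: real
  assumes "a \<ge> 0" "r \<ge> 1"
  shows "a powr (1 / r) \<le> max 1 a"
proof (cases "a \<le> 1")
  case True
  then have "a powr (1 / r) \<le> 1 powr (1 / r)" using assms by (intro powr_mono2) auto
  then show ?thesis by simp
next
  case False
  then have "a powr (1 / r) \<le> a powr 1" using assms by (intro powr_mono) auto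
  then show ?thesis using False by simp
qed

text \<open>A positive weight bounds the bracket by its power \<open>1 / \<rr>\<close> times
  \<open>n\<close>, and \<open>max 1\<close> of the weight makes this uniform in
  \<open>\<rr>\<close>. With weight 0 a finite \<open>N_functional\<close> forces the bracket to be
  0, since a positive value divided by 0 is infinite.\<close>

lemma N_bracket_le:
  assumes N: "N_functional s \<delta> lam \<pp> \<qq> \<rr> \<gamma> f = ennreal n" "n \<ge> 0" and r: "\<rr> \<ge> 1"
    and \<tau>: "\<tau> \<in> (\<Pi>\<^sub>E j\<in>{1..s}. {0..\<delta>})" and \<gamma>: "\<gamma> (active_vars s \<tau>) \<ge> 0"
  obtains b where "N_bracket s \<delta> lam \<pp> \<qq> f \<tau> = ennreal b" "b \<ge> 0" "b \<le> max 1 (\<gamma> (active_vars s \<tau>)) * n"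
proof -
  let ?X = "\<lambda>\<tau>. epowr (N_bracket s \<delta> lam \<pp> \<qq> f \<tau>) \<rr> / ennreal (\<gamma> (active_vars s \<tau>))"
  define S where "S = (\<Sum>\<tau>\<in>(\<Pi>\<^sub>E j\<in>{1..s}. {0..\<delta>}). ?X \<tau>)"
  have NS: "epowr S (1 / \<rr>) = ennreal n" using N(1) unfolding N_functional_def S_def .
  then have "S \<noteq> \<infinity>" using epowr_eq_top_iff[of S "1 / \<rr>"] by auto
  then obtain \<sigma> where \<sigma>: "S = ennreal \<sigma>" "\<sigma> \<ge> 0" by (cases S) auto
  have n: "n = \<sigma> powr (1 / \<rr>)"
    using NS \<sigma> N(2) by (simp add: epowr_def)
  have "?X \<tau> \<le> S"
    unfolding S_def using \<tau> by (intro member_le_sum finite_PiE) auto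
  then have X: "?X \<tau> \<le> ennreal \<sigma>" using \<sigma> by simp
  let ?a = "\<gamma> (active_vars s \<tau>)"
  show ?thesis
  proof (cases "?a = 0")
    case True
    then have "epowr (N_bracket s \<delta> lam \<pp> \<qq> f \<tau>) \<rr> = 0"
      using X by (auto simp: ennreal_divide_zero top_unique split: if_splits)
    then show ?thesis using N(2) by (intro that[of 0]) (auto simp: epowr_eq_0_iff)
  next
    case False
    then have a: "?a > 0" using \<gamma> by simp
    have "N_bracket s \<delta> lam \<pp> \<qq> f \<tau> \<noteq> \<infinity>"
    proof
      assume "N_bracket s \<delta> lam \<pp> \<qq> f \<tau> = \<infinity>"
      then have "?X \<tau> = \<infinity>" using a by (simp add: epowr_def ennreal_top_divide)
      then show False using X by (simp add: top_unique)
    qed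
    then obtain b where b: "N_bracket s \<delta> lam \<pp> \<qq> f \<tau> = ennreal b" "b \<ge> 0"
      by (cases "N_bracket s \<delta> lam \<pp> \<qq> f \<tau>") auto
    have "ennreal (b powr \<rr> / ?a) \<le> ennreal \<sigma>"
      using X a b by (simp add: epowr_def divide_ennreal)
    then have "b powr \<rr> \<le> ?a * \<sigma>" using a \<sigma> by (simp add: ennreal_le_iff field_simps)
    then have "(b powr \<rr>) powr (1 / \<rr>) \<le> (?a * \<sigma>) powr (1 / \<rr>)"
      using r by (intro powr_mono2) auto
    then have "b \<le> ?a powr (1 / \<rr>) * n"
      using r b a \<sigma> n by (simp add: powr_powr powr_mult)
    also have "\<dots> \<le> max 1 ?a * n"
      using powr_inverse_le_max[OF \<gamma> r] N(2) by (intro mult_right_mono)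
    finally show ?thesis using b that by blast
  qed
qed

lemma mu1_0: "q \<ge> 2 \<Longrightarrow> mu1 q \<delta> lam 0 = 0"
  using digit_positions(1)[of q 0] by (simp add: mu1_def nat_digit_def Let_def)

text \<open>Coordinates outside \<open>u\<close> carry the index 0, where \<open>mu1\<close> is 0
  and the factor is 1.\<close>

lemma walsh_decay_eq_prod:
  assumes "q \<ge> 2" "u \<subseteq> {1..s}"
  shows "(\<Prod>j\<in>{1..s}. real q powr - mu1 q \<delta> lam (if j \<in> u then k j else 0)) = walsh_decay q \<delta> lam u k"
proof -
  have "(\<Prod>j\<in>{1..s}. real q powr - mu1 q \<delta> lam (if j \<in> u then k j else 0)) =
    (\<Prod>j\<in>u. real q powr - mu1 q \<delta> lam (k j))"
    using assms by (intro prod.mono_neutral_cong_right) (auto simp: mu1_0)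
  also have "\<dots> = real q powr (\<Sum>j\<in>u. - mu1 q \<delta> lam (k j))"
    using assms finite_subset by (subst powr_sum) auto
  finally show ?thesis by (simp add: walsh_decay_def mu_def sum_negf)
qed

text \<open>\<open>hk_variation\<close> is infinite by definition when a marginal fails to exist, so
  a finite bracket yields the integrability that Fubini needs.\<close>

lemma N_bracket_integrable:
  assumes "N_bracket s \<delta> lam \<pp> \<qq> f \<tau> \<noteq> \<infinity>"
  shows "integrable (cube_measure (top_vars s \<delta> \<tau>)) (\<lambda>t. mixed_deriv s \<tau> f (zero_extend s (top_vars s \<delta> \<tau>) t))"
proof (cases "top_vars s \<delta> \<tau> = {}")
  case True
  interpret prob_space "cube_measure {}" by (rule prob_space_cube_measure)
  show ?thesis unfolding True by (simp add: zero_extend_def)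
next
  case False
  then have "hk_variation lam \<pp> \<qq> (top_vars s \<delta> \<tau>)
      (\<lambda>t. mixed_deriv s \<tau> f (zero_extend s (top_vars s \<delta> \<tau>) t)) \<noteq> \<infinity>"
    using assms by (simp add: N_bracket_def Let_def)
  then show ?thesis
    by (intro marginals_exist_integrable) (auto simp: hk_variation_def split: if_splits)
qed

theorem corollary3p11:
  fixes p r s \<delta> :: nat
    and \<theta> :: "'a::{field,finite}"
    and \<phi> :: "nat \<Rightarrow> 'a"
    and \<gamma> :: "nat set \<Rightarrow> real"
  assumes "prime p" and "r \<ge> 1" and "CARD('a) = p ^ r"
    and "power_basis p r \<theta>"
    and "bij_betw \<phi> {0..p ^ r - 1} UNIV" and "\<phi> 0 = 0"
    and "s \<ge> 1" and "\<delta> \<ge> 1"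
    and "\<And>v. v \<subseteq> {1..} \<Longrightarrow> \<gamma> v \<ge> 0"
  shows "\<exists>C>0. \<forall>lam \<pp> \<qq> \<rr> :: real.
    0 < lam \<and> lam \<le> 1 \<and> \<pp> \<ge> 1 \<and> \<qq> \<ge> 1 \<and> \<rr> \<ge> 1 \<longrightarrow>
    (\<forall>f :: (nat \<Rightarrow> real) \<Rightarrow> real. mixed_differentiable s \<delta> f \<longrightarrow>
       walsh_norm p r (eta p r \<theta> \<phi>) s \<delta> lam \<gamma> f
         \<le> ennreal C * N_functional s \<delta> lam \<pp> \<qq> \<rr> \<gamma> f)"
proof -
  interpret walsh_system p r \<theta> \<phi> using assms by unfold_locales
  let ?A = "\<Pi>\<^sub>E j\<in>{1..s}. {0..\<delta>}"
  let ?U = "{u. u \<subseteq> {1..s} \<and> \<gamma> u \<noteq> 0}"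
  define c where "c = (32 * real q ^ Suc \<delta>) ^ s"
  define G where "G = (\<Sum>\<tau>\<in>?A. max 1 (\<gamma> (active_vars s \<tau>)))"
  \<comment> \<open>\<open>c\<close> bounds a single Taylor term and \<open>G\<close> collects the
    weights lost in passing from brackets to \<open>N_functional\<close>. The sum dominates the
    quotient for each \<open>u\<close>, and the 1 keeps \<open>C\<close> positive if all weights
    vanish. All exponents are chosen after \<open>C\<close>.\<close>
  define C where "C = 1 + (\<Sum>u\<in>?U. c * G / \<gamma> u)"
  have finU: "finite ?U" by (rule finite_subset[of _ "Pow {1..s}"]) auto
  have c0: "c \<ge> 0" by (simp add: c_def)
  have G0: "G \<ge> 0" unfolding G_def by (intro sum_nonneg) (simp add: le_max_iff_disj)
  have \<gamma>0: "\<gamma> u \<ge> 0" if "u \<subseteq> {1..s}" for u using that by (intro assms(9)) auto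
  have pos: "c * G / \<gamma> u \<ge> 0" if "u \<in> ?U" for u
    using \<gamma>0[of u] that c0 G0 by auto
  have C: "C > 0" unfolding C_def using pos by (intro add_pos_nonneg sum_nonneg) auto
  have CU: "c * G / \<gamma> u \<le> C" if "u \<in> ?U" for u
    unfolding C_def using member_le_sum[OF that, of "\<lambda>u. c * G / \<gamma> u"] pos finU by simp
  have act: "\<gamma> (active_vars s \<tau>) \<ge> 0" for \<tau>
    by (rule \<gamma>0) (auto simp: active_vars_def)
  show ?thesis
  proof (intro exI[of _ C] conjI C allI impI)
    fix lam \<pp> \<qq> \<rr> :: real and f :: "(nat \<Rightarrow> real) \<Rightarrow> real"
    assume par: "0 < lam \<and> lam \<le> 1 \<and> \<pp> \<ge> 1 \<and> \<qq> \<ge> 1 \<and> \<rr> \<ge> 1" and f: "mixed_differentiable s \<delta> f"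
    let ?N = "N_functional s \<delta> lam \<pp> \<qq> \<rr> \<gamma> f"
    show "walsh_norm p r \<eta> s \<delta> lam \<gamma> f \<le> ennreal C * ?N"
    proof (cases ?N)
      case top
      then show ?thesis using C by (simp add: ennreal_mult_top)
    next
      case (real n)
      have "\<forall>\<tau>\<in>?A. \<exists>b. N_bracket s \<delta> lam \<pp> \<qq> f \<tau> = ennreal b \<and> b \<ge> 0 \<and> b \<le> max 1 (\<gamma> (active_vars s \<tau>)) * n"
        using N_bracket_le[OF real(2,1) _ _ act] par by metis
      then obtain b where b: "\<And>\<tau>. \<tau> \<in> ?A \<Longrightarrow> N_bracket s \<delta> lam \<pp> \<qq> f \<tau> = ennreal (b \<tau>)"
        "\<And>\<tau>. \<tau> \<in> ?A \<Longrightarrow> b \<tau> \<ge> 0" "\<And>\<tau>. \<tau> \<in> ?A \<Longrightarrow> b \<tau> \<le> max 1 (\<gamma> (active_vars s \<tau>)) * n"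
        by metis
      \<comment> \<open>This bound does not involve the weight of \<open>u\<close>, which enters
        only in the final comparison with \<open>C\<close>.\<close>
      have coeff: "norm (walsh_coeff p r \<eta> s f (\<lambda>j. if j \<in> u then k j else 0)) / walsh_decay q \<delta> lam u k \<le> c * G * n"
        if u: "u \<subseteq> {1..s}" for u k
      proof -
        let ?k = "\<lambda>j. if j \<in> u then k j else 0"
        let ?D = "walsh_decay q \<delta> lam u k"
        have D: "?D > 0" using prime_gt_0_nat[OF p] by (simp add: walsh_decay_def)
        have "norm (walsh_coeff p r \<eta> s f ?k) \<le>
          (\<Sum>\<tau>\<in>?A. c * (\<Prod>j\<in>{1..s}. real q powr - mu1 q \<delta> lam (?k j)) * b \<tau>)"
          unfolding c_def
        proof (subst walsh_coeff_expansion[OF f assms(8)])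
          show "integrable (cube_measure (top_vars s \<delta> \<tau>))
              (\<lambda>t. mixed_deriv s \<tau> f (zero_extend s (top_vars s \<delta> \<tau>) t))" if "\<tau> \<in> ?A" for \<tau>
            using b(1)[OF that] by (intro N_bracket_integrable[of s \<delta> lam \<pp> \<qq>]) simp
        qed (rule sum_norm_le, rule walsh_term_bound[where \<pp> = \<pp> and \<qq> = \<qq>], use par b in auto)
        also have "\<dots> = c * ?D * (\<Sum>\<tau>\<in>?A. b \<tau>)"
          by (simp only: walsh_decay_eq_prod[OF q2 u] sum_distrib_left)
        also have "\<dots> \<le> c * ?D * (\<Sum>\<tau>\<in>?A. max 1 (\<gamma> (active_vars s \<tau>)) * n)"
          using b c0 D by (intro mult_left_mono sum_mono) auto
        also have "\<dots> = c * G * n * ?D"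
          unfolding G_def sum_distrib_right[symmetric] by (simp only: ac_simps)
        finally show ?thesis using D by (simp add: divide_le_eq)
      qed
      show ?thesis
        unfolding walsh_norm_def
      proof (rule SUP_least)
        fix u assume u: "u \<in> ?U"
        then have \<gamma>u: "\<gamma> u > 0" using \<gamma>0[of u] by auto
        let ?W = "SUP k \<in> (\<Pi>\<^sub>E j\<in>u. {1..}). ennreal
          (norm (walsh_coeff p r \<eta> s f (\<lambda>j. if j \<in> u then k j else 0)) / walsh_decay q \<delta> lam u k)"
        have "?W \<le> ennreal (c * G * n)"
          using coeff u by (intro SUP_least ennreal_leI) auto
        then have "ennreal (inverse (\<gamma> u)) * ?W \<le> ennreal (inverse (\<gamma> u)) * ennreal (c * G * n)"
          by (rule mult_left_mono) simp
        also have "\<dots> = ennreal (c * G / \<gamma> u * n)"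
          using \<gamma>u c0 G0 real by (simp add: field_simps flip: ennreal_mult)
        also have "\<dots> \<le> ennreal (C * n)"
          using CU[OF u] real by (intro ennreal_leI mult_right_mono)
        also have "\<dots> = ennreal C * ?N" using real C by (simp add: ennreal_mult)
        finally show "ennreal (inverse (\<gamma> u)) * ?W \<le> ennreal C * ?N" .
      qed
    qed
  qed
qed

end
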